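(* Let $D$ be a Go-diagram of shape $\lambda$ contained in a $k\times (n-k)$ rectangle. Let $A\in Gr_{k,n}$. Then $A$ lies in the Deodhar component $\mathcal R_D$ if and only if the following conditions are satisfied: (1) $\Delta_{I_b}(A)=0$ for all boxes $b$ in $D$ containing a white stone. (2) $\Delta_{I_b}(A)\neq 0$ for all boxes $b$ in $D$ containing a $+$. (3) $\Delta_{I(\lambda)}(A)\ne 0$. (4) $\Delta_J(A)=0$ for all $k$-subsets $J\subset[n]$ which are lexicographically smaller than $I(\lambda)$.
   Context: $\mathbb K$ is an arbitrary field, $\mathbb K^*=\mathbb K\setminus\{0\}$, $[n]=\{1,\dots,n\}$, and $Gr_{k,n}$ is the Grassmannian of $k$-dimensional subspaces of $\mathbb K^n$; a full-rank $k\times n$ matrix represents the point given by its row space. For a $k$-subset $J\subset [n]$, $\Delta_J(A)$ is the Plücker coordinate of $A$: the maximal minor, in column set $J$, of a matrix representing $A$ (well defined up to a common nonzero scalar). Partitions. A partition $\lambda$ contained in a $k\times(n-k)$ rectangle is identified with its Young diagram, aligned with the upper-left corner of the rectangle. Its southeast border is a lattice path of $n$ unit steps from the upper-right to the lower-left corner of the rectangle; label the steps $1,\dots,n$ in this order. $I(\lambda)\subset[n]$ is the set of labels of the $k$ vertical steps. The standard reading order of the boxes of $\lambda$ reads the bottom row from right to left, then the row above it from right to left, and so on; label the boxes $1,2,\dots,\ell$ in this order. Diagrams and networks. A diagram in $\lambda$ is an arbitrary filling of the boxes of $\lambda$ by pluses $+$, black stones and white stones. The network $N_D$ of a diagram $D$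 in $\lambda$ is the following weighted directed graph. There is an internal vertex for each box containing a $+$ (a $+$-vertex) or a black stone (a black vertex), and a boundary vertex $i$ for each border step labeled $i\in[n]$. From each internal vertex draw a horizontal edge to the right to the nearest $+$-vertex in its row, or, if there is none, to the boundary vertex at the right end of the row; and a vertical edge down to the nearest $+$-vertex in its column, or, if there is none, to the boundary vertex at the bottom of the column. (Edges may skip over stones and may cross without meeting.) Direct all edges left and down. The boundary vertices in $I(\lambda)$ are the sources, the others are sinks. A horizontal edge whose left vertex is a $+$-vertex in box $b$ has weight $a_b$; one whose left vertex is a black vertex in box $b$ has weight $c_b$; vertical edges have weight $1$. Weight matrix. For a directed path $P$, $w(P)$ is the product of the weights of its edges; the empty path at a boundary vertex has weight $1$. For a source $s$ and a boundary vertex $t$, let $W_{st}=(-1)^q\sum_P w(P)$, the sum being over all directed paths from $s$ to $t$, where $q$ is the number of sources strictly between $s$ and $t$. The weight matrix is the $k\times n$ matrix $W_D=(W_{st})$, with rows indexed by the sources in increasing order and columns by $1,\dots,n$. Go-diagrams. Let $s_i\in\mathfrak S_n$ be the transposition exchanging $i$ and $i+1$. The box in row $r$ (from the top) and column $c$ (from the left) of the rectangle is labeled by $s_{n-k+r-c}$; write $s_b$ for the label of box $b$. Reading the boxes $b_1,\dots,b_\ell$ of $\lambda$ in the standard reading order gives a reduced expression $\mathbf w=s_{b_1}\cdots s_{b_\ell}$ of a permutation $w$ (permutations are composed as functions). A diagram $D$ in $\lambda$ determines a subexpression $\mathbf v$ of $\mathbf w$ by replacing $s_b$ by $1$ for each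 box $b$ containing a $+$ and keeping $s_b$ for each box containing a stone. Let $v_{(0)}=1$ and let $v_{(j)}$ be the product of the first $j$ factors of $\mathbf v$. Then $D$ is a Go-diagram if (i) $\mathbf v$ is distinguished, i.e. $v_{(j)}\le v_{(j-1)}s_{b_j}$ in Bruhat order for all $j$ (equivalently, $b_j$ may contain a $+$ only if $v_{(j-1)}<v_{(j-1)}s_{b_j}$); and (ii) a stone in box $b_j$ is white if $v_{(j-1)}<v_{(j)}$ and black if $v_{(j-1)}>v_{(j)}$. Component. For a Go-diagram $D$, $\mathcal R_D\subset Gr_{k,n}$ (called the network component or Deodhar component of $D$) is the set of points represented by $W_D$ as the $a_b$ range over $\mathbb K^*$ and the $c_b$ range over $\mathbb K$. The subsets $I_b$. Put $I=I(\lambda)=w\{n,n-1,\dots,n-k+1\}$. For a box $b$ of $D$, let $\lambda_b^{\mathrm{in}}$ be the set of boxes of $\lambda$ weakly southeast of $b$ (including $b$). Let $w_b^{\mathrm{in}}$ be the product, in the standard reading order, of the $s_{b'}$ for $b'\in\lambda_b^{\mathrm{in}}$, and let $v_b^{\mathrm{in}}$ be the product, in the same order, of the corresponding factors of $\mathbf v$ (i.e. of $s_{b'}$ over those $b'\in\lambda_b^{\mathrm{in}}$ containing a stone). If $b$ contains a $+$, define $I_b=v_b^{\mathrm{in}}(w_b^{\mathrm{in}})^{-1}I$. If $b$ contains a white or black stone, define $I_b=v_b^{\mathrm{in}}s_b(w_b^{\mathrm{in}})^{-1}I$. *)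

theory Defs
  imports
    "HOL-Combinatorics.Transposition"
    "HOL-Combinatorics.Permutations"
    "Graph_Theory.Arc_Walk"
    "Jordan_Normal_Form.DL_Submatrix"
    "Jordan_Normal_Form.DL_Rank"
begin

section \<open>Grassmannian and Pluecker coordinates\<close>

definition grassmannian :: "nat \<Rightarrow> nat \<Rightarrow> 'a::field vec set set" where
  "grassmannian k n =
    {A. subspace class_ring A (module_vec TYPE('a) n) \<and>
        vectorspace.dim class_ring (module_vec TYPE('a) n\<lparr>carrier := A\<rparr>) = k}"

text \<open>For a point \<open>A\<close> of the Grassmannian, a representing matrix automatically has full rank,
  since its row space has dimension \<open>k\<close>. Representing matrices exist by the lemma below; two of
  them differ by an invertible \<open>k \<times> k\<close> matrix, so their maximal minors differ by a common
  nonzero factor.\<close>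

definition represents :: "nat \<Rightarrow> nat \<Rightarrow> 'a::field mat \<Rightarrow> 'a vec set \<Rightarrow> bool" where
  "represents k n M A \<longleftrightarrow> M \<in> carrier_mat k n \<and> vec_space.row_space n M = A"

lemma grassmannian_represented:
  assumes "A \<in> grassmannian k n"
  shows "\<exists>M. represents k n M (A :: 'a::field vec set)"
proof -
  interpret V: vec_space "TYPE('a)" n .
  have sub: "subspace class_ring A (module_vec TYPE('a) n)"
    and dim: "vectorspace.dim class_ring (module_vec TYPE('a) n\<lparr>carrier := A\<rparr>) = k"
    using assms by (auto simp: grassmannian_def)
  interpret W: vectorspace class_ring "module_vec TYPE('a) n\<lparr>carrier := A\<rparr>"
    using sub by (rule V.subspace_is_vs)
  have sm: "submodule class_ring A (module_vec TYPE('a) n)"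
    using sub by (simp add: subspace_def)
  have Ac: "A \<subseteq> carrier_vec n"
    using sm by (auto simp: submodule_def)
  have li: "finite S \<and> card S \<le> n" if "S \<subseteq> A \<and> W.lin_indpt S" for S
  proof -
    have "V.lin_indpt S"
      using V.span_li_not_depend(2)[of S A] sm that by blast
    thus ?thesis
      using V.li_le_dim[of S] that Ac V.dim_is_n by auto
  qed
  have "W.lin_indpt {}"
    by (simp add: W.lin_dep_def)
  then obtain B where B: "finite B" "maximal B (\<lambda>S. S \<subseteq> A \<and> W.lin_indpt S)"
    using maximal_exists[of "\<lambda>S. S \<subseteq> A \<and> W.lin_indpt S" n "{}"] li by blast
  have basis: "W.basis B"
    using B(2) by (intro W.max_li_is_basis) simp
  have card: "card B = k"
    using W.dim_basis[OF B(1) basis] dim by simp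
  have BA: "B \<subseteq> A"
    using basis by (simp add: W.basis_def)
  have "W.span B = A"
    using basis by (simp add: W.basis_def)
  hence span: "V.span B = A"
    using V.span_li_not_depend(1)[OF BA sm] by simp
  obtain vs where vs: "set vs = B" "distinct vs"
    using B(1) finite_distinct_list by blast
  have "length vs = k" using vs card distinct_card by metis
  moreover have "rows (mat_of_rows n vs) = vs"
    using vs BA Ac by (intro rows_mat_of_rows) auto
  ultimately have "represents k n (mat_of_rows n vs) A"
    using span vs by (auto simp: represents_def V.row_space_def)
  thus ?thesis ..
qed

text \<open>Columns are labelled by \<open>1, \<dots>, n\<close>, whereas matrix indices start from \<open>0\<close>.\<close>

definition pluecker :: "'a::field mat \<Rightarrow> nat set \<Rightarrow> 'a" where
  "pluecker M J = det (submatrix M UNIV {j. Suc j \<in> J})"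

definition lex_less :: "nat set \<Rightarrow> nat set \<Rightarrow> bool" where
  "lex_less J K \<longleftrightarrow> (sorted_list_of_set J, sorted_list_of_set K) \<in> lexord less_than"


section \<open>Partitions\<close>

text \<open>A partition is given by its row lengths \<open>lam 1, \<dots>, lam k\<close>; other values of \<open>lam\<close> are
  irrelevant. Boxes are pairs (row, column), rows counted from the top and columns from the
  left, both starting from \<open>1\<close>.\<close>

type_synonym box = "nat \<times> nat"

definition partition_in_rect :: "nat \<Rightarrow> nat \<Rightarrow> (nat \<Rightarrow> nat) \<Rightarrow> bool" where
  "partition_in_rect k m lam \<longleftrightarrow>
     (\<forall>r\<in>{1..k}. lam r \<le> m) \<and> (\<forall>r\<in>{1..k}. \<forall>r'\<in>{r..k}. lam r' \<le> lam r)"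

definition boxes :: "nat \<Rightarrow> (nat \<Rightarrow> nat) \<Rightarrow> box set" where
  "boxes k lam = {(r, c). 1 \<le> r \<and> r \<le> k \<and> 1 \<le> c \<and> c \<le> lam r}"

definition col_length :: "nat \<Rightarrow> (nat \<Rightarrow> nat) \<Rightarrow> nat \<Rightarrow> nat" where
  "col_length k lam c = card {r\<in>{1..k}. c \<le> lam r}"

text \<open>On the border path from the upper-right corner, the vertical step at the end of row \<open>r\<close> is
  preceded by the \<open>r - 1\<close> vertical steps of the rows above it and by the \<open>n - k - lam r\<close>
  horizontal steps of the columns to its right; the horizontal step at the bottom of column \<open>c\<close>
  is preceded by \<open>n - k - c\<close> horizontal and \<open>col_length k lam c\<close> vertical steps.\<close>

definition row_label :: "nat \<Rightarrow> nat \<Rightarrow> (nat \<Rightarrow> nat) \<Rightarrow> nat \<Rightarrow> nat" where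
  "row_label n k lam r = (n - k - lam r) + (r - 1) + 1"

definition col_label :: "nat \<Rightarrow> nat \<Rightarrow> (nat \<Rightarrow> nat) \<Rightarrow> nat \<Rightarrow> nat" where
  "col_label n k lam c = (n - k - c) + col_length k lam c + 1"

definition source_set :: "nat \<Rightarrow> nat \<Rightarrow> (nat \<Rightarrow> nat) \<Rightarrow> nat set" where
  "source_set n k lam = row_label n k lam ` {1..k}"

definition reading_order :: "nat \<Rightarrow> (nat \<Rightarrow> nat) \<Rightarrow> box list" where
  "reading_order k lam =
     concat (map (\<lambda>r. map (\<lambda>c. (r, c)) (rev [1..<Suc (lam r)])) (rev [1..<Suc k]))"


section \<open>Diagrams and networks\<close>

datatype filling = Plus | Black | White

text \<open>A diagram in \<open>lam\<close> is a function \<^typ>\<open>box \<Rightarrow> filling\<close>, of which only the values on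
  \<open>boxes k lam\<close> matter.\<close>

datatype vertex = Inner box | Boundary nat

text \<open>\<open>Horiz b\<close> is the horizontal edge drawn to the right from the internal vertex in box \<open>b\<close>, so
  \<open>b\<close> is its left end; \<open>Vert b\<close> is the vertical edge drawn down from \<open>b\<close>.\<close>

datatype edge = Horiz box | Vert box

definition internal_boxes :: "nat \<Rightarrow> (nat \<Rightarrow> nat) \<Rightarrow> (box \<Rightarrow> filling) \<Rightarrow> box set" where
  "internal_boxes k lam D = {b \<in> boxes k lam. D b = Plus \<or> D b = Black}"

definition right_end ::
  "nat \<Rightarrow> nat \<Rightarrow> (nat \<Rightarrow> nat) \<Rightarrow> (box \<Rightarrow> filling) \<Rightarrow> box \<Rightarrow> vertex" where
  "right_end n k lam D = (\<lambda>(r, c).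
     let C = {c'. c < c' \<and> (r, c') \<in> boxes k lam \<and> D (r, c') = Plus}
     in if C = {} then Boundary (row_label n k lam r) else Inner (r, Min C))"

definition lower_end ::
  "nat \<Rightarrow> nat \<Rightarrow> (nat \<Rightarrow> nat) \<Rightarrow> (box \<Rightarrow> filling) \<Rightarrow> box \<Rightarrow> vertex" where
  "lower_end n k lam D = (\<lambda>(r, c).
     let R = {r'. r < r' \<and> (r', c) \<in> boxes k lam \<and> D (r', c) = Plus}
     in if R = {} then Boundary (col_label n k lam c) else Inner (Min R, c))"

definition network ::
  "nat \<Rightarrow> nat \<Rightarrow> (nat \<Rightarrow> nat) \<Rightarrow> (box \<Rightarrow> filling) \<Rightarrow> (vertex, edge) pre_digraph" where
  "network n k lam D =
    \<lparr>verts = Inner ` internal_boxes k lam D \<union> Boundary ` {1..n},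
     arcs = Horiz ` internal_boxes k lam D \<union> Vert ` internal_boxes k lam D,
     tail = case_edge (right_end n k lam D) Inner,
     head = case_edge Inner (lower_end n k lam D)\<rparr>"

definition edge_weight ::
  "(box \<Rightarrow> filling) \<Rightarrow> (box \<Rightarrow> 'a::field) \<Rightarrow> (box \<Rightarrow> 'a) \<Rightarrow> edge \<Rightarrow> 'a" where
  "edge_weight D a c e =
     (case e of Horiz b \<Rightarrow> (if D b = Plus then a b else c b) | Vert b \<Rightarrow> 1)"

definition path_weight ::
  "(box \<Rightarrow> filling) \<Rightarrow> (box \<Rightarrow> 'a::field) \<Rightarrow> (box \<Rightarrow> 'a) \<Rightarrow> edge list \<Rightarrow> 'a" where
  "path_weight D a c p = prod_list (map (edge_weight D a c) p)"

definition weight_entry ::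
  "nat \<Rightarrow> nat \<Rightarrow> (nat \<Rightarrow> nat) \<Rightarrow> (box \<Rightarrow> filling) \<Rightarrow> (box \<Rightarrow> 'a::field) \<Rightarrow> (box \<Rightarrow> 'a) \<Rightarrow>
   nat \<Rightarrow> nat \<Rightarrow> 'a" where
  "weight_entry n k lam D a c s t =
     (-1) ^ card {i \<in> source_set n k lam. s < i \<and> i < t \<or> t < i \<and> i < s} *
     (\<Sum>p | pre_digraph.apath (network n k lam D) (Boundary s) p (Boundary t).
        path_weight D a c p)"

definition weight_matrix ::
  "nat \<Rightarrow> nat \<Rightarrow> (nat \<Rightarrow> nat) \<Rightarrow> (box \<Rightarrow> filling) \<Rightarrow> (box \<Rightarrow> 'a::field) \<Rightarrow> (box \<Rightarrow> 'a) \<Rightarrow> 'a mat"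
  where
  "weight_matrix n k lam D a c =
     mat k n (\<lambda>(i, j). weight_entry n k lam D a c
                         (sorted_list_of_set (source_set n k lam) ! i) (Suc j))"

definition deodhar_component ::
  "nat \<Rightarrow> nat \<Rightarrow> (nat \<Rightarrow> nat) \<Rightarrow> (box \<Rightarrow> filling) \<Rightarrow> 'a::field vec set set" where
  "deodhar_component n k lam D =
     {A \<in> grassmannian k n. \<exists>a c. (\<forall>b \<in> boxes k lam. D b = Plus \<longrightarrow> a b \<noteq> 0) \<and>
                              represents k n (weight_matrix n k lam D a c) A}"


section \<open>Bruhat order and Go-diagrams\<close>

text \<open>Permutations of \<open>[n]\<close> are functions on \<^typ>\<open>nat\<close> fixing everything outside \<open>{1..n}\<close>. Their
  Coxeter length is the number of inversions.\<close>

definition perm_length :: "nat \<Rightarrow> (nat \<Rightarrow> nat) \<Rightarrow> nat" where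
  "perm_length n u = card {(i, j). 1 \<le> i \<and> i < j \<and> j \<le> n \<and> u j < u i}"

definition bruhat_step :: "nat \<Rightarrow> (nat \<Rightarrow> nat) \<Rightarrow> (nat \<Rightarrow> nat) \<Rightarrow> bool" where
  "bruhat_step n u v \<longleftrightarrow> u permutes {1..n} \<and> perm_length n u < perm_length n v \<and>
     (\<exists>i j. 1 \<le> i \<and> i < j \<and> j \<le> n \<and> v = u \<circ> transpose i j)"

definition bruhat_le :: "nat \<Rightarrow> (nat \<Rightarrow> nat) \<Rightarrow> (nat \<Rightarrow> nat) \<Rightarrow> bool" where
  "bruhat_le n = (bruhat_step n)\<^sup>*\<^sup>*"

definition bruhat_less :: "nat \<Rightarrow> (nat \<Rightarrow> nat) \<Rightarrow> (nat \<Rightarrow> nat) \<Rightarrow> bool" where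
  "bruhat_less n u v \<longleftrightarrow> bruhat_le n u v \<and> u \<noteq> v"

definition box_refl :: "nat \<Rightarrow> nat \<Rightarrow> box \<Rightarrow> nat \<Rightarrow> nat" where
  "box_refl n k = (\<lambda>(r, c). let i = n - k + r - c in transpose i (i + 1))"

definition v_factor :: "nat \<Rightarrow> nat \<Rightarrow> (box \<Rightarrow> filling) \<Rightarrow> box \<Rightarrow> nat \<Rightarrow> nat" where
  "v_factor n k D b = (if D b = Plus then id else box_refl n k b)"

definition perm_prod :: "(nat \<Rightarrow> nat) list \<Rightarrow> nat \<Rightarrow> nat" where
  "perm_prod us = foldr (\<circ>) us id"

definition v_prefix ::
  "nat \<Rightarrow> nat \<Rightarrow> (nat \<Rightarrow> nat) \<Rightarrow> (box \<Rightarrow> filling) \<Rightarrow> nat \<Rightarrow> nat \<Rightarrow> nat" where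
  "v_prefix n k lam D j = perm_prod (map (v_factor n k D) (take j (reading_order k lam)))"

text \<open>The boxes \<open>b\<^sub>1, \<dots>, b\<^sub>l\<close> are the list entries with indices \<open>0, \<dots>, l - 1\<close>.\<close>

definition distinguished ::
  "nat \<Rightarrow> nat \<Rightarrow> (nat \<Rightarrow> nat) \<Rightarrow> (box \<Rightarrow> filling) \<Rightarrow> bool" where
  "distinguished n k lam D \<longleftrightarrow>
     (\<forall>j < length (reading_order k lam).
        bruhat_le n (v_prefix n k lam D (Suc j))
                    (v_prefix n k lam D j \<circ> box_refl n k (reading_order k lam ! j)))"

definition go_diagram ::
  "nat \<Rightarrow> nat \<Rightarrow> (nat \<Rightarrow> nat) \<Rightarrow> (box \<Rightarrow> filling) \<Rightarrow> bool" where
  "go_diagram n k lam D \<longleftrightarrow> distinguished n k lam D \<and>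
     (\<forall>j < length (reading_order k lam).
        let b = reading_order k lam ! j; v = v_prefix n k lam D j; v' = v_prefix n k lam D (Suc j)
        in D b \<noteq> Plus \<longrightarrow>
             (bruhat_less n v v' \<longrightarrow> D b = White) \<and> (bruhat_less n v' v \<longrightarrow> D b = Black))"


section \<open>The subsets attached to the boxes\<close>

definition in_boxes :: "nat \<Rightarrow> (nat \<Rightarrow> nat) \<Rightarrow> box \<Rightarrow> box list" where
  "in_boxes k lam b =
     filter (\<lambda>b'. fst b \<le> fst b' \<and> snd b \<le> snd b') (reading_order k lam)"

definition w_in :: "nat \<Rightarrow> nat \<Rightarrow> (nat \<Rightarrow> nat) \<Rightarrow> box \<Rightarrow> nat \<Rightarrow> nat" where
  "w_in n k lam b = perm_prod (map (box_refl n k) (in_boxes k lam b))"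

definition v_in ::
  "nat \<Rightarrow> nat \<Rightarrow> (nat \<Rightarrow> nat) \<Rightarrow> (box \<Rightarrow> filling) \<Rightarrow> box \<Rightarrow> nat \<Rightarrow> nat" where
  "v_in n k lam D b = perm_prod (map (v_factor n k D) (in_boxes k lam b))"

definition box_set ::
  "nat \<Rightarrow> nat \<Rightarrow> (nat \<Rightarrow> nat) \<Rightarrow> (box \<Rightarrow> filling) \<Rightarrow> box \<Rightarrow> nat set" where
  "box_set n k lam D b =
     (if D b = Plus
      then (v_in n k lam D b \<circ> inv_into UNIV (w_in n k lam b)) ` source_set n k lam
      else (v_in n k lam D b \<circ> box_refl n k b \<circ> inv_into UNIV (w_in n k lam b)) ` source_set n k lam)"

end

theory Submission
  imports Defs
begin

text \<open>Push the coordinate vectors \<open>e\<^sub>1, \<dots>, e\<^sub>n\<close>, one for each step of the southeast border, through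
  the boxes towards the northwest: each box turns the vectors on its right and lower edge into
  vectors on its left and upper edge by the inverse of the transfer rule of the network. The
  permutations \<open>v\<^sub>(\<^sub>j\<^sub>)\<close> are the same process for labels, and for a Go-diagram the vector on an edge is
  a nonzero multiple of the coordinate vector of its label plus coordinate vectors of smaller
  labels. Project along a point given in reduced echelon form onto the non-pivot coordinates. The
  point lies in the component iff in each box \<open>b\<close> of column \<open>j\<close> the parameter can be chosen so that
  the projected vector on the left edge loses its \<open>j\<close>-th coordinate. This determines the parameters
  box by box: the coordinate \<open>x\<^sub>b\<close> on the right edge must vanish for a white stone and must not
  vanish for a plus. Triangularity with respect to the labels shows that \<open>x\<^sub>b\<close> is a nonzero multiple
  of the Pluecker coordinate at \<open>I\<^sub>b\<close> whenever the boxes southeast of \<open>b\<close> are already consistent.\<close>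

section \<open>Maximal minors and representing matrices\<close>

text \<open>A single minor at \<open>I_b\<close> mixes many parameters; it isolates the one of
  \<open>b\<close> only after the boxes southeast of \<open>b\<close> have been settled. Both
  directions therefore share one local statement, used along the southeast order: for a weight
  matrix consistency of all boxes is known beforehand, while from the minors it is derived box by
  box. The inverse rule is used because \<open>I_b\<close> is determined from the southeast border,
  where the vectors are unit vectors, whereas path sums are built up from the left border. At a plus
  the left vector is \<open>h / p + v\<close>, and the condition that the subexpression is
  distinguished says precisely that \<open>v\<close> has the larger label, so the lead is
  predictable; a black stone accepts any parameter and hence imposes no condition. Conditions (3)
  and (4) provide a reduced echelon form with pivots in \<open>I(lambda)\<close>. A weight matrix
  has this form already, so membership becomes an equation between matrices instead of one between
  row spaces. The main obstacle is that \<open>I_b\<close> also contains the pivots of the rows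
  above \<open>b\<close>, whose remaining entries are arbitrary at that stage; the triangularity
  argument needs a modified order of the columns.\<close>

lemma bij_betw_pick_labels:
  assumes "J \<subseteq> {1..n}" "card J = k"
  shows "bij_betw (\<lambda>j. Suc (pick {j. Suc j \<in> J} j)) {0..<k} J"
proof -
  let ?S = "{j. Suc j \<in> J}"
  have img: "Suc ` ?S = J"
  proof
    show "J \<subseteq> Suc ` ?S"
    proof
      fix x assume "x \<in> J"
      with assms obtain y where "x = Suc y" by (cases x) auto
      thus "x \<in> Suc ` ?S" using \<open>x \<in> J\<close> by auto
    qed
  qed auto
  hence cS: "card ?S = k" using assms card_image[of Suc ?S] by simp
  have inj: "inj_on (\<lambda>j. Suc (pick ?S j)) {0..<k}"
  proof (rule inj_onI)
    fix x y assume "x \<in> {0..<k}" "y \<in> {0..<k}" "Suc (pick ?S x) = Suc (pick ?S y)"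
    thus "x = y" using pick_mono_le[of x ?S y] pick_mono_le[of y ?S x] cS
      by (cases x y rule: linorder_cases) auto
  qed
  have sub: "(\<lambda>j. Suc (pick ?S j)) ` {0..<k} \<subseteq> J"
    using pick_in_set_le[of _ ?S] cS by auto
  moreover have "finite J" using assms(1) finite_subset by blast
  ultimately have "(\<lambda>j. Suc (pick ?S j)) ` {0..<k} = J"
    using card_image[OF inj] assms(2) by (intro card_subset_eq) auto
  thus ?thesis using inj by (simp add: bij_betw_def)
qed

lemma pluecker_eq_det:
  assumes "B \<in> carrier_mat k n" "J \<subseteq> {1..n}" "card J = k"
  shows "pluecker B J = det (mat k k (\<lambda>(i, j). B $$ (i, pick {j. Suc j \<in> J} j)))"
proof -
  have "{j. j < n \<and> Suc j \<in> J} = {j. Suc j \<in> J}" using assms(2) by auto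
  moreover have "card {j. Suc j \<in> J} = k"
  proof -
    have "Suc ` {j. Suc j \<in> J} = J"
      using assms(2) by (auto simp: image_iff) (metis Suc_pred atLeastAtMost_iff less_eq_Suc_le subsetD One_nat_def)
    thus ?thesis using assms(3) card_image[of Suc "{j. Suc j \<in> J}"] by simp
  qed
  ultimately show ?thesis using assms(1)
    unfolding pluecker_def submatrix_def by (simp add: pick_UNIV)
qed

lemma pluecker_mult:
  assumes "X \<in> carrier_mat k k" "B \<in> carrier_mat k n" "J \<subseteq> {1..n}" "card J = k"
  shows "pluecker (X * B) J = det X * pluecker B J"
proof -
  let ?p = "pick {j. Suc j \<in> J}"
  have p: "?p j < n" if "j < k" for j
    using bij_betw_pick_labels[OF assms(3,4)] assms(3) that
    by (fastforce simp: bij_betw_def)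
  have "mat k k (\<lambda>(i, j). (X * B) $$ (i, ?p j)) = X * mat k k (\<lambda>(i, j). B $$ (i, ?p j))"
    by (rule eq_matI) (use assms p in \<open>auto simp: scalar_prod_def\<close>)
  moreover have "X * B \<in> carrier_mat k n" using assms by simp
  ultimately show ?thesis
    using assms det_mult[of X k "mat k k (\<lambda>(i, j). B $$ (i, ?p j))"]
    by (simp add: pluecker_eq_det[of _ k n])
qed

lemma pluecker_leibniz:
  assumes "B \<in> carrier_mat k n" "J \<subseteq> {1..n}" "card J = k"
  shows "pluecker B J = (\<Sum>p | p permutes {0..<k}.
           signof p * (\<Prod>i = 0..<k. B $$ (i, pick {j. Suc j \<in> J} (p i))))"
proof -
  have "signof p * (\<Prod>i = 0..<k. mat k k (\<lambda>(i, j). B $$ (i, pick {j. Suc j \<in> J} j)) $$ (i, p i)) =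
        signof p * (\<Prod>i = 0..<k. B $$ (i, pick {j. Suc j \<in> J} (p i)))" if "p permutes {0..<k}" for p
  proof -
    have "p i < k" if "i < k" for i using permutes_in_image[OF \<open>p permutes {0..<k}\<close>] that by auto
    thus ?thesis by (intro arg_cong2[where f = "(*)"] prod.cong) auto
  qed
  thus ?thesis unfolding pluecker_eq_det[OF assms] by (subst det_def'[of _ k]) auto
qed

lemma pluecker_nonzeroD:
  assumes "B \<in> carrier_mat k n" "J \<subseteq> {1..n}" "card J = k" "pluecker B J \<noteq> 0"
  obtains \<sigma> where "bij_betw \<sigma> {0..<k} J" "\<And>i. i < k \<Longrightarrow> B $$ (i, \<sigma> i - 1) \<noteq> 0"
proof -
  let ?p = "\<lambda>j. Suc (pick {j. Suc j \<in> J} j)"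
  obtain p where p: "p permutes {0..<k}"
    "signof p * (\<Prod>i = 0..<k. B $$ (i, pick {j. Suc j \<in> J} (p i))) \<noteq> 0"
    using assms(4) unfolding pluecker_leibniz[OF assms(1-3)]
    by (metis (mono_tags, lifting) mem_Collect_eq sum.neutral)
  show thesis
  proof (rule that[of "?p \<circ> p"])
    show "bij_betw (?p \<circ> p) {0..<k} J"
      using permutes_imp_bij[OF p(1)] bij_betw_pick_labels[OF assms(2,3)] by (rule bij_betw_trans)
    show "B $$ (i, (?p \<circ> p) i - 1) \<noteq> 0" if "i < k" for i
      using p(2) that by auto
  qed
qed

text \<open>Only one term of the Leibniz expansion survives, so nothing can cancel it.\<close>

lemma pluecker_nonzeroI:
  fixes B :: "'a::field mat"
  assumes B: "B \<in> carrier_mat k n" and J: "J \<subseteq> {1..n}" "card J = k"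
    and l: "bij_betw l {0..<k} J" "\<And>i. i < k \<Longrightarrow> B $$ (i, l i - 1) \<noteq> 0"
    and uniq: "\<And>\<sigma>. bij_betw \<sigma> {0..<k} J \<Longrightarrow> (\<And>i. i < k \<Longrightarrow> B $$ (i, \<sigma> i - 1) \<noteq> 0) \<Longrightarrow>
                 \<forall>i<k. \<sigma> i = l i"
  shows "pluecker B J \<noteq> 0"
proof -
  let ?p = "\<lambda>j. Suc (pick {j. Suc j \<in> J} j)"
  let ?f = "\<lambda>p. signof p * (\<Prod>i = 0..<k. B $$ (i, pick {j. Suc j \<in> J} (p i)))"
  have bp: "bij_betw ?p {0..<k} J" using bij_betw_pick_labels[OF J] .
  \<comment> \<open>\<open>l\<close> chooses columns of \<open>J\<close>; \<open>q\<close> is the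
    same choice as a permutation of row indices, through the increasing enumeration
    \<open>?p\<close> of \<open>J\<close>.\<close>
  define q where "q i = (if i < k then the_inv_into {0..<k} ?p (l i) else i)" for i
  have pq: "?p (q i) = l i" if "i < k" for i
    using that f_the_inv_into_f_bij_betw[OF bp, of "l i"] l(1) by (auto simp: q_def bij_betw_def)
  have "bij_betw (the_inv_into {0..<k} ?p \<circ> l) {0..<k} {0..<k}"
    using l(1) bij_betw_the_inv_into[OF bp] by (rule bij_betw_trans)
  hence "bij_betw q {0..<k} {0..<k}"
    by (rule bij_betw_cong[THEN iffD1, rotated]) (auto simp: q_def)
  hence q: "q permutes {0..<k}" by (rule bij_imp_permutes) (auto simp: q_def)
  have "?f p = 0" if p: "p permutes {0..<k}" "p \<noteq> q" for p
  proof (rule ccontr)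
    assume nz: "?f p \<noteq> 0"
    have "bij_betw (?p \<circ> p) {0..<k} J"
      using permutes_imp_bij[OF p(1)] bp by (rule bij_betw_trans)
    moreover have "B $$ (i, (?p \<circ> p) i - 1) \<noteq> 0" if "i < k" for i using nz that by auto
    ultimately have eq: "\<forall>i<k. ?p (p i) = l i" using uniq by fastforce
    have "p i = q i" for i
    proof (cases "i < k")
      case True
      hence "?p (p i) = ?p (q i)" using eq pq by simp
      moreover have "p i \<in> {0..<k}" "q i \<in> {0..<k}"
        using True permutes_in_image[OF p(1)] permutes_in_image[OF q] by auto
      ultimately show ?thesis using bp by (auto simp: bij_betw_def inj_on_def)
    next
      case False thus ?thesis using permutes_not_in[OF p(1)] permutes_not_in[OF q] by auto
    qed
    thus False using p(2) by auto
  qed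
  hence "pluecker B J = ?f q"
    unfolding pluecker_leibniz[OF B J] using q
    by (subst sum.remove[of _ q]) (simp_all add: finite_permutations sum.neutral)
  moreover have "B $$ (i, pick {j. Suc j \<in> J} (q i)) \<noteq> 0" if "i < k" for i
    using l(2)[OF that] pq[OF that] by (metis diff_Suc_1)
  ultimately show ?thesis by (auto simp: sign_def)
qed

text \<open>Triangularity for a column order \<open>rk\<close> of one's choice. A transversal
  \<open>\<sigma>\<close> of nonzero entries has rank at most that of \<open>l\<close> in each row,
  and both have the same total rank over \<open>J\<close>, so no inequality is strict.\<close>

lemma pluecker_nonzero_if_lead:
  fixes rk :: "nat \<Rightarrow> nat" and B :: "'a::field mat"
  assumes B: "B \<in> carrier_mat k n" and J: "J \<subseteq> {1..n}" "card J = k"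
    and l: "bij_betw l {0..<k} J" "\<And>i. i < k \<Longrightarrow> B $$ (i, l i - 1) \<noteq> 0"
    and rk: "inj_on rk J"
      "\<And>i t. i < k \<Longrightarrow> t \<in> J \<Longrightarrow> B $$ (i, t - 1) \<noteq> 0 \<Longrightarrow> rk t \<le> rk (l i)"
  shows "pluecker B J \<noteq> 0"
proof (rule pluecker_nonzeroI[OF B J l], simp)
  fix \<sigma> assume s: "bij_betw \<sigma> {0..<k} J" "\<And>i. i < k \<Longrightarrow> B $$ (i, \<sigma> i - 1) \<noteq> 0"
  have le: "rk (\<sigma> i) \<le> rk (l i)" if "i < k" for i
    using rk(2)[OF that _ s(2)[OF that]] s(1) that by (auto simp: bij_betw_def)
  have "(\<Sum>i = 0..<k. rk (\<sigma> i)) = (\<Sum>i = 0..<k. rk (l i))"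
    using sum.reindex_bij_betw[OF s(1), of rk] sum.reindex_bij_betw[OF l(1), of rk] by simp
  hence "rk (\<sigma> i) = rk (l i)" if "i < k" for i
    using sum_strict_mono_ex1[of "{0..<k}" "\<lambda>i. rk (\<sigma> i)" "\<lambda>i. rk (l i)"] le that
    by (metis atLeastLessThan_iff finite_atLeastLessThan le_neq_implies_less less_irrefl zero_le)
  moreover have "\<sigma> i \<in> J" "l i \<in> J" if "i < k" for i
    using s(1) l(1) that by (auto simp: bij_betw_def)
  ultimately show "\<forall>i<k. \<sigma> i = l i" using rk(1) by (auto simp: inj_on_def)
qed

text \<open>The same rank count: the leads \<open>l'\<close> bound every transversal of nonzero
  entries, and their total rank falls short of that of \<open>J\<close>.\<close>

lemma pluecker_zero_if_lead:
  fixes rk :: "nat \<Rightarrow> nat" and B :: "'a::field mat"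
  assumes B: "B \<in> carrier_mat k n" and J: "J \<subseteq> {1..n}" "card J = k"
    and l: "bij_betw l {0..<k} J"
    and rk: "\<And>i t. i < k \<Longrightarrow> t \<in> J \<Longrightarrow> B $$ (i, t - 1) \<noteq> 0 \<Longrightarrow> rk t \<le> rk (l' i)"
    and le: "\<And>i. i < k \<Longrightarrow> rk (l' i) \<le> rk (l i)" and less: "i0 < k" "rk (l' i0) < rk (l i0)"
  shows "pluecker B J = 0"
proof (rule ccontr)
  assume "pluecker B J \<noteq> 0"
  then obtain \<sigma> where s: "bij_betw \<sigma> {0..<k} J" "\<And>i. i < k \<Longrightarrow> B $$ (i, \<sigma> i - 1) \<noteq> 0"
    using pluecker_nonzeroD[OF B J] by metis
  have "rk (\<sigma> i) \<le> rk (l' i)" if "i < k" for i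
    using rk[OF that _ s(2)[OF that]] s(1) that by (auto simp: bij_betw_def)
  hence "(\<Sum>i = 0..<k. rk (\<sigma> i)) < (\<Sum>i = 0..<k. rk (l i))"
    using le less by (intro sum_strict_mono_ex1) (meson atLeastLessThan_iff order.trans le_less_trans zero_le finite_atLeastLessThan)+
  thus False
    using sum.reindex_bij_betw[OF s(1), of rk] sum.reindex_bij_betw[OF l(1), of rk] by simp
qed

section \<open>Matrices with the same row space\<close>

lemma represents_factor:
  fixes M M' :: "'a::field mat"
  assumes "represents k n M A" "represents k n M' A"
  obtains X where "X \<in> carrier_mat k k" "M = X * M'"
proof -
  have M: "M \<in> carrier_mat k n" "M' \<in> carrier_mat k n"
    and eq: "vec_space.row_space n M = vec_space.row_space n M'"
    using assms by (auto simp: represents_def)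
  interpret vec_space "TYPE('a)" n .
  have "\<exists>y \<in> carrier_vec k. transpose_mat M' *\<^sub>v y = row M i" if "i < k" for i
  proof -
    have "row M i \<in> row_space M"
      unfolding row_space_def using M that
      by (intro set_mp[OF in_own_span]) (auto simp: rows_def)
    thus ?thesis using eq row_space_eq[OF M(2)] M by auto
  qed
  then obtain y where y: "\<And>i. i < k \<Longrightarrow> y i \<in> carrier_vec k \<and> transpose_mat M' *\<^sub>v y i = row M i"
    by metis
  let ?X = "mat k k (\<lambda>(i, j). y i $ j)"
  have "M = ?X * M'"
  proof (rule eq_matI)
    fix i j assume ij: "i < dim_row (?X * M')" "j < dim_col (?X * M')"
    hence i: "i < k" "j < n" using M by auto
    have "M $$ (i, j) = (transpose_mat M' *\<^sub>v y i) $ j" using y[OF i(1)] M i by simp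
    also have "\<dots> = (?X * M') $$ (i, j)"
      using M i carrier_vecD[OF conjunct1[OF y[OF i(1)]]]
      by (simp add: scalar_prod_def mult.commute)
    finally show "M $$ (i, j) = (?X * M') $$ (i, j)" .
  qed (use M in auto)
  thus thesis by (intro that[of ?X]) auto
qed

lemma represents_mult:
  fixes M :: "'a::field mat"
  assumes "represents k n M A" "X \<in> carrier_mat k k" "det X \<noteq> 0"
  shows "represents k n (X * M) A"
proof -
  have M: "M \<in> carrier_mat k n" using assms by (auto simp: represents_def)
  have "X \<in> Units (ring_mat TYPE('a) k ())"
    using det_non_zero_imp_unit[OF assms(2,3)] .
  hence "invertible_mat X"
    using assms(2) unfolding Units_def invertible_mat_def inverts_mat_def
    by (auto simp: ring_mat_simps square_mat.simps)
  thus ?thesis using vec_space.row_space_is_preserved[OF _ assms(2) M] assms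
    by (auto simp: represents_def)
qed

text \<open>The transition matrices in both directions multiply the minor at
  \<open>J\<^sub>0\<close> by \<open>det Y * det X\<close> and return the same nonzero value, so
  \<open>det X\<close> is nonzero; no separate rank argument is made.\<close>

lemma represents_pluecker:
  fixes M M' :: "'a::field mat"
  assumes M: "represents k n M A" "represents k n M' A"
    and J0: "J\<^sub>0 \<subseteq> {1..n}" "card J\<^sub>0 = k" "pluecker M' J\<^sub>0 \<noteq> 0"
    and J: "J \<subseteq> {1..n}" "card J = k"
  shows "pluecker M J = 0 \<longleftrightarrow> pluecker M' J = 0"
proof -
  have c: "M \<in> carrier_mat k n" "M' \<in> carrier_mat k n" using M by (auto simp: represents_def)
  obtain X where X: "X \<in> carrier_mat k k" "M = X * M'" using represents_factor[OF M] .
  obtain Y where Y: "Y \<in> carrier_mat k k" "M' = Y * M" using represents_factor[OF M(2,1)] .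
  have "pluecker M' J\<^sub>0 = det Y * pluecker M J\<^sub>0"
    using pluecker_mult[OF Y(1) c(1) J0(1,2), folded Y(2)] .
  also have "pluecker M J\<^sub>0 = det X * pluecker M' J\<^sub>0"
    using pluecker_mult[OF X(1) c(2) J0(1,2), folded X(2)] .
  finally have "det X \<noteq> 0" using J0(3) by auto
  thus ?thesis using pluecker_mult[OF X(1) c(2) J, folded X(2)] by simp
qed

section \<open>Labels of the border path\<close>

locale partition_shape =
  fixes n k :: nat and lam :: "nat \<Rightarrow> nat"
  assumes k_le_n: "k \<le> n" and part: "partition_in_rect k (n - k) lam"
begin

abbreviation m :: nat where "m \<equiv> n - k"
abbreviation B :: "box set" where "B \<equiv> boxes k lam"
abbreviation rl :: "nat \<Rightarrow> nat" where "rl \<equiv> row_label n k lam"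
abbreviation cl :: "nat \<Rightarrow> nat" where "cl \<equiv> col_label n k lam"
abbreviation len :: "nat \<Rightarrow> nat" where "len \<equiv> col_length k lam"

lemma lam_le: "r \<in> {1..k} \<Longrightarrow> lam r \<le> m"
  and lam_anti: "r \<in> {1..k} \<Longrightarrow> r' \<in> {r..k} \<Longrightarrow> lam r' \<le> lam r"
  using part by (auto simp: partition_in_rect_def)

lemma rows_of_column: "{r \<in> {1..k}. c \<le> lam r} = {1..len c}"
proof -
  let ?S = "{r \<in> {1..k}. c \<le> lam r}"
  show ?thesis
  proof (cases "?S = {}")
    case True
    hence "len c = 0" by (simp add: col_length_def del: Collect_empty_eq)
    thus ?thesis using True by auto
  next
    case False
    have M: "Max ?S \<in> ?S" by (rule Max_in) (use False in auto)
    have "?S = {1..Max ?S}"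
    proof
      show "{1..Max ?S} \<subseteq> ?S"
      proof
        fix r assume r: "r \<in> {1..Max ?S}"
        hence "lam (Max ?S) \<le> lam r" using M by (intro lam_anti) auto
        thus "r \<in> ?S" using M r by auto
      qed
    qed auto
    thus ?thesis unfolding col_length_def by (metis card_atLeastAtMost diff_Suc_1)
  qed
qed

lemma le_len_iff: "r \<in> {1..k} \<Longrightarrow> r \<le> len c \<longleftrightarrow> c \<le> lam r"
proof -
  assume "r \<in> {1..k}"
  moreover have "r \<in> {r \<in> {1..k}. c \<le> lam r} \<longleftrightarrow> r \<in> {1..len c}"
    by (simp only: rows_of_column)
  ultimately show ?thesis by simp
qed

lemma len_le: "len c \<le> k"
  unfolding col_length_def using card_mono[of "{1..k}" "{r \<in> {1..k}. c \<le> lam r}"] by force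

lemma len_anti: "c \<le> c' \<Longrightarrow> len c' \<le> len c"
  unfolding col_length_def by (intro card_mono) auto

lemma box_iff: "(r, c) \<in> B \<longleftrightarrow> r \<in> {1..k} \<and> 1 \<le> c \<and> c \<le> lam r"
  by (auto simp: boxes_def)

lemma box_iff': "(r, c) \<in> B \<longleftrightarrow> c \<in> {1..m} \<and> 1 \<le> r \<and> r \<le> len c"
  using lam_le[of r] le_len_iff[of r c] len_le[of c] by (auto simp: box_iff)

lemma box_col: "(r, c) \<in> B \<Longrightarrow> c \<in> {1..m}"
  by (simp add: box_iff')

lemma rl_eq: "1 \<le> r \<Longrightarrow> rl r = m - lam r + r"
  by (simp add: row_label_def)

lemma cl_eq: "cl c = m - c + 1 + len c"
  by (simp add: col_label_def)

lemma rl_less: "r \<in> {1..k} \<Longrightarrow> r' \<in> {1..k} \<Longrightarrow> r < r' \<Longrightarrow> rl r < rl r'"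
  using lam_anti[of r r'] by (simp add: rl_eq)

lemma cl_less: "c \<in> {1..m} \<Longrightarrow> c' \<in> {1..m} \<Longrightarrow> c < c' \<Longrightarrow> cl c' < cl c"
  using len_anti[of c c'] by (auto simp: cl_eq)

lemma rl_eq_iff: "r \<in> {1..k} \<Longrightarrow> r' \<in> {1..k} \<Longrightarrow> rl r = rl r' \<longleftrightarrow> r = r'"
  using rl_less[of r r'] rl_less[of r' r] by (cases r r' rule: linorder_cases) auto

lemma cl_eq_iff: "c \<in> {1..m} \<Longrightarrow> c' \<in> {1..m} \<Longrightarrow> cl c = cl c' \<longleftrightarrow> c = c'"
  using cl_less[of c c'] cl_less[of c' c] by (cases c c' rule: linorder_cases) auto

text \<open>The border path passes the end of row \<open>r\<close> before the bottom of column
  \<open>c\<close> exactly when \<open>(r, c)\<close> is a box. This turns comparisons of labels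
  into membership of boxes.\<close>

lemma rl_cl: "r \<in> {1..k} \<Longrightarrow> c \<in> {1..m} \<Longrightarrow> (if c \<le> lam r then rl r < cl c else cl c < rl r)"
  using le_len_iff[of r c] lam_le[of r] by (auto simp: rl_eq cl_eq)

lemma rl_neq_cl: "r \<in> {1..k} \<Longrightarrow> c \<in> {1..m} \<Longrightarrow> rl r \<noteq> cl c"
  using rl_cl[of r c] by (auto split: if_splits)

lemma rl_inj: "inj_on rl {1..k}"
  using rl_eq_iff by (auto simp: inj_on_def)

lemma cl_inj: "inj_on cl {1..m}"
  using cl_eq_iff by (auto simp: inj_on_def)

lemma rl_range: "r \<in> {1..k} \<Longrightarrow> rl r \<in> {1..n}"
  using lam_le[of r] k_le_n by (auto simp: rl_eq)

lemma cl_range: "c \<in> {1..m} \<Longrightarrow> cl c \<in> {1..n}"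
  using len_le[of c] k_le_n by (auto simp: cl_eq)

lemma labels_union: "rl ` {1..k} \<union> cl ` {1..m} = {1..n}"
proof (rule card_subset_eq)
  show "rl ` {1..k} \<union> cl ` {1..m} \<subseteq> {1..n}" using rl_range cl_range by blast
  have "card (rl ` {1..k} \<union> cl ` {1..m}) = card (rl ` {1..k}) + card (cl ` {1..m})"
    by (rule card_Un_disjoint) (use rl_neq_cl in fastforce)+
  thus "card (rl ` {1..k} \<union> cl ` {1..m}) = card {1..n}"
    using k_le_n by (simp only: card_image[OF rl_inj] card_image[OF cl_inj] card_atLeastAtMost)
qed auto

lemma source_set_eq: "source_set n k lam = rl ` {1..k}"
  by (simp add: source_set_def)

lemma card_source_set: "card (source_set n k lam) = k"
  unfolding source_set_eq card_image[OF rl_inj] by simp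

lemma source_set_subset: "source_set n k lam \<subseteq> {1..n}"
  unfolding source_set_eq using rl_range by auto

lemma sorted_source_set: "sorted_list_of_set (source_set n k lam) = map rl [1..<Suc k]"
proof -
  have "sorted (map rl [1..<Suc k])"
    unfolding sorted_iff_nth_Suc using rl_less by (auto intro!: less_imp_le simp del: upt_Suc)
  moreover have "distinct (map rl [1..<Suc k])"
    using rl_inj by (simp add: distinct_map atLeastLessThanSuc_atLeastAtMost del: upt_Suc)
  moreover have "set (map rl [1..<Suc k]) = source_set n k lam"
    by (simp only: set_map set_upt source_set_eq atLeastLessThanSuc_atLeastAtMost)
  ultimately show ?thesis by (metis sorted_list_of_set.idem_if_sorted_distinct)
qed

end

section \<open>Values on the edges of the boxes\<close>

context partition_shape
begin

text \<open>\<open>H r c\<close> belongs to the vertical edge at the right of box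
  \<open>(r, c)\<close> (the left border of row \<open>r\<close> for \<open>c = 0\<close>), \<open>V r c\<close> to the horizontal edge below it
  (the upper border of column \<open>c\<close> for \<open>r = 0\<close>). The rule \<open>st\<close> of a box computes the values on
  its left and upper edge from those on its right and lower edge.\<close>

definition edge_system ::
  "(box \<Rightarrow> 'v \<Rightarrow> 'v \<Rightarrow> 'v \<times> 'v) \<Rightarrow> (nat \<Rightarrow> 'v) \<Rightarrow> (nat \<Rightarrow> 'v) \<Rightarrow>
   (nat \<Rightarrow> nat \<Rightarrow> 'v) \<Rightarrow> (nat \<Rightarrow> nat \<Rightarrow> 'v) \<Rightarrow> bool" where
  "edge_system st h\<^sub>0 v\<^sub>0 H V \<longleftrightarrow>
     (\<forall>r\<in>{1..k}. H r (lam r) = h\<^sub>0 r) \<and> (\<forall>c\<in>{1..m}. V (len c) c = v\<^sub>0 c) \<and>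
     (\<forall>r c. (r, c) \<in> B \<longrightarrow> st (r, c) (H r c) (V r c) = (H r (c - 1), V (r - 1) c))"

text \<open>Existence by recursion from the border: the flag selects \<open>H\<close> or
  \<open>V\<close>, and the guards \<open>c < m\<close> and \<open>r < k\<close> make the measure
  \<open>(k - r) + (m - c)\<close> drop. Elsewhere systems are treated as relations, because
  projected vectors and signed path sums satisfy such equations too and are compared by
  uniqueness.\<close>

function edge_value ::
  "(box \<Rightarrow> 'v \<Rightarrow> 'v \<Rightarrow> 'v \<times> 'v) \<Rightarrow> (nat \<Rightarrow> 'v) \<Rightarrow> (nat \<Rightarrow> 'v) \<Rightarrow> bool \<Rightarrow> nat \<Rightarrow> nat \<Rightarrow> 'v" where
  "edge_value st h\<^sub>0 v\<^sub>0 True r c =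
     (if (r, Suc c) \<in> B \<and> c < m
      then fst (st (r, Suc c) (edge_value st h\<^sub>0 v\<^sub>0 True r (Suc c)) (edge_value st h\<^sub>0 v\<^sub>0 False r (Suc c)))
      else h\<^sub>0 r)"
| "edge_value st h\<^sub>0 v\<^sub>0 False r c =
     (if (Suc r, c) \<in> B \<and> r < k
      then snd (st (Suc r, c) (edge_value st h\<^sub>0 v\<^sub>0 True (Suc r) c) (edge_value st h\<^sub>0 v\<^sub>0 False (Suc r) c))
      else v\<^sub>0 c)"
  by pat_completeness auto
termination
  by (relation "measure (\<lambda>(st, h\<^sub>0, v\<^sub>0, b, r, c). (k - r) + (m - c))") auto

declare edge_value.simps [simp del]

lemma edge_system_exists:
  obtains H V where "edge_system st h\<^sub>0 v\<^sub>0 H V"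
proof
  let ?H = "edge_value st h\<^sub>0 v\<^sub>0 True" and ?V = "edge_value st h\<^sub>0 v\<^sub>0 False"
  show "edge_system st h\<^sub>0 v\<^sub>0 ?H ?V"
    unfolding edge_system_def
  proof (intro conjI ballI allI impI)
    show "?H r (lam r) = h\<^sub>0 r" if "r \<in> {1..k}" for r
      by (subst edge_value.simps) (simp add: box_iff)
    show "?V (len c) c = v\<^sub>0 c" if "c \<in> {1..m}" for c
      by (subst edge_value.simps) (simp add: box_iff')
    show "st (r, c) (?H r c) (?V r c) = (?H r (c - 1), ?V (r - 1) c)" if b: "(r, c) \<in> B" for r c
    proof -
      have *: "c = Suc (c - 1)" "r = Suc (r - 1)" "c - 1 < m" "r - 1 < k"
        using b box_iff[of r c] box_iff'[of r c] len_le[of c] by auto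
      have "?H r (c - 1) = fst (st (r, c) (?H r c) (?V r c))"
        using b * by (subst edge_value.simps) simp
      moreover have "?V (r - 1) c = snd (st (r, c) (?H r c) (?V r c))"
        using b * by (subst edge_value.simps) simp
      ultimately show ?thesis by simp
    qed
  qed
qed

lemma edge_system_row: "edge_system st h\<^sub>0 v\<^sub>0 H V \<Longrightarrow> r \<in> {1..k} \<Longrightarrow> H r (lam r) = h\<^sub>0 r"
  and edge_system_col: "edge_system st h\<^sub>0 v\<^sub>0 H V \<Longrightarrow> c \<in> {1..m} \<Longrightarrow> V (len c) c = v\<^sub>0 c"
  and edge_system_box: "edge_system st h\<^sub>0 v\<^sub>0 H V \<Longrightarrow> (r, c) \<in> B \<Longrightarrow>
    st (r, c) (H r c) (V r c) = (H r (c - 1), V (r - 1) c)"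
  by (auto simp: edge_system_def)

lemma edge_system_left: "edge_system st h\<^sub>0 v\<^sub>0 H V \<Longrightarrow> (r, c) \<in> B \<Longrightarrow>
    H r (c - 1) = fst (st (r, c) (H r c) (V r c))"
  and edge_system_up: "edge_system st h\<^sub>0 v\<^sub>0 H V \<Longrightarrow> (r, c) \<in> B \<Longrightarrow>
    V (r - 1) c = snd (st (r, c) (H r c) (V r c))"
  by (simp_all only: edge_system_box fst_conv snd_conv)

text \<open>Induction from the southeast border towards the northwest; the hypothesis \<open>C\<close> is only
  needed for the boxes that the edge depends on.\<close>

lemma edge_induct_nw:
  assumes row: "\<And>r. r \<in> {1..k} \<Longrightarrow> P r (lam r)" and col: "\<And>c. c \<in> {1..m} \<Longrightarrow> Q (len c) c"
    and box: "\<And>r c. (r, c) \<in> B \<Longrightarrow> C (r, c) \<Longrightarrow> P r c \<Longrightarrow> Q r c \<Longrightarrow> P r (c - 1) \<and> Q (r - 1) c"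
  shows "r \<in> {1..k} \<Longrightarrow> c \<le> lam r \<Longrightarrow>
      (\<And>r' c'. (r', c') \<in> B \<Longrightarrow> r \<le> r' \<Longrightarrow> c < c' \<Longrightarrow> C (r', c')) \<Longrightarrow> P r c"
    and "c \<in> {1..m} \<Longrightarrow> r \<le> len c \<Longrightarrow>
      (\<And>r' c'. (r', c') \<in> B \<Longrightarrow> r < r' \<Longrightarrow> c \<le> c' \<Longrightarrow> C (r', c')) \<Longrightarrow> Q r c"
proof (induction "(k - r) + (m - c)" arbitrary: r c rule: less_induct)
  case less
  note IH = less.hyps
  {
    case 1
    show ?case
    proof (cases "c = lam r")
      case True thus ?thesis using row 1 by simp
    next
      case False
      hence b: "(r, Suc c) \<in> B" using 1 by (simp add: box_iff)
      have lt: "(k - r) + (m - Suc c) < (k - r) + (m - c)" using box_col[OF b] by simp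
      have "P r (Suc c)" using 1 False by (intro IH(1)[OF lt]) auto
      moreover have "Q r (Suc c)" using 1 b by (intro IH(2)[OF lt]) (auto simp: box_iff')
      ultimately show ?thesis using box[OF b] 1 b by auto
    qed
  next
    case 2
    show ?case
    proof (cases "r = len c")
      case True thus ?thesis using col 2 by simp
    next
      case False
      hence b: "(Suc r, c) \<in> B" using 2 by (simp add: box_iff')
      have lt: "(k - Suc r) + (m - c) < (k - r) + (m - c)" using b by (auto simp: box_iff)
      have "P (Suc r) c" using 2 b by (intro IH(1)[OF lt]) (auto simp: box_iff)
      moreover have "Q (Suc r) c" using 2 False by (intro IH(2)[OF lt]) auto
      ultimately show ?thesis using box[OF b] 2 b by auto
    qed
  }
qed

lemma edge_induct_nw':
  assumes row: "\<And>r. r \<in> {1..k} \<Longrightarrow> P r (lam r)" and col: "\<And>c. c \<in> {1..m} \<Longrightarrow> Q (len c) c"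
    and box: "\<And>r c. (r, c) \<in> B \<Longrightarrow> P r c \<Longrightarrow> Q r c \<Longrightarrow> P r (c - 1) \<and> Q (r - 1) c"
  shows "r \<in> {1..k} \<Longrightarrow> c \<le> lam r \<Longrightarrow> P r c" and "c \<in> {1..m} \<Longrightarrow> r \<le> len c \<Longrightarrow> Q r c"
  using edge_induct_nw[of P Q "\<lambda>_. True", OF row col box] by blast+

text \<open>Induction along the direction of the paths, for quantities whose right and upper values
  are computed from the left and lower ones.\<close>

lemma edge_induct_sw:
  assumes row: "\<And>r. r \<in> {1..k} \<Longrightarrow> P r 0" and col: "\<And>c. c \<in> {1..m} \<Longrightarrow> Q (len c) c"
    and box: "\<And>r c. (r, c) \<in> B \<Longrightarrow> P r (c - 1) \<Longrightarrow> Q r c \<Longrightarrow> P r c \<and> Q (r - 1) c"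
  shows "r \<in> {1..k} \<Longrightarrow> c \<le> lam r \<Longrightarrow> P r c" and "c \<in> {1..m} \<Longrightarrow> r \<le> len c \<Longrightarrow> Q r c"
proof -
  \<comment> \<open>\<open>P r c\<close> depends on \<open>Q r c\<close>, which has the same value
    of \<open>c + (k - r)\<close>. Doubling the measure leaves room to treat \<open>Q\<close>
    first.\<close>
  have "(r \<in> {1..k} \<and> c \<le> lam r \<and> 2 * (c + (k - r)) < N \<longrightarrow> P r c) \<and>
        (c \<in> {1..m} \<and> r \<le> len c \<and> 2 * (c + (k - r)) \<le> N \<longrightarrow> Q r c)" for N r c
  proof (induction N arbitrary: r c rule: less_induct)
    case (less N)
    have IHP: "P r c" if "r \<in> {1..k}" "c \<le> lam r" "2 * (c + (k - r)) + 1 < N" for r c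
      using less[of "2 * (c + (k - r)) + 1" r c] that by auto
    have IHQ: "Q r c" if "c \<in> {1..m}" "r \<le> len c" "2 * (c + (k - r)) < N" for r c
      using less[of "2 * (c + (k - r))" r c] that by auto
    show ?case
    proof (intro conjI impI)
      assume a: "r \<in> {1..k} \<and> c \<le> lam r \<and> 2 * (c + (k - r)) < N"
      show "P r c"
      proof (cases "c = 0")
        case True thus ?thesis using row a by simp
      next
        case False
        hence b: "(r, c) \<in> B" using a by (simp add: box_iff)
        have "P r (c - 1)" using a False by (intro IHP) auto
        moreover have "Q r c" using a b by (intro IHQ) (auto simp: box_iff')
        ultimately show ?thesis using box[OF b] by simp
      qed
    next
      assume a: "c \<in> {1..m} \<and> r \<le> len c \<and> 2 * (c + (k - r)) \<le> N"
      show "Q r c"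
      proof (cases "r = len c")
        case True thus ?thesis using col a by simp
      next
        case False
        hence b: "(Suc r, c) \<in> B" using a by (simp add: box_iff')
        hence *: "Suc r \<le> k" "1 \<le> c" by (auto simp: box_iff)
        have "P (Suc r) (c - 1)" using a b * by (intro IHP) (auto simp: box_iff)
        moreover have "Q (Suc r) c" using a False * by (intro IHQ) auto
        ultimately show ?thesis using box[OF b] by simp
      qed
    qed
  qed
  from this[of r c "Suc (2 * (c + (k - r)))"] this[of r c "Suc (2 * (c + (k - r)))"]
  show "r \<in> {1..k} \<Longrightarrow> c \<le> lam r \<Longrightarrow> P r c" "c \<in> {1..m} \<Longrightarrow> r \<le> len c \<Longrightarrow> Q r c"
    by auto
qed

end

text \<open>Labels travel along strands: at a stone the two strands cross straight, at a plus both
  turn.\<close>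

definition label_step :: "(box \<Rightarrow> filling) \<Rightarrow> box \<Rightarrow> nat \<Rightarrow> nat \<Rightarrow> nat \<times> nat" where
  "label_step D b h v = (if D b = Plus then (v, h) else (h, v))"

definition unit_at :: "nat \<Rightarrow> nat \<Rightarrow> 'a::field" where
  "unit_at s t = (if t = s then 1 else 0)"

text \<open>The network gives \<open>right = p * (left + lower)\<close> and
  \<open>up = left + lower\<close> at a plus, \<open>right = left + p * lower\<close> and
  \<open>up = lower\<close> at a black stone, and no mixing at a white one. These are solved for
  \<open>left\<close> and \<open>up\<close>, after the change of signs made in \<open>SH\<close> and
  \<open>SV\<close>.\<close>

definition vector_step ::
  "(box \<Rightarrow> filling) \<Rightarrow> (box \<Rightarrow> 'a::field) \<Rightarrow> box \<Rightarrow> (nat \<Rightarrow> 'a) \<Rightarrow> (nat \<Rightarrow> 'a) \<Rightarrow>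
   (nat \<Rightarrow> 'a) \<times> (nat \<Rightarrow> 'a)" where
  "vector_step D p b h v =
     (case D b of
        Plus \<Rightarrow> (\<lambda>t. h t / p b + v t, \<lambda>t. h t / p b)
      | Black \<Rightarrow> (\<lambda>t. h t + p b * v t, \<lambda>t. - v t)
      | White \<Rightarrow> (h, \<lambda>t. - v t))"

definition has_lead :: "(nat \<Rightarrow> 'a::zero) \<Rightarrow> nat \<Rightarrow> bool" where
  "has_lead x s \<longleftrightarrow> x s \<noteq> 0 \<and> (\<forall>t>s. x t = 0)"

lemma has_lead_unit_at: "has_lead (unit_at s) s"
  by (simp add: has_lead_def unit_at_def)

context partition_shape
begin

abbreviation label_system where
  "label_system D \<equiv> edge_system (label_step D) rl cl"

abbreviation vector_system where
  "vector_system D p \<equiv> edge_system (vector_step D p) (\<lambda>r. unit_at (rl r)) (\<lambda>c. unit_at (cl c))"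

text \<open>Strands enter only at the border steps southeast of the edge.\<close>

lemma label_support:
  assumes L: "label_system D LH LV"
  shows "r \<in> {1..k} \<Longrightarrow> c \<le> lam r \<Longrightarrow> LH r c \<in> rl ` {r..k} \<union> cl ` {Suc c..m}"
    and "c \<in> {1..m} \<Longrightarrow> r \<le> len c \<Longrightarrow> LV r c \<in> rl ` {Suc r..k} \<union> cl ` {c..m}"
proof -
  let ?P = "\<lambda>r c. LH r c \<in> rl ` {r..k} \<union> cl ` {Suc c..m}" and ?Q = "\<lambda>r c. LV r c \<in> rl ` {Suc r..k} \<union> cl ` {c..m}"
  have 1: "?P r (lam r)" if "r \<in> {1..k}" for r
    using that edge_system_row[OF L] by auto
  have 2: "?Q (len c) c" if "c \<in> {1..m}" for c
    using that edge_system_col[OF L] by auto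
  have 3: "?P r (c - 1) \<and> ?Q (r - 1) c" if 3: "(r, c) \<in> B" "?P r c" "?Q r c" for r c
  proof -
    from 3 have "{r..k} \<subseteq> {Suc (r - 1)..k}" "{Suc r..k} \<subseteq> {r..k}" "{Suc c..m} \<subseteq> {c..m}"
      "Suc (c - 1) = c" "Suc (r - 1) = r" by (auto simp: box_iff)
    thus "?P r (c - 1) \<and> ?Q (r - 1) c" using edge_system_box[OF L 3(1)] 3(2,3)
      by (auto simp: label_step_def split: if_splits)
  qed
  note ind = edge_induct_nw'[where P = ?P and Q = ?Q, OF 1 2 3]
  show "r \<in> {1..k} \<Longrightarrow> c \<le> lam r \<Longrightarrow> LH r c \<in> rl ` {r..k} \<union> cl ` {Suc c..m}"
    by (rule ind(1))
  show "c \<in> {1..m} \<Longrightarrow> r \<le> len c \<Longrightarrow> LV r c \<in> rl ` {Suc r..k} \<union> cl ` {c..m}"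
    by (rule ind(2))
qed

text \<open>The vector on an edge is built from unit vectors entering southeast of it; the pivots of
  the rows above have not entered yet.\<close>

lemma vector_support:
  assumes N: "vector_system D p NH NV"
  shows "r \<in> {1..k} \<Longrightarrow> c \<le> lam r \<Longrightarrow> \<forall>s\<in>{1..k}. s < r \<longrightarrow> NH r c (rl s) = 0"
    and "c \<in> {1..m} \<Longrightarrow> r \<le> len c \<Longrightarrow> \<forall>s\<in>{1..k}. s \<le> r \<longrightarrow> NV r c (rl s) = 0"
proof -
  let ?P = "\<lambda>r c. \<forall>s\<in>{1..k}. s < r \<longrightarrow> NH r c (rl s) = 0" and ?Q = "\<lambda>r c. \<forall>s\<in>{1..k}. s \<le> r \<longrightarrow> NV r c (rl s) = 0"
  have 1: "?P r (lam r)" if "r \<in> {1..k}" for r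
    using that edge_system_row[OF N] rl_eq_iff by (auto simp: unit_at_def)
  have 2: "?Q (len c) c" if "c \<in> {1..m}" for c
    using that edge_system_col[OF N] rl_neq_cl by (auto simp: unit_at_def)
  have 3: "?P r (c - 1) \<and> ?Q (r - 1) c" if 3: "(r, c) \<in> B" "?P r c" "?Q r c" for r c
  proof -
    have "s \<le> r" if "s \<le> r - 1" for s using that by simp
    with 3 show "?P r (c - 1) \<and> ?Q (r - 1) c"
      unfolding edge_system_left[OF N 3(1)] edge_system_up[OF N 3(1)]
      by (auto simp: vector_step_def box_iff split: filling.splits)
  qed
  note ind = edge_induct_nw'[where P = ?P and Q = ?Q, OF 1 2 3]
  show "r \<in> {1..k} \<Longrightarrow> c \<le> lam r \<Longrightarrow> \<forall>s\<in>{1..k}. s < r \<longrightarrow> NH r c (rl s) = 0"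
    by (rule ind(1))
  show "c \<in> {1..m} \<Longrightarrow> r \<le> len c \<Longrightarrow> \<forall>s\<in>{1..k}. s \<le> r \<longrightarrow> NV r c (rl s) = 0"
    by (rule ind(2))
qed

text \<open>At a plus the lead of \<open>v\<close> survives the addition of \<open>h / p\<close>
  because \<open>LH < LV\<close>; at a black stone the lead of \<open>h\<close> survives because
  \<open>LV < LH\<close>. A parameter 0 at a plus would destroy the upper vector, as division by 0
  yields 0.\<close>

lemma vector_lead:
  assumes L: "label_system D LH LV" and N: "vector_system D p NH NV"
    and up: "\<And>r c. (r, c) \<in> B \<Longrightarrow> D (r, c) = Plus \<Longrightarrow> LH r c < LV r c"
    and down: "\<And>r c. (r, c) \<in> B \<Longrightarrow> D (r, c) = Black \<Longrightarrow> LV r c < LH r c"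
  shows "r \<in> {1..k} \<Longrightarrow> c \<le> lam r \<Longrightarrow>
      (\<And>r' c'. (r', c') \<in> B \<Longrightarrow> r \<le> r' \<Longrightarrow> c < c' \<Longrightarrow> D (r', c') = Plus \<longrightarrow> p (r', c') \<noteq> 0) \<Longrightarrow>
      has_lead (NH r c) (LH r c)"
    and "c \<in> {1..m} \<Longrightarrow> r \<le> len c \<Longrightarrow>
      (\<And>r' c'. (r', c') \<in> B \<Longrightarrow> r < r' \<Longrightarrow> c \<le> c' \<Longrightarrow> D (r', c') = Plus \<longrightarrow> p (r', c') \<noteq> 0) \<Longrightarrow>
      has_lead (NV r c) (LV r c)"
proof -
  let ?P = "\<lambda>r c. has_lead (NH r c) (LH r c)" and ?Q = "\<lambda>r c. has_lead (NV r c) (LV r c)"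
  have 1: "?P r (lam r)" if "r \<in> {1..k}" for r
    using that edge_system_row[OF L] edge_system_row[OF N] by (simp add: has_lead_unit_at)
  have 2: "?Q (len c) c" if "c \<in> {1..m}" for c
    using that edge_system_col[OF L] edge_system_col[OF N] by (simp add: has_lead_unit_at)
  have 3: "?P r (c - 1) \<and> ?Q (r - 1) c" if 3: "(r, c) \<in> B" "(\<lambda>b. D b = Plus \<longrightarrow> p b \<noteq> 0) (r, c)" "?P r c" "?Q r c" for r c
  proof -
    show "?P r (c - 1) \<and> ?Q (r - 1) c"
      unfolding edge_system_left[OF N 3(1)] edge_system_up[OF N 3(1)]
        edge_system_left[OF L 3(1)] edge_system_up[OF L 3(1)]
      using up[OF 3(1)] down[OF 3(1)] 3
      by (auto simp: vector_step_def label_step_def has_lead_def split: filling.splits)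
  qed
  note ind = edge_induct_nw[where P = ?P and Q = ?Q and C = "\<lambda>b. D b = Plus \<longrightarrow> p b \<noteq> 0", OF 1 2 3]
  show "r \<in> {1..k} \<Longrightarrow> c \<le> lam r \<Longrightarrow>
      (\<And>r' c'. (r', c') \<in> B \<Longrightarrow> r \<le> r' \<Longrightarrow> c < c' \<Longrightarrow> D (r', c') = Plus \<longrightarrow> p (r', c') \<noteq> 0) \<Longrightarrow>
      has_lead (NH r c) (LH r c)"
    by (rule ind(1))
  show "c \<in> {1..m} \<Longrightarrow> r \<le> len c \<Longrightarrow>
      (\<And>r' c'. (r', c') \<in> B \<Longrightarrow> r < r' \<Longrightarrow> c \<le> c' \<Longrightarrow> D (r', c') = Plus \<longrightarrow> p (r', c') \<noteq> 0) \<Longrightarrow>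
      has_lead (NV r c) (LV r c)"
    by (rule ind(2))
qed

end

section \<open>Minors attached to the boxes\<close>

context partition_shape
begin

text \<open>Indices start from 1 as for the labels, and the value 0 outside \<open>{1..n}\<close>
  makes a row a function on all of \<open>nat\<close>, like the vectors on the edges.\<close>

definition entry :: "'a::field mat \<Rightarrow> nat \<Rightarrow> nat \<Rightarrow> 'a" where
  "entry M r t = (if t \<in> {1..n} then M $$ (r - 1, t - 1) else 0)"

text \<open>The last clause is the vanishing to the left of the pivot: \<open>lam r < c\<close>
  means \<open>cl c < rl r\<close>.\<close>

definition echelon :: "'a::field mat \<Rightarrow> bool" where
  "echelon M \<longleftrightarrow> M \<in> carrier_mat k n \<and>
     (\<forall>r\<in>{1..k}. \<forall>s\<in>{1..k}. entry M r (rl s) = (if r = s then 1 else 0)) \<and>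
     (\<forall>r\<in>{1..k}. \<forall>c\<in>{1..m}. lam r < c \<longrightarrow> entry M r (cl c) = 0)"

text \<open>The projection along the row space of \<open>M\<close> onto the span of the non-pivot coordinates.\<close>

definition reduce :: "'a::field mat \<Rightarrow> (nat \<Rightarrow> 'a) \<Rightarrow> nat \<Rightarrow> 'a" where
  "reduce M x t = x t - (\<Sum>s=1..k. x (rl s) * entry M s t)"

text \<open>The coordinate at \<open>cl c\<close> of the projected vector on the lower edge of a
  box: it is 1 at the border and changes sign at each consistent box of the column.\<close>

definition edge_sign :: "nat \<Rightarrow> nat \<Rightarrow> 'a::field" where
  "edge_sign r c = (-1) ^ (len c - r)"

lemma edge_sign_sq [simp]: "edge_sign r c * edge_sign r c = 1"
  by (simp add: edge_sign_def flip: power_mult_distrib)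

lemma edge_sign_nonzero [simp]: "edge_sign r c \<noteq> (0::'a::field)"
  by (simp add: edge_sign_def)

lemma edge_sign_sq' [simp]: "edge_sign r c * (x * edge_sign r c) = (x::'a::field)"
  by (simp add: mult.left_commute[of _ x])

lemma edge_sign_pred: "(r, c) \<in> B \<Longrightarrow> edge_sign (r - 1) c = - (edge_sign r c :: 'a::field)"
  by (simp add: edge_sign_def box_iff' Suc_diff_le)

lemma reduce_add: "reduce M (\<lambda>t. x t + y t) t = reduce M x t + reduce M y t"
  by (simp add: reduce_def sum.distrib algebra_simps)

lemma reduce_mult: "reduce M (\<lambda>t. a * x t) t = a * reduce M x t"
  by (simp add: reduce_def sum_distrib_left algebra_simps)

lemma reduce_divide: "reduce M (\<lambda>t. x t / a) t = reduce M x t / a"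
  using reduce_mult[of M "inverse a" x t] by (simp add: divide_inverse_commute)

lemma reduce_uminus: "reduce M (\<lambda>t. - x t) t = - reduce M x t"
  using reduce_mult[of M "-1" x t] by simp

lemma reduce_diff: "reduce M (\<lambda>t. x t - y t) t = reduce M x t - reduce M y t"
  using reduce_add[of M x "\<lambda>t. - y t" t] by (simp add: reduce_uminus)

lemmas reduce_linear = reduce_add reduce_diff reduce_mult reduce_divide reduce_uminus

lemma reduce_unit_row:
  assumes "r \<in> {1..k}" shows "reduce M (unit_at (rl r)) t = unit_at (rl r) t - entry M r t"
proof -
  have "(\<Sum>s=1..k. unit_at (rl r) (rl s) * entry M s t) = (\<Sum>s=1..k. if s = r then entry M s t else 0)"
    by (rule sum.cong) (use assms rl_eq_iff in \<open>auto simp: unit_at_def\<close>)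
  thus ?thesis using assms by (simp add: reduce_def)
qed

lemma reduce_unit_col:
  fixes M :: "'a::field mat"
  assumes "c \<in> {1..m}" shows "reduce M (unit_at (cl c)) t = unit_at (cl c) t"
proof -
  have "unit_at (cl c) (rl s) = (0::'a)" if "s \<in> {1..k}" for s
    using rl_neq_cl[OF that assms] by (simp add: unit_at_def)
  thus ?thesis by (simp add: reduce_def)
qed

lemma echelon_pivot: "echelon M \<Longrightarrow> r \<in> {1..k} \<Longrightarrow> s \<in> {1..k} \<Longrightarrow>
    entry M r (rl s) = (if r = s then 1 else 0)"
  and echelon_zero: "echelon M \<Longrightarrow> r \<in> {1..k} \<Longrightarrow> c \<in> {1..m} \<Longrightarrow> lam r < c \<Longrightarrow> entry M r (cl c) = 0"
  and echelon_carrier: "echelon M \<Longrightarrow> M \<in> carrier_mat k n"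
  by (simp_all add: echelon_def)

lemma reduce_row_support:
  assumes M: "echelon M" and r: "r \<in> {1..k}" and t: "t \<notin> cl ` {1..lam r}"
  shows "reduce M (unit_at (rl r)) t = 0"
proof (cases "t \<in> {1..n}")
  case False
  thus ?thesis using rl_range[OF r] by (auto simp: reduce_unit_row[OF r] unit_at_def entry_def)
next
  case True
  then consider s where "s \<in> {1..k}" "t = rl s" | c where "c \<in> {1..m}" "t = cl c"
    using labels_union by blast
  thus ?thesis
  proof cases
    case 1
    thus ?thesis using echelon_pivot[OF M r 1(1)] rl_eq_iff[OF r 1(1)]
      by (auto simp: reduce_unit_row[OF r] unit_at_def)
  next
    case 2
    hence "lam r < c" using t by (cases "lam r < c") auto
    thus ?thesis using 2 rl_neq_cl[OF r 2(1)] echelon_zero[OF M r 2(1)]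
      by (auto simp: reduce_unit_row[OF r] unit_at_def)
  qed
qed

text \<open>With \<open>x\<close> the coordinate at \<open>cl c\<close> on the right edge and
  \<open>s = edge_sign r c\<close> the one on the lower edge, the left edge loses this coordinate
  iff \<open>x / p + s = 0\<close>, \<open>x + p * s = 0\<close> or \<open>x = 0\<close>,
  respectively. As \<open>s * s = 1\<close>, the first two have the same solution
  \<open>p = - s * x\<close>.\<close>

definition consistent ::
  "(box \<Rightarrow> filling) \<Rightarrow> (box \<Rightarrow> 'a::field) \<Rightarrow> 'a mat \<Rightarrow> (nat \<Rightarrow> nat \<Rightarrow> nat \<Rightarrow> 'a) \<Rightarrow> box \<Rightarrow> bool"
  where
  "consistent D p M NH b = (case b of (r, c) \<Rightarrow>
     (case D b of
        Plus \<Rightarrow> p b \<noteq> 0 \<and> p b = - edge_sign r c * reduce M (NH r c) (cl c)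
      | Black \<Rightarrow> p b = - edge_sign r c * reduce M (NH r c) (cl c)
      | White \<Rightarrow> reduce M (NH r c) (cl c) = 0))"

text \<open>Each consistent box clears its column from the projected left edge. At
  \<open>c = 0\<close> nothing is left, so the vectors on the left border lie in the row space of
  \<open>M\<close>.\<close>

lemma reduce_support:
  assumes M: "echelon M" and N: "vector_system D p NH NV"
  shows "r \<in> {1..k} \<Longrightarrow> c \<le> lam r \<Longrightarrow>
      (\<And>r' c'. (r', c') \<in> B \<Longrightarrow> r \<le> r' \<Longrightarrow> c < c' \<Longrightarrow> consistent D p M NH (r', c')) \<Longrightarrow>
      \<forall>t. t \<notin> cl ` {1..c} \<longrightarrow> reduce M (NH r c) t = 0"
    and "c \<in> {1..m} \<Longrightarrow> r \<le> len c \<Longrightarrow>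
      (\<And>r' c'. (r', c') \<in> B \<Longrightarrow> r < r' \<Longrightarrow> c \<le> c' \<Longrightarrow> consistent D p M NH (r', c')) \<Longrightarrow>
      reduce M (NV r c) (cl c) = edge_sign r c \<and>
      (\<forall>t. t \<notin> cl ` {1..c} \<longrightarrow> reduce M (NV r c) t = 0)"
proof -
  let ?P = "\<lambda>r c. \<forall>t. t \<notin> cl ` {1..c} \<longrightarrow> reduce M (NH r c) t = 0"
  let ?Q = "\<lambda>r c. reduce M (NV r c) (cl c) = edge_sign r c \<and>
      (\<forall>t. t \<notin> cl ` {1..c} \<longrightarrow> reduce M (NV r c) t = 0)"
  have 1: "?P r (lam r)" if "r \<in> {1..k}" for r
    using that edge_system_row[OF N that] reduce_row_support[OF M that] by simp
  have 2: "?Q (len c) c" if "c \<in> {1..m}" for c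
    using that edge_system_col[OF N that]
    by (auto simp: reduce_unit_col unit_at_def edge_sign_def)
  have 3: "?P r (c - 1) \<and> ?Q (r - 1) c"
    if 3: "(r, c) \<in> B" "consistent D p M NH (r, c)" "?P r c" "?Q r c" for r c
  proof -
    let ?x = "reduce M (NH r c) (cl c)" and ?s = "edge_sign r c :: 'a"
    have "reduce M (fst (vector_step D p (r, c) (NH r c) (NV r c))) t = 0"
      if t: "t \<notin> cl ` {1..c - 1}" for t
    proof (cases "t = cl c")
      case True
      have "?x / (- ?s * ?x) + ?s = 0" if "?x \<noteq> 0"
        using that by (simp add: eq_divide_eq)
      moreover have "?x + - ?s * ?x * ?s = 0" by (simp add: mult.assoc mult.left_commute[of _ ?x])
      ultimately show ?thesis using True 3(2,4)
        by (auto simp: vector_step_def consistent_def reduce_linear split: filling.splits)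
    next
      case False
      hence "t \<notin> cl ` {1..c}" using t by (auto simp: image_iff) (metis One_nat_def Suc_leI
        atLeastAtMost_iff diff_Suc_1 le_SucE le_less_Suc_eq not0_implies_Suc not_less_eq_eq)
      thus ?thesis using 3(3,4)
        by (auto simp: vector_step_def reduce_linear split: filling.splits)
    qed
    moreover have "reduce M (snd (vector_step D p (r, c) (NH r c) (NV r c))) (cl c) = - ?s"
    proof -
      have "?x / (- ?s * ?x) = - ?s" if "?x \<noteq> 0"
        using that by (simp add: divide_eq_eq)
      thus ?thesis using 3(2,4)
        by (auto simp: vector_step_def consistent_def reduce_linear split: filling.splits)
    qed
    moreover have "reduce M (snd (vector_step D p (r, c) (NH r c) (NV r c))) t = 0"
      if t: "t \<notin> cl ` {1..c}" for t
      using 3(3,4) t by (auto simp: vector_step_def reduce_linear split: filling.splits)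
    ultimately show ?thesis
      unfolding edge_system_left[OF N 3(1)] edge_system_up[OF N 3(1)] edge_sign_pred[OF 3(1)]
      by blast
  qed
  note ind = edge_induct_nw[where P = ?P and Q = ?Q and C = "consistent D p M NH", OF 1 2 3]
  show "r \<in> {1..k} \<Longrightarrow> c \<le> lam r \<Longrightarrow>
      (\<And>r' c'. (r', c') \<in> B \<Longrightarrow> r \<le> r' \<Longrightarrow> c < c' \<Longrightarrow> consistent D p M NH (r', c')) \<Longrightarrow>
      \<forall>t. t \<notin> cl ` {1..c} \<longrightarrow> reduce M (NH r c) t = 0"
    by (rule ind(1))
  show "c \<in> {1..m} \<Longrightarrow> r \<le> len c \<Longrightarrow>
      (\<And>r' c'. (r', c') \<in> B \<Longrightarrow> r < r' \<Longrightarrow> c \<le> c' \<Longrightarrow> consistent D p M NH (r', c')) \<Longrightarrow>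
      reduce M (NV r c) (cl c) = edge_sign r c \<and>
      (\<forall>t. t \<notin> cl ` {1..c} \<longrightarrow> reduce M (NV r c) t = 0)"
    by (rule ind(2))
qed

text \<open>The column in row \<open>r'\<close> just outside the boxes weakly southeast of \<open>(r, c)\<close>.\<close>

definition outer_col :: "box \<Rightarrow> nat \<Rightarrow> nat" where
  "outer_col b r' = (case b of (r, c) \<Rightarrow> if r' < r then lam r' else min (lam r') (c - 1))"

text \<open>In row \<open>r\<close> the position of the left edge of \<open>b\<close> is read before
  the factor of \<open>b\<close> is applied, when it still carries the label of the lower
  edge.\<close>

definition outer_label :: "(nat \<Rightarrow> nat \<Rightarrow> nat) \<Rightarrow> (nat \<Rightarrow> nat \<Rightarrow> nat) \<Rightarrow> box \<Rightarrow> nat \<Rightarrow> nat" where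
  "outer_label LH LV b r' = (if r' = fst b then LV (fst b) (snd b) else LH r' (outer_col b r'))"

lemma bij_betw_Suc_rows: "bij_betw Suc {0..<k} {1..k}"
  by (simp add: bij_betw_def atLeastLessThanSuc_atLeastAtMost)

text \<open>For \<open>b = (r, c)\<close> the set \<open>I\<^sub>b\<close> consists of the labels of the lower edge of \<open>b\<close> and of the
  vertical edges at these columns in the other rows. The row operations by \<open>C\<close> in the next proof
  replace \<open>M\<close> by a matrix whose rows have these labels as leading columns, once the columns
  \<open>rl s\<close> with \<open>s < r\<close> are ranked above all others.\<close>

lemma pluecker_outer_label:
  fixes M :: "'a::field mat"
  assumes M: "echelon M" and L: "label_system D LH LV" and N: "vector_system D p NH NV"
    and up: "\<And>r c. (r, c) \<in> B \<Longrightarrow> D (r, c) = Plus \<Longrightarrow> LH r c < LV r c"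
    and down: "\<And>r c. (r, c) \<in> B \<Longrightarrow> D (r, c) = Black \<Longrightarrow> LV r c < LH r c"
    and b: "(r, c) \<in> B" and asc: "LH r c < LV r c"
    and cons: "\<And>r' c'. (r', c') \<in> B \<Longrightarrow> r \<le> r' \<Longrightarrow> c \<le> c' \<Longrightarrow> (r', c') \<noteq> (r, c) \<Longrightarrow>
                 consistent D p M NH (r', c')"
    and inj: "inj_on (outer_label LH LV (r, c)) {1..k}"
      "inj_on ((outer_label LH LV (r, c))(r := LH r c)) {1..k}"
  shows "pluecker M (outer_label LH LV (r, c) ` {1..k}) = 0 \<longleftrightarrow> reduce M (NH r c) (cl c) = 0"
proof -
  define l where "l = outer_label LH LV (r, c)"
  define x where "x = reduce M (NH r c) (cl c)"
  \<comment> \<open>The projected lower vector has coordinate \<open>edge_sign r c\<close> at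
    \<open>cl c\<close>, so this multiple of it cancels \<open>x\<close> there.\<close>
  define y where "y r' = (if r' = r then (\<lambda>t. NH r c t + - edge_sign r c * x * NV r c t)
                          else NH r' (outer_col (r, c) r'))" for r'
  \<comment> \<open>For \<open>x = 0\<close> the lower vector drops out of \<open>y r\<close>, and
    the lead falls from \<open>LV r c\<close> to \<open>LH r c\<close>.\<close>
  define l' where "l' = (if x = 0 then l(r := LH r c) else l)"
  \<comment> \<open>The shift by \<open>n + 1\<close> carries the pivots of the rows above
    \<open>b\<close> past all columns. Rows from \<open>r\<close> on vanish there, and each row
    above has exactly one such pivot, its own.\<close>
  define rk where "rk t = (if t \<in> rl ` {1..<r} then t + n + 1 else t)" for t
  \<comment> \<open>With the pivot coordinates of \<open>y\<close> as coefficients, the rows of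
    \<open>C * M\<close> are the vectors \<open>y\<close> minus their projections.\<close>
  define C where "C = mat k k (\<lambda>(a, b). y (Suc a) (rl (Suc b)))"
  have r: "r \<in> {1..k}" "c \<le> lam r" and c: "c \<in> {1..m}" "r \<le> len c"
    using b box_iff box_iff' by auto
  have C: "C \<in> carrier_mat k k" and Mc: "M \<in> carrier_mat k n"
    using echelon_carrier[OF M] by (auto simp: C_def)
  have plus: "p (r', c') \<noteq> 0" if "consistent D p M NH (r', c')" "D (r', c') = Plus" for r' c'
    using that(1) unfolding consistent_def prod.case that(2) filling.case by blast
  have cons_plus: "D (r', c') = Plus \<longrightarrow> p (r', c') \<noteq> 0"
    if "(r', c') \<in> B" "r \<le> r'" "c \<le> c'" "(r', c') \<noteq> (r, c)" for r' c'
    using plus[OF cons[OF that]] by blast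
  have outer: "outer_col (r, c) r' \<le> lam r'" for r' by (auto simp: outer_col_def)
  have outer_se: "r \<le> r' \<and> r \<le> r'' \<and> c \<le> c'' \<and> (r'', c'') \<noteq> (r, c)"
    if "r' \<in> {1..k}" "r' \<noteq> r" "(r'', c'') \<in> B" "r' \<le> r''" "outer_col (r, c) r' < c''" for r' r'' c''
  proof -
    have "lam r'' \<le> lam r'" using that by (intro lam_anti) (auto simp: box_iff)
    thus ?thesis using that by (auto simp: outer_col_def box_iff split: if_splits)
  qed
  have consH: "consistent D p M NH (r'', c'')"
    if "r' \<in> {1..k}" "r' \<noteq> r" "(r'', c'') \<in> B" "r' \<le> r''" "outer_col (r, c) r' < c''" for r' r'' c''
    using outer_se[OF that] cons that(3) by blast
  have redH: "reduce M (NH r' (outer_col (r, c) r')) t = 0"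
    if "r' \<in> {1..k}" "r' \<noteq> r" "t \<notin> cl ` {1..outer_col (r, c) r'}" for r' t
    using reduce_support(1)[OF M N that(1) outer consH[OF that(1,2)]] that(3) by blast
  have redh: "reduce M (NH r c) t = 0" if "t \<notin> cl ` {1..c}" for t
    using reduce_support(1)[OF M N r] cons that by auto
  have redv: "reduce M (NV r c) (cl c) = edge_sign r c" "t \<notin> cl ` {1..c} \<Longrightarrow> reduce M (NV r c) t = 0" for t
    using reduce_support(2)[OF M N c] cons by auto
  have redy: "reduce M (y r') t = 0" if r': "r' \<in> {r..k}" and t: "t \<notin> cl ` {1..<c}" for r' t
  proof (cases "r' = r")
    case True
    show ?thesis
    proof (cases "t = cl c")
      case True
      thus ?thesis using \<open>r' = r\<close>
        by (simp add: y_def reduce_linear redv(1) x_def[symmetric])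
    next
      case False
      hence "t \<notin> cl ` {1..c}" using t by (auto simp: le_less)
      thus ?thesis using \<open>r' = r\<close> by (simp add: y_def reduce_linear redh redv(2))
    qed
  next
    case False
    hence "outer_col (r, c) r' < c" using r' c by (auto simp: outer_col_def)
    hence "t \<notin> cl ` {1..outer_col (r, c) r'}" using t by auto
    thus ?thesis using redH[of r' t] r' r False by (auto simp: y_def)
  qed
  have lead: "has_lead (y r') (l' r')" if r': "r' \<in> {1..k}" for r'
  proof (cases "r' = r")
    case True
    have lh: "has_lead (NH r c) (LH r c)"
      by (rule vector_lead(1)[OF L N up down r]) (assumption | rule cons_plus | simp)+
    have lv: "has_lead (NV r c) (LV r c)"
      by (rule vector_lead(2)[OF L N up down c]) (assumption | rule cons_plus | simp)+
    show ?thesis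
      using True lh lv asc by (auto simp: y_def l'_def l_def outer_label_def has_lead_def)
  next
    case False
    have "has_lead (NH r' (outer_col (r, c) r')) (LH r' (outer_col (r, c) r'))"
      using vector_lead(1)[OF L N up down r' outer] consH[OF r' False] plus by blast
    thus ?thesis using False by (simp add: y_def l'_def l_def outer_label_def)
  qed
  have y0: "y r' (rl s) = 0" if "r' \<in> {r..k}" "s \<in> {1..<r}" for r' s
  proof -
    have s: "s \<in> {1..k}" using that r by auto
    have "NH r c (rl s) = 0" "NV r c (rl s) = 0"
      using vector_support(1)[OF N r] vector_support(2)[OF N c] s that by auto
    moreover have "NH r' (outer_col (r, c) r') (rl s) = 0"
      using vector_support(1)[OF N _ outer, of r'] s that r by auto
    ultimately show ?thesis by (simp add: y_def)
  qed
  have low: "outer_col (r, c) r' = lam r'" "y r' = unit_at (rl r')" "l r' = rl r'" "l' r' = rl r'"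
    if "r' \<in> {1..<r}" for r'
    using that r edge_system_row[OF N, of r'] edge_system_row[OF L, of r']
    by (auto simp: outer_col_def y_def l_def l'_def outer_label_def)
  have entries: "(C * M) $$ (a, t - 1) = y (Suc a) t - reduce M (y (Suc a)) t"
    if a: "a < k" and t: "t \<in> {1..n}" for a t
  proof -
    have "(C * M) $$ (a, t - 1) = (\<Sum>s = 0..<k. y (Suc a) (rl (Suc s)) * M $$ (s, t - 1))"
      using a t Mc C by (auto simp: scalar_prod_def C_def intro!: sum.cong)
    also have "\<dots> = (\<Sum>s = 0..<k. y (Suc a) (rl (Suc s)) * entry M (Suc s) t)"
      using t by (simp add: entry_def)
    also have "\<dots> = (\<Sum>s=1..k. y (Suc a) (rl s) * entry M s t)"
      using sum.reindex_bij_betw[OF bij_betw_Suc_rows] .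
    finally show ?thesis by (simp add: reduce_def)
  qed
  have entry_high: "(C * M) $$ (a, t - 1) = y (Suc a) t"
    if "a < k" "r \<le> Suc a" "t \<in> {1..n}" "t \<notin> cl ` {1..<c}" for a t
    using entries[OF that(1,3)] redy[of "Suc a" t] that by simp
  have entry_low: "(C * M) $$ (a, t - 1) = entry M (Suc a) t" if "Suc a < r" "t \<in> {1..n}" for a t
    using entries[of a t] low(2)[of "Suc a"] reduce_unit_row[of "Suc a" M t] that r by simp
  have labels: "g r' \<in> {1..n}" "g r' \<notin> cl ` {1..<c}" "r \<le> r' \<Longrightarrow> g r' \<notin> rl ` {1..<r}"
    if g: "g = l \<or> g = l'" and r': "r' \<in> {1..k}" for g r'
  proof -
    have notin: "q \<in> {1..n} \<and> q \<notin> cl ` {1..<c} \<and> q \<notin> rl ` {1..<r}"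
      if "q \<in> rl ` {r..k} \<union> cl ` {c..m}" for q
    proof -
      have "rl ` {r..k} \<union> cl ` {c..m} \<subseteq> rl ` {1..k} \<union> cl ` {1..m}"
        using r c by (intro Un_mono image_mono) auto
      hence "q \<in> {1..n}" using that labels_union by blast
      moreover have "q \<notin> cl ` {1..<c}"
        using that cl_eq_iff rl_neq_cl r c by fastforce
      moreover have "q \<notin> rl ` {1..<r}"
        using that rl_eq_iff rl_neq_cl r c by fastforce
      ultimately show ?thesis by simp
    qed
    have "g r' \<in> rl ` {r..k} \<union> cl ` {c..m}" if rr': "r \<le> r'"
    proof (cases "r' = r")
      case True
      have "LH r c \<in> rl ` {r..k} \<union> cl ` {Suc c..m}" "LV r c \<in> rl ` {Suc r..k} \<union> cl ` {c..m}"
        using label_support[OF L] r c by auto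
      hence "LH r c \<in> rl ` {r..k} \<union> cl ` {c..m}" "LV r c \<in> rl ` {r..k} \<union> cl ` {c..m}" by auto
      thus ?thesis using g True by (auto simp: l_def l'_def outer_label_def)
    next
      case False
      have "LH r' (outer_col (r, c) r') \<in> rl ` {r..k} \<union> cl ` {c..m}"
      proof (cases "lam r' \<le> c - 1")
        case True
        hence "outer_col (r, c) r' = lam r'" using rr' by (simp add: outer_col_def)
        thus ?thesis using edge_system_row[OF L r'] r' rr' by auto
      next
        case False
        hence *: "outer_col (r, c) r' = c - 1" using rr' by (simp add: outer_col_def)
        have "LH r' (outer_col (r, c) r') \<in> rl ` {r'..k} \<union> cl ` {Suc (c - 1)..m}"
          using label_support(1)[OF L r' outer] * by metis
        moreover have "{r'..k} \<subseteq> {r..k}" "Suc (c - 1) = c" using rr' c by auto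
        ultimately show ?thesis by auto
      qed
      thus ?thesis using False g by (auto simp: l_def l'_def outer_label_def)
    qed
    moreover have "g r' \<in> {1..n} \<and> g r' \<notin> cl ` {1..<c}" if "r' < r"
    proof -
      have "g r' = rl r'" using low[of r'] that r' g by auto
      thus ?thesis using rl_range[OF r'] rl_neq_cl[OF r'] c by fastforce
    qed
    ultimately show "g r' \<in> {1..n}" "g r' \<notin> cl ` {1..<c}" "r \<le> r' \<Longrightarrow> g r' \<notin> rl ` {1..<r}"
      using notin[of "g r'"] by (cases "r \<le> r'"; force)+
  qed
  have le_rk: "rk t \<le> rk (l' (Suc a))"
    if a: "a < k" and t: "t \<in> {1..n}" "t \<notin> cl ` {1..<c}" and nz: "(C * M) $$ (a, t - 1) \<noteq> 0" for a t
  proof (cases "r \<le> Suc a")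
    case True
    have yt: "y (Suc a) t \<noteq> 0" using nz entry_high[OF a True t] by simp
    hence "t \<notin> rl ` {1..<r}" using y0[of "Suc a"] True a by auto
    moreover have "t \<le> l' (Suc a)"
      using lead[of "Suc a"] a yt by (auto simp: has_lead_def not_le[symmetric])
    ultimately show ?thesis by (simp add: rk_def)
  next
    case False
    have e: "entry M (Suc a) t \<noteq> 0" using nz entry_low[of a t] False t by simp
    have sa: "Suc a \<in> {1..<r}" "Suc a \<in> {1..k}" using False a by auto
    have "t = rl (Suc a)" if "t \<in> rl ` {1..<r}"
      using that e echelon_pivot[OF M sa(2)] r by (auto split: if_splits)
    thus ?thesis using low(4)[OF sa(1)] sa t by (auto simp: rk_def)
  qed
  have nz_l': "(C * M) $$ (a, l' (Suc a) - 1) \<noteq> 0" if a: "a < k" for a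
  proof (cases "r \<le> Suc a")
    case True
    thus ?thesis using entry_high[OF a True] labels[of l' "Suc a"] lead[of "Suc a"] a
      by (auto simp: has_lead_def)
  next
    case False
    hence sa: "Suc a \<in> {1..<r}" "Suc a \<in> {1..k}" using a by auto
    thus ?thesis using entry_low[of a "rl (Suc a)"] low(4)[OF sa(1)] echelon_pivot[OF M sa(2) sa(2)]
      rl_range[OF sa(2)] by auto
  qed
  have inj_rk: "inj_on rk {1..n}" by (auto simp: inj_on_def rk_def)
  have bij: "bij_betw (\<lambda>a. g (Suc a)) {0..<k} (g ` {1..k})" "g ` {1..k} \<subseteq> {1..n}" "card (g ` {1..k}) = k"
    if "g = l \<or> g = l'" for g
  proof -
    have i: "inj_on g {1..k}" using that inj by (auto simp: l_def l'_def)
    show "bij_betw (\<lambda>a. g (Suc a)) {0..<k} (g ` {1..k})"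
      using bij_betw_trans[OF bij_betw_Suc_rows bij_betw_imageI[OF i refl]] by (simp add: comp_def)
    show "g ` {1..k} \<subseteq> {1..n}" using labels(1)[OF that] by blast
    show "card (g ` {1..k}) = k" using card_image[OF i] by simp
  qed
  \<comment> \<open>The minor at the leads is nonzero whether or not \<open>x\<close> vanishes. It
    certifies that \<open>C\<close> is invertible, so the minor of \<open>M\<close> at
    \<open>l\<close> may be tested on \<open>C * M\<close>.\<close>
  have nonzero: "pluecker (C * M) (l' ` {1..k}) \<noteq> 0"
  proof (rule pluecker_nonzero_if_lead)
    show "C * M \<in> carrier_mat k n" using C Mc by simp
    show "inj_on rk (l' ` {1..k})" using inj_rk bij(2)[of l'] by (auto intro: inj_on_subset)
    show "rk t \<le> rk (l' (Suc a))" if "a < k" "t \<in> l' ` {1..k}" "(C * M) $$ (a, t - 1) \<noteq> 0" for a t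
      using le_rk[OF that(1) _ _ that(3)] labels(1,2)[of l'] that(2) by auto
  qed (use bij[of l'] nz_l' in auto)
  hence detC: "det C \<noteq> 0"
    using pluecker_mult[OF C Mc bij(2,3)[of l']] by auto
  have "pluecker M (l ` {1..k}) = 0 \<longleftrightarrow> pluecker (C * M) (l ` {1..k}) = 0"
    using pluecker_mult[OF C Mc bij(2,3)[of l]] detC by simp
  also have "\<dots> \<longleftrightarrow> x = 0"
  proof (cases "x = 0")
    case False
    hence "l' = l" by (simp add: l'_def)
    thus ?thesis using nonzero False by simp
  next
    case True
    hence l': "l' = l(r := LH r c)" by (simp add: l'_def)
    have lr: "l r = LV r c" by (simp add: l_def outer_label_def)
    have notlow: "LV r c \<notin> rl ` {1..<r}" "LH r c \<notin> rl ` {1..<r}"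
      using labels(3)[of l r] labels(3)[of l' r] r lr l' by auto
    have "pluecker (C * M) (l ` {1..k}) = 0"
    proof (rule pluecker_zero_if_lead[where l' = "\<lambda>a. l' (Suc a)"])
      show "C * M \<in> carrier_mat k n" using C Mc by simp
      show "rk t \<le> rk (l' (Suc a))" if "a < k" "t \<in> l ` {1..k}" "(C * M) $$ (a, t - 1) \<noteq> 0" for a t
        using le_rk[OF that(1) _ _ that(3)] labels(1,2)[of l] that(2) by auto
      show "rk (l' (Suc a)) \<le> rk (l (Suc a))" for a
        using asc notlow lr by (auto simp: l' rk_def)
      show "r - 1 < k" using r by auto
      show "rk (l' (Suc (r - 1))) < rk (l (Suc (r - 1)))"
        using asc notlow lr r by (auto simp: l' rk_def)
    qed (use bij[of l] in auto)
    thus ?thesis using True by simp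
  qed
  finally show ?thesis by (simp add: l_def x_def)
qed

end

section \<open>Permutation labels of the edges\<close>

lemma perm_prod_snoc: "perm_prod (us @ [u]) = perm_prod us \<circ> u"
  by (induction us) (simp_all add: perm_prod_def comp_assoc)

text \<open>Exchanging the positions \<open>i\<close> and \<open>Suc i\<close> maps inversions
  injectively to inversions, and \<open>(i, Suc i)\<close> becomes a new one.\<close>

lemma perm_length_less_transpose:
  assumes "v i < v (Suc i)" "1 \<le> i" "Suc i \<le> n"
  shows "perm_length n v < perm_length n (v \<circ> transpose i (Suc i))"
proof -
  let ?s = "transpose i (Suc i)"
  let ?I = "\<lambda>u. {(a, b). 1 \<le> a \<and> a < b \<and> b \<le> n \<and> u b < u a}"
  let ?f = "map_prod ?s ?s"
  have fin: "finite (?I u)" for u :: "nat \<Rightarrow> nat"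
    by (rule finite_subset[of _ "{1..n} \<times> {1..n}"]) auto
  have "inj ?s" by simp
  hence inj: "inj ?f" by (rule prod.inj_map[OF _ \<open>inj ?s\<close>])
  have "?f ` ?I v \<subset> ?I (v \<circ> ?s)"
  proof
    show "?f ` ?I v \<subseteq> ?I (v \<circ> ?s)"
    proof
      fix q assume "q \<in> ?f ` ?I v"
      then obtain a b where ab: "1 \<le> a" "a < b" "b \<le> n" "v b < v a" "q = (?s a, ?s b)" by auto
      have "(a, b) \<noteq> (i, Suc i)" using ab assms by auto
      hence "1 \<le> ?s a \<and> ?s a < ?s b \<and> ?s b \<le> n"
        using ab assms by (auto simp: transpose_def)
      thus "q \<in> ?I (v \<circ> ?s)" using ab by simp
    qed
    have "(i, Suc i) \<in> ?I (v \<circ> ?s)" using assms by simp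
    moreover have "(i, Suc i) \<notin> ?f ` ?I v"
    proof
      assume "(i, Suc i) \<in> ?f ` ?I v"
      then obtain a b where "a < b" "?s a = i" "?s b = Suc i" by auto
      thus False by (auto simp: transpose_def split: if_splits)
    qed
    ultimately show "?f ` ?I v \<noteq> ?I (v \<circ> ?s)" by metis
  qed
  hence "card (?f ` ?I v) < card (?I (v \<circ> ?s))" using fin by (rule psubset_card_mono[rotated])
  moreover have "card (?f ` ?I v) = card (?I v)"
    by (rule card_image) (rule inj_on_subset[OF inj subset_UNIV])
  ultimately show ?thesis by (simp add: perm_length_def)
qed

lemma bruhat_le_length: "bruhat_le n u v \<Longrightarrow> perm_length n u \<le> perm_length n v"
  unfolding bruhat_le_def by (induction rule: rtranclp_induct) (auto simp: bruhat_step_def)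

lemma bruhat_less_transpose:
  assumes "v permutes {1..n}" "v i < v (Suc i)" "1 \<le> i" "Suc i \<le> n"
  shows "bruhat_less n v (v \<circ> transpose i (Suc i))"
proof -
  have "bruhat_step n v (v \<circ> transpose i (Suc i))"
    unfolding bruhat_step_def using perm_length_less_transpose[OF assms(2-4)] assms
    by (intro conjI exI[of _ i] exI[of _ "Suc i"]) simp_all
  moreover have "v \<noteq> v \<circ> transpose i (Suc i)"
    using assms(2) by (metis comp_apply less_irrefl transpose_apply_first)
  ultimately show ?thesis by (auto simp: bruhat_less_def bruhat_le_def)
qed

context partition_shape
begin

text \<open>Common generalisation of the prefixes of the reading order and of the lists
  \<^term>\<open>in_boxes k lam b\<close>, neither of which specialises to the other.\<close>

inductive nw_growing :: "box list \<Rightarrow> bool" where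
  Nil: "nw_growing []"
| snoc: "nw_growing bs \<Longrightarrow> (r, c) \<in> B \<Longrightarrow> (r, c) \<notin> set bs \<Longrightarrow>
    (\<And>r' c'. (r', c') \<in> B \<Longrightarrow> r \<le> r' \<Longrightarrow> c \<le> c' \<Longrightarrow> (r', c') \<noteq> (r, c) \<Longrightarrow> (r', c') \<in> set bs) \<Longrightarrow>
    nw_growing (bs @ [(r, c)])"

lemma nw_growing_closed:
  assumes "nw_growing bs" "(r, c) \<in> set bs" "(r', c') \<in> B" "r \<le> r'" "c \<le> c'"
  shows "(r', c') \<in> set bs"
  using assms by (induction bs rule: nw_growing.induct) auto

lemma nw_growing_subset: "nw_growing bs \<Longrightarrow> set bs \<subseteq> B"
  by (induction bs rule: nw_growing.induct) auto

lemma box_refl_eq: "(r, c) \<in> B \<Longrightarrow> box_refl n k (r, c) = transpose (m - c + r) (Suc (m - c + r))"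
proof -
  assume "(r, c) \<in> B"
  hence "c \<le> m" using box_col[of r c] by simp
  hence "m + r - c = m - c + r" by (rule Nat.add_diff_assoc2[symmetric])
  thus ?thesis by (simp only: box_refl_def Let_def prod.case Suc_eq_plus1)
qed

lemma box_position: "(r, c) \<in> B \<Longrightarrow> 1 \<le> m - c + r \<and> Suc (m - c + r) \<le> n"
  using box_col[of r c] k_le_n by (auto simp: box_iff)

lemma v_factor_permutes: "b \<in> B \<Longrightarrow> v_factor n k D b permutes {1..n}"
proof (cases b)
  case (Pair r c)
  assume "b \<in> B"
  hence "(r, c) \<in> B" using Pair by simp
  thus ?thesis using box_position[of r c]
    by (auto simp: v_factor_def Pair box_refl_eq permutes_id intro!: permutes_swap_id)
qed

lemma perm_prod_permutes: "nw_growing bs \<Longrightarrow> perm_prod (map (v_factor n k D) bs) permutes {1..n}"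
proof (induction bs rule: nw_growing.induct)
  case Nil thus ?case by (simp add: perm_prod_def permutes_def)
next
  case (snoc bs r c)
  show ?case
    unfolding map_append list.map perm_prod_snoc
    by (rule permutes_compose[OF v_factor_permutes[OF snoc.hyps(2)] snoc.IH])
qed

text \<open>The boxes read so far are bounded by a lattice path, and the permutation evaluated at a
  step number is the label of that edge: step \<open>m - c + r\<close> for the vertical edge and
  \<open>m - c + 1 + r\<close> for the horizontal edge at \<open>(r, c)\<close>. The two conditions
  place an edge on the path: its northwest side is unread, its southeast side is read or outside the
  diagram.\<close>

lemma perm_prod_label:
  assumes L: "label_system D LH LV" and bs: "nw_growing bs"
  shows "(\<forall>r\<in>{1..k}. \<forall>c\<le>lam r. (c = 0 \<or> (r, c) \<notin> set bs) \<longrightarrow>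
            ((r, Suc c) \<in> B \<longrightarrow> (r, Suc c) \<in> set bs) \<longrightarrow>
            perm_prod (map (v_factor n k D) bs) (m - c + r) = LH r c) \<and>
         (\<forall>c\<in>{1..m}. \<forall>r\<le>len c. (r = 0 \<or> (r, c) \<notin> set bs) \<longrightarrow>
            ((Suc r, c) \<in> B \<longrightarrow> (Suc r, c) \<in> set bs) \<longrightarrow>
            perm_prod (map (v_factor n k D) bs) (m - c + 1 + r) = LV r c)"
  using bs
proof (induction bs rule: nw_growing.induct)
  case Nil
  show ?case
  proof (intro conjI ballI allI impI)
    fix r c assume "r \<in> {1..k}" "c \<le> lam r" "(r, Suc c) \<in> B \<longrightarrow> (r, Suc c) \<in> set []"
    hence "c = lam r" by (auto simp: box_iff)
    thus "perm_prod (map (v_factor n k D) []) (m - c + r) = LH r c"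
      using edge_system_row[OF L] \<open>r \<in> {1..k}\<close> by (simp add: perm_prod_def rl_eq)
  next
    fix c r assume "c \<in> {1..m}" "r \<le> len c" "(Suc r, c) \<in> B \<longrightarrow> (Suc r, c) \<in> set []"
    hence "r = len c" by (auto simp: box_iff')
    thus "perm_prod (map (v_factor n k D) []) (m - c + 1 + r) = LV r c"
      using edge_system_col[OF L \<open>c \<in> {1..m}\<close>] by (simp add: perm_prod_def cl_eq)
  qed
next
  case (snoc bs r\<^sub>0 c\<^sub>0)
  let ?v = "perm_prod (map (v_factor n k D) bs)" and ?i = "m - c\<^sub>0 + r\<^sub>0"
  let ?v' = "perm_prod (map (v_factor n k D) (bs @ [(r\<^sub>0, c\<^sub>0)]))"
  have b: "r\<^sub>0 \<in> {1..k}" "1 \<le> c\<^sub>0" "c\<^sub>0 \<le> lam r\<^sub>0" "c\<^sub>0 \<in> {1..m}" "1 \<le> r\<^sub>0" "r\<^sub>0 \<le> len c\<^sub>0"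
    using snoc(2) box_iff box_iff' by auto
  have v': "?v' = ?v \<circ> v_factor n k D (r\<^sub>0, c\<^sub>0)" by (simp add: perm_prod_snoc)
  have vh: "?v ?i = LH r\<^sub>0 c\<^sub>0" 
    by (rule conjunct1[OF snoc.IH, rule_format]) (use snoc.hyps(3,4) b in auto)
  have vv: "?v (Suc ?i) = LV r\<^sub>0 c\<^sub>0"
    using conjunct2[OF snoc.IH, rule_format, of c\<^sub>0 r\<^sub>0] snoc.hyps(3,4) b by auto
  \<comment> \<open>The right edge has step number \<open>?i\<close> and the left edge
    \<open>Suc ?i\<close>, so applying the transposition means that the labels go straight
    on.\<close>
  have left: "?v' (Suc ?i) = LH r\<^sub>0 (c\<^sub>0 - 1)" and up: "?v' ?i = LV (r\<^sub>0 - 1) c\<^sub>0"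
    unfolding v' edge_system_left[OF L snoc(2)] edge_system_up[OF L snoc(2)]
    using vh vv by (auto simp: v_factor_def box_refl_eq[OF snoc(2)] label_step_def)
  have same: "?v' q = ?v q" if "q \<noteq> ?i" "q \<noteq> Suc ?i" for q
    using that unfolding v' by (simp add: v_factor_def box_refl_eq[OF snoc(2)])
  show ?case
  proof (intro conjI ballI allI impI)
    fix r c assume r: "r \<in> {1..k}" "c \<le> lam r" and fr: "c = 0 \<or> (r, c) \<notin> set (bs @ [(r\<^sub>0, c\<^sub>0)])"
      "(r, Suc c) \<in> B \<longrightarrow> (r, Suc c) \<in> set (bs @ [(r\<^sub>0, c\<^sub>0)])"
    show "?v' (m - c + r) = LH r c"
    proof (cases "(r, Suc c) = (r\<^sub>0, c\<^sub>0)")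
      case True
      hence "m - c + r = Suc ?i" using b by auto
      thus ?thesis using left True by auto
    next
      case False
      have old: "?v (m - c + r) = LH r c"
        by (rule conjunct1[OF snoc.IH, rule_format]) (use r fr False in auto)
      \<comment> \<open>A path has one edge per step number. A further edge at one of these two
        numbers would contradict that the boxes read are closed towards the southeast.\<close>
      have "m - c + r \<noteq> ?i \<and> m - c + r \<noteq> Suc ?i"
      proof (cases r r\<^sub>0 rule: linorder_cases)
        case less
        have "c\<^sub>0 \<le> c"
        proof (rule ccontr)
          assume "\<not> c\<^sub>0 \<le> c"
          moreover have "lam r\<^sub>0 \<le> lam r" using less r b by (intro lam_anti) auto
          ultimately have "(r, Suc c) \<in> set bs" "Suc c \<le> c\<^sub>0"
            using fr(2) r b False by (auto simp: box_iff)
          hence "(r\<^sub>0, c\<^sub>0) \<in> set bs"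
            using nw_growing_closed[OF snoc(1)] snoc(2) less by auto
          thus False using snoc by blast
        qed
        thus ?thesis using less by linarith
      next
        case equal
        have "c < c\<^sub>0"
        proof (rule ccontr)
          assume "\<not> c < c\<^sub>0"
          moreover have "c \<noteq> c\<^sub>0" using fr(1) equal b by auto
          ultimately have "(r, c) \<in> set bs" using snoc.hyps(4)[of r c] r b equal by (auto simp: box_iff)
          thus False using fr(1) b \<open>\<not> c < c\<^sub>0\<close> by auto
        qed
        moreover have "\<not> Suc c < c\<^sub>0"
        proof
          assume *: "Suc c < c\<^sub>0"
          hence "(r, Suc c) \<in> B" using r equal b by (auto simp: box_iff)
          hence "(r, Suc c) \<in> set bs" using fr(2) False by auto
          hence "(r\<^sub>0, c\<^sub>0) \<in> set bs"
            using nw_growing_closed[OF snoc(1)] snoc(2) equal * by auto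
          thus False using snoc by blast
        qed
        ultimately show ?thesis using False equal by auto
      next
        case greater
        have "c < c\<^sub>0"
        proof (rule ccontr)
          assume "\<not> c < c\<^sub>0"
          hence "(r, c) \<in> set bs" using snoc.hyps(4)[of r c] r b greater by (auto simp: box_iff)
          thus False using fr(1) b \<open>\<not> c < c\<^sub>0\<close> by auto
        qed
        thus ?thesis using greater b by auto
      qed
      thus ?thesis using same old by simp
    qed
  next
    fix c r assume c: "c \<in> {1..m}" "r \<le> len c" and fr: "r = 0 \<or> (r, c) \<notin> set (bs @ [(r\<^sub>0, c\<^sub>0)])"
      "(Suc r, c) \<in> B \<longrightarrow> (Suc r, c) \<in> set (bs @ [(r\<^sub>0, c\<^sub>0)])"
    show "?v' (m - c + 1 + r) = LV r c"
    proof (cases "(Suc r, c) = (r\<^sub>0, c\<^sub>0)")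
      case True
      hence "m - c + 1 + r = ?i" using b by auto
      thus ?thesis using up True by auto
    next
      case False
      have old: "?v (m - c + 1 + r) = LV r c"
        by (rule conjunct2[OF snoc.IH, rule_format]) (use c fr False in auto)
      have "m - c + 1 + r \<noteq> ?i \<and> m - c + 1 + r \<noteq> Suc ?i"
      proof (cases c c\<^sub>0 rule: linorder_cases)
        case less
        have "r\<^sub>0 \<le> r"
        proof (rule ccontr)
          assume "\<not> r\<^sub>0 \<le> r"
          moreover have "len c\<^sub>0 \<le> len c" using less by (intro len_anti) auto
          ultimately have "(Suc r, c) \<in> set bs" "Suc r \<le> r\<^sub>0"
            using fr(2) c b False by (auto simp: box_iff')
          hence "(r\<^sub>0, c\<^sub>0) \<in> set bs"
            using nw_growing_closed[OF snoc(1)] snoc(2) less by auto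
          thus False using snoc by blast
        qed
        thus ?thesis using less b by auto
      next
        case equal
        have "r < r\<^sub>0"
        proof (rule ccontr)
          assume "\<not> r < r\<^sub>0"
          moreover have "r \<noteq> r\<^sub>0" using fr(1) equal b by auto
          ultimately have "(r, c) \<in> set bs" using snoc.hyps(4)[of r c] c b equal by (auto simp: box_iff')
          thus False using fr(1) b \<open>\<not> r < r\<^sub>0\<close> by auto
        qed
        moreover have "\<not> Suc r < r\<^sub>0"
        proof
          assume *: "Suc r < r\<^sub>0"
          hence "(Suc r, c) \<in> B" using c equal b by (auto simp: box_iff')
          hence "(Suc r, c) \<in> set bs" using fr(2) False by auto
          hence "(r\<^sub>0, c\<^sub>0) \<in> set bs"
            using nw_growing_closed[OF snoc(1)] snoc(2) equal * by auto
          thus False using snoc by blast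
        qed
        ultimately show ?thesis using False equal by auto
      next
        case greater
        have "r < r\<^sub>0"
        proof (rule ccontr)
          assume "\<not> r < r\<^sub>0"
          hence "(r, c) \<in> set bs" using snoc.hyps(4)[of r c] c b greater by (auto simp: box_iff')
          thus False using fr(1) b \<open>\<not> r < r\<^sub>0\<close> by auto
        qed
        thus ?thesis using greater c b by auto
      qed
      thus ?thesis using same old by simp
    qed
  qed
qed

lemma perm_prod_row_label:
  assumes "label_system D LH LV" "nw_growing bs" "r \<in> {1..k}" "c \<le> lam r"
    "c = 0 \<or> (r, c) \<notin> set bs" "(r, Suc c) \<in> B \<Longrightarrow> (r, Suc c) \<in> set bs"
  shows "perm_prod (map (v_factor n k D) bs) (m - c + r) = LH r c"
  using perm_prod_label[OF assms(1,2)] assms(3-6) by blast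

lemma perm_prod_col_label:
  assumes "label_system D LH LV" "nw_growing bs" "c \<in> {1..m}" "r \<le> len c"
    "r = 0 \<or> (r, c) \<notin> set bs" "(Suc r, c) \<in> B \<Longrightarrow> (Suc r, c) \<in> set bs"
  shows "perm_prod (map (v_factor n k D) bs) (m - c + 1 + r) = LV r c"
  using perm_prod_label[OF assms(1,2)] assms(3-6) by blast

section \<open>The reading order and the boxes southeast of a box\<close>

definition reading_before :: "box \<Rightarrow> box \<Rightarrow> bool" where
  "reading_before b b' \<longleftrightarrow> fst b' < fst b \<or> fst b' = fst b \<and> snd b' < snd b"

text \<open>Boxes weakly southeast of a box precede it in the reading order, so removing the last
  box leaves a list closed towards the southeast.\<close>

lemma nw_growing_if_sorted:
  assumes "sorted_wrt reading_before bs" "set bs \<subseteq> B"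
    "\<And>r c r' c'. (r, c) \<in> set bs \<Longrightarrow> (r', c') \<in> B \<Longrightarrow> r \<le> r' \<Longrightarrow> c \<le> c' \<Longrightarrow> (r', c') \<in> set bs"
  shows "nw_growing bs"
  using assms
proof (induction bs rule: rev_induct)
  case Nil show ?case by (rule nw_growing.Nil)
next
  case (snoc b bs)
  obtain r c where b: "b = (r, c)" by fastforce
  have before: "\<forall>b'\<in>set bs. reading_before b' b" and s: "sorted_wrt reading_before bs"
    using snoc(2) by (auto simp: sorted_wrt_append)
  have "(r', c') \<in> set bs" if "(r\<^sub>1, c\<^sub>1) \<in> set bs" "(r', c') \<in> B" "r\<^sub>1 \<le> r'" "c\<^sub>1 \<le> c'" for r\<^sub>1 c\<^sub>1 r' c'
    using snoc(4)[of r\<^sub>1 c\<^sub>1 r' c'] that before by (auto simp: b reading_before_def)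
  hence "nw_growing bs" using snoc.IH[OF s] snoc(3) by auto
  moreover have "(r, c) \<notin> set bs" using before by (auto simp: b reading_before_def)
  ultimately show ?case
    unfolding b using snoc(3) snoc(4)[of r c] by (intro nw_growing.snoc) (auto simp: b)
qed

lemma sorted_reading_order: "sorted_wrt reading_before (reading_order k lam)"
proof -
  have "sorted_wrt reading_before
          (concat (map (\<lambda>r. map (\<lambda>c. (r, c)) (rev [1..<Suc (lam r)])) rs))"
    if "sorted_wrt (>) rs" for rs
    using that
  proof (induction rs)
    case (Cons r rs)
    have "sorted_wrt reading_before (map (\<lambda>c. (r, c)) (rev [1..<Suc (lam r)]))"
      by (simp add: sorted_wrt_map sorted_wrt_rev reading_before_def del: upt_Suc)
    thus ?case using Cons
      by (simp add: sorted_wrt_append del: upt_Suc) (auto simp: reading_before_def)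
  qed simp
  moreover have "sorted_wrt (>) (rev [1..<Suc k])"
    by (simp add: sorted_wrt_rev del: upt_Suc)
  ultimately show ?thesis unfolding reading_order_def by blast
qed

lemma set_reading_order: "set (reading_order k lam) = B"
  by (fastforce simp: reading_order_def boxes_def simp del: upt_Suc)

lemma nw_growing_take: "nw_growing (take j (reading_order k lam))"
proof (rule nw_growing_if_sorted)
  let ?ro = "reading_order k lam"
  show "sorted_wrt reading_before (take j ?ro)" using sorted_reading_order by (rule sorted_wrt_take)
  show "set (take j ?ro) \<subseteq> B" using set_reading_order set_take_subset by metis
  fix r c r' c'
  assume *: "(r, c) \<in> set (take j ?ro)" "(r', c') \<in> B" "r \<le> r'" "c \<le> c'"
  have "sorted_wrt reading_before (take j ?ro @ drop j ?ro)" using sorted_reading_order by simp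
  hence "\<not> (r', c') \<in> set (drop j ?ro)"
    using * unfolding sorted_wrt_append by (fastforce simp: reading_before_def)
  moreover have "set (take j ?ro) \<union> set (drop j ?ro) = B"
    by (metis set_append append_take_drop_id set_reading_order)
  ultimately show "(r', c') \<in> set (take j ?ro)" using * by blast
qed

lemma set_in_boxes: "set (in_boxes k lam (r, c)) = {(r', c'). (r', c') \<in> B \<and> r \<le> r' \<and> c \<le> c'}"
  by (auto simp: in_boxes_def set_reading_order)

lemma nw_growing_in_boxes: "nw_growing (in_boxes k lam (r, c))"
proof (rule nw_growing_if_sorted)
  show "sorted_wrt reading_before (in_boxes k lam (r, c))"
    unfolding in_boxes_def using sorted_reading_order by (rule sorted_wrt_filter)
qed (auto simp: set_in_boxes)

text \<open>The northwest corner of the region is read last.\<close>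

lemma in_boxes_snoc:
  assumes "(r, c) \<in> B"
  obtains bs where "in_boxes k lam (r, c) = bs @ [(r, c)]" "nw_growing bs" "(r, c) \<notin> set bs"
    "\<And>r' c'. (r', c') \<in> B \<Longrightarrow> r \<le> r' \<Longrightarrow> c \<le> c' \<Longrightarrow> (r', c') \<noteq> (r, c) \<Longrightarrow> (r', c') \<in> set bs"
proof -
  have "(r, c) \<in> set (in_boxes k lam (r, c))" using assms by (simp add: set_in_boxes)
  then obtain bs cs where eq: "in_boxes k lam (r, c) = bs @ (r, c) # cs"
    by (meson split_list)
  have "sorted_wrt reading_before (in_boxes k lam (r, c))"
    unfolding in_boxes_def using sorted_reading_order by (rule sorted_wrt_filter)
  hence "\<forall>b\<in>set cs. reading_before (r, c) b" by (simp add: eq sorted_wrt_append)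
  moreover have "\<forall>b\<in>set cs. r \<le> fst b \<and> c \<le> snd b"
    using set_in_boxes[of r c] unfolding eq by auto
  ultimately have "\<forall>b\<in>set cs. False" by (force simp: reading_before_def)
  hence "cs = []" by (cases cs) auto
  hence eq': "in_boxes k lam (r, c) = bs @ [(r, c)]" using eq by simp
  have "nw_growing (bs @ [(r, c)])" using nw_growing_in_boxes[of r c] eq' by simp
  thus thesis using that eq' by (cases rule: nw_growing.cases) auto
qed

section \<open>Go-diagrams and the subsets of the boxes in terms of labels\<close>

lemma v_prefix_labels:
  assumes L: "label_system D LH LV" and j: "j < length (reading_order k lam)"
    and b: "reading_order k lam ! j = (r, c)"
  shows "v_prefix n k lam D j (m - c + r) = LH r c"
    and "v_prefix n k lam D j (Suc (m - c + r)) = LV r c"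
    and "v_prefix n k lam D j permutes {1..n}"
    and "v_prefix n k lam D (Suc j) = v_prefix n k lam D j \<circ> v_factor n k D (r, c)"
proof -
  let ?bs = "take j (reading_order k lam)"
  have suc: "take (Suc j) (reading_order k lam) = ?bs @ [(r, c)]"
    using j b by (simp add: take_Suc_conv_app_nth)
  have g: "nw_growing (?bs @ [(r, c)])" using nw_growing_take[of "Suc j"] suc by simp
  have rc: "r \<in> {1..k}" "c \<le> lam r" "c \<in> {1..m}" "r \<le> len c"
    using nw_growing_subset[OF g] box_iff box_iff' by auto
  have cl: "(r, c) \<notin> set ?bs" "(r', c') \<in> B \<Longrightarrow> r \<le> r' \<Longrightarrow> c \<le> c' \<Longrightarrow> (r', c') \<noteq> (r, c) \<Longrightarrow>
      (r', c') \<in> set ?bs" for r' c'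
    using g by (cases rule: nw_growing.cases; auto)+
  show "v_prefix n k lam D j (m - c + r) = LH r c"
    unfolding v_prefix_def
    by (rule perm_prod_row_label[OF L nw_growing_take]) (use rc cl in auto)
  have "perm_prod (map (v_factor n k D) ?bs) (m - c + 1 + r) = LV r c"
    by (rule perm_prod_col_label[OF L nw_growing_take]) (use rc cl in auto)
  thus "v_prefix n k lam D j (Suc (m - c + r)) = LV r c" by (simp add: v_prefix_def)
  show "v_prefix n k lam D j permutes {1..n}"
    unfolding v_prefix_def by (rule perm_prod_permutes[OF nw_growing_take])
  show "v_prefix n k lam D (Suc j) = v_prefix n k lam D j \<circ> v_factor n k D (r, c)"
    by (simp add: v_prefix_def suc perm_prod_snoc)
qed

text \<open>The labels entering the box are the values of \<open>v\<close> at the two positions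
  exchanged by its reflection, so their order decides whether the reflection lengthens or shortens
  \<open>v\<close>. At a plus a shortening would contradict distinguishedness; at a stone it decides
  the colour.\<close>

lemma go_diagram_labels:
  assumes L: "label_system D LH LV" and go: "go_diagram n k lam D" and b: "(r, c) \<in> B"
  shows "if D (r, c) = Black then LV r c < LH r c else LH r c < LV r c"
proof -
  obtain j where j: "j < length (reading_order k lam)" "reading_order k lam ! j = (r, c)"
    using b set_reading_order by (metis in_set_conv_nth)
  let ?v = "v_prefix n k lam D j" and ?v' = "v_prefix n k lam D (Suc j)" and ?i = "m - c + r"
  note v = v_prefix_labels[OF L j]
  have i: "1 \<le> ?i" "Suc ?i \<le> n" using box_position[OF b] by auto
  have refl: "box_refl n k (r, c) = transpose ?i (Suc ?i)" using box_refl_eq[OF b] .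
  have ne: "?v ?i \<noteq> ?v (Suc ?i)" using injD[OF permutes_inj[OF v(3)], of ?i "Suc ?i"] by auto
  let ?u = "?v \<circ> transpose ?i (Suc ?i)"
  have u: "?u permutes {1..n}"
    using v(3) i by (intro permutes_compose permutes_swap_id) auto
  have le: "bruhat_le n ?v' ?u"
    using go j refl by (auto simp: go_diagram_def distinguished_def)
  have col: "D (r, c) \<noteq> Plus \<Longrightarrow> (bruhat_less n ?v ?v' \<longrightarrow> D (r, c) = White) \<and>
      (bruhat_less n ?v' ?v \<longrightarrow> D (r, c) = Black)"
    using go j by (auto simp: go_diagram_def Let_def)
  have uu: "?u \<circ> transpose ?i (Suc ?i) = ?v" by (simp add: comp_assoc)
  show ?thesis
  proof (cases "D (r, c) = Plus")
    case True
    hence "perm_length n ?v \<le> perm_length n ?u"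
      using bruhat_le_length[OF le] v(4) by (simp add: v_factor_def)
    moreover have "perm_length n ?u < perm_length n ?v" if "?v (Suc ?i) < ?v ?i"
      using perm_length_less_transpose[of ?u ?i n] that i uu by simp
    ultimately show ?thesis using ne True v(1,2) by fastforce
  next
    case False
    hence v': "?v' = ?u" using v(4) refl by (simp add: v_factor_def)
    show ?thesis
    proof (cases "?v ?i < ?v (Suc ?i)")
      case True
      hence "D (r, c) = White" using col[OF False] bruhat_less_transpose[OF v(3) True i] v' by simp
      thus ?thesis using True v(1,2) by simp
    next
      case False': False
      hence "?u ?i < ?u (Suc ?i)" using ne by simp
      hence "D (r, c) = Black"
        using col[OF False] bruhat_less_transpose[OF u _ i] v' uu by simp
      thus ?thesis using False' ne v(1,2) by simp
    qed
  qed
qed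

text \<open>For a stone the factor of \<open>b\<close> in \<open>v_in\<close> cancels against the
  extra reflection, and for a plus it is the identity. In both cases the product before
  \<open>b\<close> is applied to positions computed with \<open>b\<close> included, which explains
  the special role of row \<open>r\<close>.\<close>

lemma box_set_labels:
  assumes L: "label_system D LH LV" and b: "(r, c) \<in> B"
  shows "box_set n k lam D (r, c) = outer_label LH LV (r, c) ` {1..k}"
    and "inj_on (outer_label LH LV (r, c)) {1..k}"
    and "inj_on ((outer_label LH LV (r, c))(r := LH r c)) {1..k}"
proof -
  obtain bs where bs: "in_boxes k lam (r, c) = bs @ [(r, c)]" "nw_growing bs" "(r, c) \<notin> set bs"
    "\<And>r' c'. (r', c') \<in> B \<Longrightarrow> r \<le> r' \<Longrightarrow> c \<le> c' \<Longrightarrow> (r', c') \<noteq> (r, c) \<Longrightarrow> (r', c') \<in> set bs"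
    using in_boxes_snoc[OF b] by blast
  let ?u = "perm_prod (map (v_factor n k D) bs)" and ?w = "w_in n k lam (r, c)"
  let ?o = "outer_col (r, c)" and ?l = "outer_label LH LV (r, c)"
  have rc: "r \<in> {1..k}" "c \<le> lam r" "c \<in> {1..m}" "r \<le> len c" using b box_iff box_iff' by auto
  have bs_se: "r \<le> r' \<and> c \<le> c'" if "(r', c') \<in> set bs" for r' c'
    using set_in_boxes[of r c] that unfolding bs(1) by auto
  have o: "?o r' \<le> lam r'" "?o r' = 0 \<or> (r', ?o r') \<notin> set (bs @ [(r, c)])"
    "(r', Suc (?o r')) \<in> B \<Longrightarrow> r \<le> r' \<and> Suc (?o r') = c" for r'
    using bs_se[of r' "?o r'"] rc by (auto simp: outer_col_def box_iff)
  \<comment> \<open>In an all-white diagram every strand is straight, so \<open>w_in\<close> is the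
    instance of the label lemma in which each row keeps its own label.\<close>
  have white: "label_system (\<lambda>_. White) (\<lambda>r c. rl r) (\<lambda>r c. cl c)"
    by (simp add: edge_system_def label_step_def)
  have w_map: "map (box_refl n k) = map (v_factor n k (\<lambda>_. White))"
    by (simp add: v_factor_def fun_eq_iff)
  have w: "?w (m - ?o r' + r') = rl r'" if "r' \<in> {1..k}" for r'
    unfolding w_in_def w_map
  proof (rule perm_prod_row_label[OF white nw_growing_in_boxes that o(1)])
    show "?o r' = 0 \<or> (r', ?o r') \<notin> set (in_boxes k lam (r, c))" using o(2) unfolding bs(1) .
    show "(r', Suc (?o r')) \<in> set (in_boxes k lam (r, c))" if "(r', Suc (?o r')) \<in> B"
      using o(3)[OF that] that by (simp add: set_in_boxes)
  qed
  have "?w permutes {1..n}"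
    unfolding w_in_def w_map by (rule perm_prod_permutes[OF nw_growing_in_boxes])
  hence winv: "inv_into UNIV ?w (rl r') = m - ?o r' + r'" if "r' \<in> {1..k}" for r'
    using w[OF that] by (metis inv_f_f permutes_inj)
  have u_other: "?u (m - ?o r' + r') = LH r' (?o r')" if "r' \<in> {1..k}" "r' \<noteq> r" for r'
  proof (rule perm_prod_row_label[OF L bs(2) that(1) o(1)])
    show "?o r' = 0 \<or> (r', ?o r') \<notin> set bs" using o(2)[of r'] by auto
    show "(r', Suc (?o r')) \<in> set bs" if "(r', Suc (?o r')) \<in> B"
      using o(3)[OF that] that \<open>r' \<noteq> r\<close> by (intro bs(4)) auto
  qed
  have u_bottom: "?u (m - c + 1 + r) = LV r c"
    by (rule perm_prod_col_label[OF L bs(2)]) (use rc bs in auto)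
  have u_right: "?u (m - c + r) = LH r c"
    by (rule perm_prod_row_label[OF L bs(2)]) (use rc bs in auto)
  have or: "?o r = c - 1" using rc by (simp add: outer_col_def)
  have pos_r: "m - ?o r + r = m - c + 1 + r" using rc unfolding or atLeastAtMost_iff by arith
  have u: "?u (m - ?o r' + r') = ?l r'" if "r' \<in> {1..k}" for r'
    using u_other[OF that] u_bottom pos_r by (cases "r' = r") (simp_all add: outer_label_def)
  have v_in: "v_in n k lam D (r, c) = ?u \<circ> v_factor n k D (r, c)"
    by (simp add: v_in_def bs(1) perm_prod_snoc)
  have "box_set n k lam D (r, c) = (?u \<circ> inv_into UNIV ?w) ` source_set n k lam"
    using box_refl_eq[OF b]
    by (simp add: box_set_def v_in v_factor_def comp_assoc)
  also have "\<dots> = ?l ` {1..k}"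
    unfolding source_set_eq image_image by (rule image_cong) (simp_all only: comp_def winv u)
  finally show "box_set n k lam D (r, c) = ?l ` {1..k}" .
  have inj_u: "inj ?u" using permutes_inj[OF perm_prod_permutes[OF bs(2)]] .
  have mono: "?o r'' \<le> ?o r'" if "r' \<in> {1..k}" "r'' \<in> {1..k}" "r' < r''" for r' r''
  proof -
    have "lam r'' \<le> lam r'" using that by (intro lam_anti) auto
    thus ?thesis using that(3) by (auto simp: outer_col_def)
  qed
  have less: "m - ?o r' + r' < m - ?o r'' + r''" if "r' \<in> {1..k}" "r'' \<in> {1..k}" "r' < r''" for r' r''
    using mono[OF that] that by linarith
  have inj_pos: "inj_on (\<lambda>r'. m - ?o r' + r') {1..k}"
    by (rule linorder_inj_onI', rule less_imp_neq, rule less)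
  have inj1: "inj_on (?u \<circ> (\<lambda>r'. m - ?o r' + r')) {1..k}"
    using inj_pos inj_u by (intro comp_inj_on) (auto intro: inj_on_subset)
  have eq1: "(?u \<circ> (\<lambda>r'. m - ?o r' + r')) r' = ?l r'" if "r' \<in> {1..k}" for r'
    using u[OF that] by simp
  show "inj_on ?l {1..k}" by (rule inj_on_cong[THEN iffD1, OF eq1 inj1])
  \<comment> \<open>Passing to the right edge of \<open>b\<close> lowers the position of row
    \<open>r\<close> by one. The order of the positions survives, because the rows above
    \<open>r\<close> are at least as long as row \<open>r\<close>.\<close>
  let ?pos = "(\<lambda>r'. m - ?o r' + r')(r := m - c + r)"
  have less': "?pos r' < ?pos r''" if "r' \<in> {1..k}" "r'' \<in> {1..k}" "r' < r''" for r' r''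
  proof (cases "r'' = r")
    case True
    hence "?o r' = lam r'" using that by (simp add: outer_col_def)
    moreover have "lam r \<le> lam r'" using that True by (intro lam_anti) auto
    ultimately show ?thesis using that True rc by auto
  next
    case False
    thus ?thesis using less[OF that] pos_r by auto
  qed
  have "inj_on ?pos {1..k}"
    by (rule linorder_inj_onI', rule less_imp_neq, rule less')
  hence inj2: "inj_on (?u \<circ> ?pos) {1..k}"
    using inj_u by (intro comp_inj_on) (auto intro: inj_on_subset)
  have eq2: "(?u \<circ> ?pos) r' = (?l(r := LH r c)) r'" if "r' \<in> {1..k}" for r'
    using u[OF that] u_right by simp
  show "inj_on (?l(r := LH r c)) {1..k}" by (rule inj_on_cong[THEN iffD1, OF eq2 inj2])
qed

end

section \<open>Path sums in the network\<close>

text \<open>Since the potential grows along arcs, prefixing an arc to a path never revisits a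
  vertex, and the paths split freely by their first arc.\<close>

lemma (in fin_digraph) apath_sum_step:
  fixes pot :: "'a \<Rightarrow> int" and wt :: "'b \<Rightarrow> 'c::comm_semiring_1"
  assumes pot: "\<And>e. e \<in> arcs G \<Longrightarrow> pot (tail G e) < pot (head G e)" and x: "x \<in> verts G"
  shows "(\<Sum>p | apath x p v. prod_list (map wt p)) =
    (if x = v then 1 else 0) +
    (\<Sum>e | e \<in> arcs G \<and> tail G e = x. wt e * (\<Sum>p | apath (head G e) p v. prod_list (map wt p)))"
proof -
  let ?A = "\<lambda>u. {p. apath u p v}" and ?out = "{e. e \<in> arcs G \<and> tail G e = x}"
  have ge: "pot u \<le> pot y" if "awalk u p v" "y \<in> set (awalk_verts u p)" for u p y
    using that
  proof (induction p arbitrary: u)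
    case (Cons e p)
    thus ?case using pot[of e] by (force simp: awalk_Cons_iff)
  qed simp
  have cons: "apath x (e # p) v \<longleftrightarrow> e \<in> ?out \<and> apath (head G e) p v" for e p
    using ge[of "head G e" p x] pot[of e] by (auto simp: apath_Cons_iff apath_def awalk_Cons_iff)
  have eq: "?A x = (if x = v then {[]} else {}) \<union> (\<Union>e\<in>?out. (#) e ` ?A (head G e))" (is "_ = ?N \<union> ?U")
  proof (rule Set.set_eqI)
    fix p show "p \<in> ?A x \<longleftrightarrow> p \<in> ?N \<union> ?U"
      using x cons by (cases p) (auto simp: apath_Nil_iff)
  qed
  hence "(\<Sum>p\<in>?A x. prod_list (map wt p)) = (\<Sum>p\<in>?N. prod_list (map wt p)) + (\<Sum>p\<in>?U. prod_list (map wt p))"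
  proof (simp only:, intro sum.union_disjoint)
    have "finite (?N \<union> ?U)" using eq apaths_finite by (metis (no_types))
    thus "finite ?N" "finite ?U" by simp_all
  qed auto
  also have "(\<Sum>p\<in>?U. prod_list (map wt p)) = (\<Sum>e\<in>?out. \<Sum>p\<in>(#) e ` ?A (head G e). prod_list (map wt p))"
    using apaths_finite by (intro sum.UNION_disjoint) auto
  also have "\<dots> = (\<Sum>e\<in>?out. wt e * (\<Sum>p\<in>?A (head G e). prod_list (map wt p)))"
    by (intro sum.cong) (simp_all add: sum.reindex sum_distrib_left)
  finally show ?thesis by simp
qed

section \<open>Edges of the network\<close>

locale weighted_network = partition_shape +
  fixes D :: "box \<Rightarrow> filling" and a c :: "box \<Rightarrow> 'a::field"
begin

abbreviation N where "N \<equiv> network n k lam D"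
abbreviation I where "I \<equiv> internal_boxes k lam D"

abbreviation wt :: "edge \<Rightarrow> 'a" where "wt \<equiv> edge_weight D a c"

lemma internal_iff: "b \<in> I \<longleftrightarrow> b \<in> B \<and> D b \<noteq> White"
  by (cases "D b") (auto simp: internal_boxes_def)

lemma right_end_Inner:
  assumes "(r, j) \<in> B"
  shows "right_end n k lam D (r, j) = Inner b \<longleftrightarrow>
    (\<exists>j'. b = (r, j') \<and> j < j' \<and> (r, j') \<in> B \<and> D b = Plus \<and> (\<forall>i. j < i \<and> i < j' \<longrightarrow> D (r, i) \<noteq> Plus))"
proof -
  let ?C = "{j'. j < j' \<and> (r, j') \<in> B \<and> D (r, j') = Plus}"
  have fin: "finite ?C" by (rule finite_subset[of _ "{..lam r}"]) (auto simp: box_iff)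
  have in_B: "(r, i) \<in> B" if "(r, j') \<in> B" "j < i" "i < j'" for i j'
    using that assms by (auto simp: box_iff)
  show ?thesis
  proof (cases "?C = {}")
    case True
    thus ?thesis by (auto simp: right_end_def Let_def)
  next
    case False
    have "Min ?C = j' \<longleftrightarrow> j' \<in> ?C \<and> (\<forall>i. j < i \<and> i < j' \<longrightarrow> D (r, i) \<noteq> Plus)" for j'
    proof
      assume "Min ?C = j'"
      hence j': "j' \<in> ?C" "\<And>i. i \<in> ?C \<Longrightarrow> j' \<le> i" using Min_in[OF fin False] Min_le[OF fin] by auto
      have "D (r, i) \<noteq> Plus" if i: "j < i" "i < j'" for i
      proof
        assume "D (r, i) = Plus"
        hence "i \<in> ?C" using in_B[of j' i] j'(1) i by simp
        thus False using j'(2) i by fastforce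
      qed
      thus "j' \<in> ?C \<and> (\<forall>i. j < i \<and> i < j' \<longrightarrow> D (r, i) \<noteq> Plus)"
        using j'(1) by blast
    next
      assume j': "j' \<in> ?C \<and> (\<forall>i. j < i \<and> i < j' \<longrightarrow> D (r, i) \<noteq> Plus)"
      show "Min ?C = j'" by (rule Min_eqI[OF fin]) (use j' in \<open>auto simp: not_less[symmetric]\<close>)
    qed
    hence "Min ?C = j' \<longleftrightarrow> j < j' \<and> (r, j') \<in> B \<and> D (r, j') = Plus \<and>
        (\<forall>i. j < i \<and> i < j' \<longrightarrow> D (r, i) \<noteq> Plus)" for j' by simp
    thus ?thesis using False by (cases b) (auto simp: right_end_def Let_def)
  qed
qed

lemma right_end_Boundary:
  assumes "(r, j) \<in> B"
  shows "right_end n k lam D (r, j) = Boundary s \<longleftrightarrow>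
    s = rl r \<and> (\<forall>i. j < i \<and> i \<le> lam r \<longrightarrow> D (r, i) \<noteq> Plus)"
  using assms by (auto simp: right_end_def Let_def box_iff)

text \<open>For \<open>r = 1\<close> the row 0 stands for the upper border of the column.\<close>

lemma lower_end_eq:
  assumes "(r, j) \<in> B"
  shows "lower_end n k lam D (r - 1, j) =
    (if D (r, j) = Plus then Inner (r, j) else lower_end n k lam D (r, j))"
proof -
  let ?R = "\<lambda>r. {r'. r < r' \<and> (r', j) \<in> B \<and> D (r', j) = Plus}"
  have r: "1 \<le> r" using assms by (simp add: box_iff)
  show ?thesis
  proof (cases "D (r, j) = Plus")
    case True
    have "finite (?R (r - 1))" by (rule finite_subset[of _ "{..k}"]) (auto simp: box_iff)
    hence "Min (?R (r - 1)) = r" using r True assms by (intro Min_eqI) auto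
    moreover have "?R (r - 1) \<noteq> {}" using r True assms by auto
    ultimately show ?thesis using True by (simp only: lower_end_def prod.case Let_def if_False if_True simp_thms)
  next
    case False
    have "?R (r - 1) = ?R r"
    proof (rule Set.set_eqI)
      fix r' show "r' \<in> ?R (r - 1) \<longleftrightarrow> r' \<in> ?R r" using False r by (cases "r' = r") auto
    qed
    thus ?thesis using False by (simp only: lower_end_def prod.case Let_def if_False)
  qed
qed

lemma lower_end_border: "lower_end n k lam D (len j, j) = Boundary (cl j)"
  by (simp add: lower_end_def Let_def box_iff')

lemma lower_end_cases:
  assumes "(r, j) \<in> B"
  shows "lower_end n k lam D (r, j) = Boundary (cl j) \<or>
    (\<exists>r'. lower_end n k lam D (r, j) = Inner (r', j) \<and> r < r' \<and> (r', j) \<in> B \<and> D (r', j) = Plus)"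
proof -
  let ?R = "{r'. r < r' \<and> (r', j) \<in> B \<and> D (r', j) = Plus}"
  have "finite ?R" by (rule finite_subset[of _ "{..k}"]) (auto simp: box_iff)
  hence "Min ?R \<in> ?R" if "?R \<noteq> {}" using that by (rule Min_in)
  thus ?thesis by (auto simp: lower_end_def Let_def)
qed

lemma right_end_cases:
  assumes "(r, j) \<in> B"
  shows "right_end n k lam D (r, j) = Boundary (rl r) \<or>
    (\<exists>j'. right_end n k lam D (r, j) = Inner (r, j') \<and> j < j' \<and> (r, j') \<in> B \<and> D (r, j') = Plus)"
proof (cases "right_end n k lam D (r, j)")
  case (Inner b)
  thus ?thesis using right_end_Inner[OF assms, of b] by auto
next
  case (Boundary s)
  thus ?thesis using right_end_Boundary[OF assms, of s] by auto
qed

sublocale net: fin_digraph N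
proof
  have "B \<subseteq> {1..k} \<times> {1..m}" using box_iff box_col by fast
  hence "finite B" by (rule finite_subset) simp
  hence "finite I" by (rule finite_subset[rotated]) (auto simp: internal_iff)
  thus "finite (verts N)" "finite (arcs N)" by (auto simp: network_def)
  fix e assume e: "e \<in> arcs N"
  then obtain r j where rj: "(r, j) \<in> I" "e = Horiz (r, j) \<or> e = Vert (r, j)"
    by (auto simp: network_def)
  hence b: "(r, j) \<in> B" by (simp add: internal_iff)
  have lab: "rl r \<in> {1..n}" "cl j \<in> {1..n}" using rl_range cl_range b box_iff box_iff' by blast+
  show "tail N e \<in> verts N"
    using rj right_end_cases[OF b] lab by (auto simp: network_def internal_iff)
  show "head N e \<in> verts N"
    using rj lower_end_cases[OF b] lab by (auto simp: network_def internal_iff)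
qed

text \<open>Edges run left or down, so row minus column grows; sources lie below and sinks above all
  values of internal vertices.\<close>

definition potential :: "vertex \<Rightarrow> int" where
  "potential x = (case x of Inner (r, j) \<Rightarrow> int r - int j
     | Boundary t \<Rightarrow> if t \<in> source_set n k lam then - int n - 1 else int n + 1)"

lemma potential_increasing:
  assumes "e \<in> arcs N" shows "potential (tail N e) < potential (head N e)"
proof -
  obtain r j where rj: "(r, j) \<in> I" "e = Horiz (r, j) \<or> e = Vert (r, j)"
    using assms by (auto simp: network_def)
  hence b: "(r, j) \<in> B" by (simp add: internal_iff)
  have bd: "int r \<le> int n" "int j \<le> int n" using b box_col[OF b] k_le_n by (auto simp: box_iff)
  have lab: "rl r \<in> source_set n k lam" "cl j \<notin> source_set n k lam"
    using b rl_neq_cl[OF _ box_col[OF b]] unfolding source_set_eq by (auto simp: box_iff) force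
  show ?thesis using rj(2)
  proof
    assume "e = Horiz (r, j)"
    thus ?thesis using right_end_cases[OF b] lab bd by (auto simp: network_def potential_def)
  next
    assume "e = Vert (r, j)"
    thus ?thesis using lower_end_cases[OF b] lab bd by (auto simp: network_def potential_def)
  qed
qed

section \<open>Local recursion for path sums\<close>

definition path_sum :: "vertex \<Rightarrow> nat \<Rightarrow> 'a" where
  "path_sum x t = (\<Sum>p | net.apath x p (Boundary t). path_weight D a c p)"

lemma path_sum_step:
  assumes "x \<in> verts N"
  shows "path_sum x t = (if x = Boundary t then 1 else 0) +
    (\<Sum>e | e \<in> arcs N \<and> tail N e = x. wt e * path_sum (head N e) t)"
  unfolding path_sum_def path_weight_def
  by (rule net.apath_sum_step[of potential, OF potential_increasing assms])

text \<open>The boxes reached in one step by a path that has just crossed the vertical edge \<open>(r, j)\<close>.\<close>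

definition next_boxes :: "nat \<Rightarrow> nat \<Rightarrow> nat set" where
  "next_boxes r j = {j'. (r, j') \<in> I \<and> j' \<le> j \<and> (\<forall>i. j' < i \<and> i \<le> j \<longrightarrow> D (r, i) \<noteq> Plus)}"

text \<open>Path sums are attached to the edges of boxes instead of the vertices of the network.
  Arcs that skip over boxes are thereby cut at each box, which gives one local rule per box.\<close>

definition PH :: "nat \<Rightarrow> nat \<Rightarrow> nat \<Rightarrow> 'a" where
  "PH r j t = (\<Sum>j'\<in>next_boxes r j. wt (Horiz (r, j')) * path_sum (Inner (r, j')) t)"

definition PV :: "nat \<Rightarrow> nat \<Rightarrow> nat \<Rightarrow> 'a" where
  "PV r j t = path_sum (lower_end n k lam D (r, j)) t"

lemma finite_next_boxes: "finite (next_boxes r j)"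
  by (rule finite_subset[of _ "{..j}"]) (auto simp: next_boxes_def)

lemma PH_border: "PH r 0 t = 0"
proof -
  have "next_boxes r 0 = {}" by (auto simp: next_boxes_def internal_iff box_iff)
  thus ?thesis by (simp add: PH_def)
qed

lemma out_Boundary_source:
  assumes "r \<in> {1..k}"
  shows "{e. e \<in> arcs N \<and> tail N e = Boundary (rl r)} = (\<lambda>j. Horiz (r, j)) ` next_boxes r (lam r)"
proof (rule Set.set_eqI)
  fix e
  show "e \<in> {e. e \<in> arcs N \<and> tail N e = Boundary (rl r)} \<longleftrightarrow> e \<in> (\<lambda>j. Horiz (r, j)) ` next_boxes r (lam r)"
  proof (cases e)
    case (Horiz b)
    obtain r' j where b: "b = (r', j)" by fastforce
    show ?thesis
      using right_end_Boundary[of r' j "rl r"] assms rl_eq_iff[of r r']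
      by (auto simp: Horiz b network_def next_boxes_def internal_iff box_iff image_iff)
  qed (auto simp: network_def)
qed

lemma out_Boundary_sink:
  assumes "j \<in> {1..m}"
  shows "{e. e \<in> arcs N \<and> tail N e = Boundary (cl j)} = {}"
proof -
  have "tail N e \<noteq> Boundary (cl j)" if "e \<in> arcs N" for e
  proof (cases e)
    case (Horiz b)
    obtain r' j' where b: "b = (r', j')" by fastforce
    hence "(r', j') \<in> B" using that Horiz by (auto simp: network_def internal_iff)
    thus ?thesis using right_end_Boundary[of r' j' "cl j"] rl_neq_cl[of r' j] assms
      by (auto simp: Horiz b network_def box_iff)
  qed (simp add: network_def)
  thus ?thesis by blast
qed

lemma out_Inner:
  assumes "(r, j) \<in> I"
  shows "{e. e \<in> arcs N \<and> tail N e = Inner (r, j)} =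
    insert (Vert (r, j)) (if D (r, j) = Plus then (\<lambda>j. Horiz (r, j)) ` next_boxes r (j - 1) else {})"
proof (rule Set.set_eqI)
  have j: "1 \<le> j" "(r, j) \<in> B" using assms by (auto simp: internal_iff box_iff)
  fix e
  show "e \<in> {e. e \<in> arcs N \<and> tail N e = Inner (r, j)} \<longleftrightarrow>
    e \<in> insert (Vert (r, j)) (if D (r, j) = Plus then (\<lambda>j. Horiz (r, j)) ` next_boxes r (j - 1) else {})"
  proof (cases e)
    case (Horiz b)
    obtain r' j' where b: "b = (r', j')" by fastforce
    have "e \<in> {e. e \<in> arcs N \<and> tail N e = Inner (r, j)} \<longleftrightarrow>
        (r', j') \<in> I \<and> right_end n k lam D (r', j') = Inner (r, j)"
      by (auto simp: Horiz b network_def)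
    also have "\<dots> \<longleftrightarrow> D (r, j) = Plus \<and> r' = r \<and> (r, j') \<in> I \<and> j' < j \<and>
        (\<forall>i. j' < i \<and> i < j \<longrightarrow> D (r, i) \<noteq> Plus)"
      using right_end_Inner[of r' j' "(r, j)"] j by (auto simp: internal_iff)
    also have "\<dots> \<longleftrightarrow> D (r, j) = Plus \<and> r' = r \<and> j' \<in> next_boxes r (j - 1)"
    proof -
      have "i \<le> j - 1 \<longleftrightarrow> i < j" for i using j by auto
      thus ?thesis by (auto simp: next_boxes_def)
    qed
    finally show ?thesis by (auto simp: Horiz b)
  next
    case (Vert b)
    thus ?thesis using assms by (auto simp: network_def)
  qed
qed

lemma path_sum_source:
  assumes "r \<in> {1..k}"
  shows "path_sum (Boundary (rl r)) t = (if rl r = t then 1 else 0) + PH r (lam r) t"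
proof -
  have "Boundary (rl r) \<in> verts N" using rl_range[OF assms] by (simp add: network_def)
  hence "path_sum (Boundary (rl r)) t = (if rl r = t then 1 else 0) +
      (\<Sum>e\<in>(\<lambda>j. Horiz (r, j)) ` next_boxes r (lam r). wt e * path_sum (head N e) t)"
    using path_sum_step out_Boundary_source[OF assms] by simp
  thus ?thesis by (simp add: sum.reindex inj_on_def PH_def network_def)
qed

lemma path_sum_sink:
  assumes "j \<in> {1..m}"
  shows "path_sum (Boundary (cl j)) t = unit_at (cl j) t"
proof -
  have "Boundary (cl j) \<in> verts N" using cl_range[OF assms] by (simp add: network_def)
  thus ?thesis using path_sum_step[of "Boundary (cl j)" t] out_Boundary_sink[OF assms]
    by (simp add: unit_at_def)
qed

lemma path_sum_Inner:
  assumes "(r, j) \<in> I"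
  shows "path_sum (Inner (r, j)) t = PV r j t + (if D (r, j) = Plus then PH r (j - 1) t else 0)"
proof -
  have v: "Inner (r, j) \<in> verts N" using assms by (simp add: network_def)
  have "path_sum (Inner (r, j)) t =
      (\<Sum>e\<in>insert (Vert (r, j)) (if D (r, j) = Plus then (\<lambda>j. Horiz (r, j)) ` next_boxes r (j - 1) else {}).
          wt e * path_sum (head N e) t)"
    using path_sum_step[OF v] out_Inner[OF assms] by simp
  also have "\<dots> = PV r j t + (if D (r, j) = Plus then PH r (j - 1) t else 0)"
  proof -
    have "Vert (r, j) \<notin> (\<lambda>j. Horiz (r, j)) ` next_boxes r (j - 1)" by auto
    thus ?thesis using finite_next_boxes[of r "j - 1"]
      by (simp add: sum.reindex inj_on_def PH_def PV_def network_def edge_weight_def)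
  qed
  finally show ?thesis .
qed

lemma PV_border: "j \<in> {1..m} \<Longrightarrow> PV (len j) j t = unit_at (cl j) t"
  by (simp add: PV_def lower_end_border path_sum_sink)

definition box_weight :: "box \<Rightarrow> 'a" where
  "box_weight b = (if D b = Plus then a b else c b)"

text \<open>A plus stops every path entering it from the right, a black stone offers an additional
  exit downwards, and a white stone is passed over.\<close>

lemma PH_box:
  assumes b: "(r, j) \<in> B"
  shows "PH r j t = (case D (r, j) of
      Plus \<Rightarrow> box_weight (r, j) * (PH r (j - 1) t + PV r j t)
    | Black \<Rightarrow> PH r (j - 1) t + box_weight (r, j) * PV r j t
    | White \<Rightarrow> PH r (j - 1) t)"
proof -
  have j: "1 \<le> j" using b by (simp add: box_iff)
  have le: "i \<le> j \<longleftrightarrow> i = j \<or> i \<le> j - 1" "i \<le> j - 1 \<Longrightarrow> i \<noteq> j" for i using j by auto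
  have white: "next_boxes r j = next_boxes r (j - 1)" if "D (r, j) = White"
    using that le by (auto simp: next_boxes_def internal_iff)
  have black: "next_boxes r j = insert j (next_boxes r (j - 1))" if "D (r, j) = Black"
    using that le b by (auto simp: next_boxes_def internal_iff)
  have plus: "next_boxes r j = {j}" if "D (r, j) = Plus"
    using that b j by (auto simp: next_boxes_def internal_iff) (metis le_neq_implies_less order_refl)
  have notin: "j \<notin> next_boxes r (j - 1)" using j by (auto simp: next_boxes_def)
  show ?thesis
  proof (cases "D (r, j)")
    case Plus
    hence "(r, j) \<in> I" using b by (simp add: internal_iff)
    from path_sum_Inner[OF this] show ?thesis
      using Plus unfolding PH_def[of r j] plus[OF Plus]
      by (simp add: edge_weight_def box_weight_def add.commute)
  next
    case Black
    hence "(r, j) \<in> I" using b by (simp add: internal_iff)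
    from path_sum_Inner[OF this] show ?thesis
      using Black notin finite_next_boxes unfolding PH_def[of r j] black[OF Black]
      by (simp add: edge_weight_def box_weight_def PH_def add.commute)
  next
    case White
    thus ?thesis unfolding PH_def[of r j] white[OF White] by (simp add: PH_def)
  qed
qed

lemma PV_box:
  assumes b: "(r, j) \<in> B"
  shows "PV (r - 1) j t = (if D (r, j) = Plus then PH r (j - 1) t + PV r j t else PV r j t)"
proof (cases "D (r, j) = Plus")
  case True
  hence "(r, j) \<in> I" using b by (simp add: internal_iff)
  from path_sum_Inner[OF this] show ?thesis
    using True lower_end_eq[OF b] by (simp add: PV_def add.commute)
next
  case False
  thus ?thesis using lower_end_eq[OF b] by (simp add: PV_def)
qed

text \<open>Paths move only left and down, so sinks to the right are out of reach, and
  \<open>cl j\<close> is reached from column \<open>j\<close> only by staying in it, with weight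
  1.\<close>

lemma path_support:
  shows "r \<in> {1..k} \<Longrightarrow> j \<le> lam r \<Longrightarrow> \<forall>t. t \<notin> cl ` {1..j} \<longrightarrow> PH r j t = 0"
    and "j \<in> {1..m} \<Longrightarrow> r \<le> len j \<Longrightarrow> PV r j (cl j) = 1 \<and> (\<forall>t. t \<notin> cl ` {1..j} \<longrightarrow> PV r j t = 0)"
proof -
  let ?P = "\<lambda>r j. \<forall>t. t \<notin> cl ` {1..j} \<longrightarrow> PH r j t = 0"
  let ?Q = "\<lambda>r j. PV r j (cl j) = 1 \<and> (\<forall>t. t \<notin> cl ` {1..j} \<longrightarrow> PV r j t = 0)"
  have 1: "?P r 0" for r by (simp add: PH_border)
  have 2: "?Q (len j) j" if "j \<in> {1..m}" for j
    using that by (auto simp: PV_border unit_at_def)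
  have 3: "?P r j \<and> ?Q (r - 1) j" if b: "(r, j) \<in> B" and P: "?P r (j - 1)" and Q: "?Q r j" for r j
  proof -
    have j: "j \<in> {1..m}" using box_col[OF b] .
    have "PH r (j - 1) t = 0" if "t \<notin> cl ` {1..j}" for t
    proof -
      have "{1..j - 1} \<subseteq> {1..j}" by auto
      thus ?thesis using P that by blast
    qed
    moreover have "cl j \<notin> cl ` {1..j - 1}" using cl_eq_iff j by fastforce
    hence "PH r (j - 1) (cl j) = 0" using P by blast
    ultimately show ?thesis using Q
      unfolding PV_box[OF b] PH_box[OF b] by (auto split: filling.splits)
  qed
  note ind = edge_induct_sw[where P = ?P and Q = ?Q, OF 1 2 3]
  show "r \<in> {1..k} \<Longrightarrow> j \<le> lam r \<Longrightarrow> ?P r j" by (rule ind(1))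
  show "j \<in> {1..m} \<Longrightarrow> r \<le> len j \<Longrightarrow> ?Q r j" by (rule ind(2))
qed

section \<open>Signed path sums and the weight matrix\<close>

definition sources_below :: "nat \<Rightarrow> nat" where
  "sources_below t = card {s \<in> source_set n k lam. s < t}"

text \<open>With these signs the path sums obey \<^const>\<open>vector_step\<close>.\<close>

definition SH :: "nat \<Rightarrow> nat \<Rightarrow> nat \<Rightarrow> 'a" where
  "SH r j t = (-1) ^ (sources_below t + r + 1) * PH r j t"

definition SV :: "nat \<Rightarrow> nat \<Rightarrow> nat \<Rightarrow> 'a" where
  "SV r j t = (-1) ^ (sources_below t + r) * PV r j t"

lemma sources_below_cl:
  assumes "j \<in> {1..m}" shows "sources_below (cl j) = len j"
proof -
  have "{s \<in> source_set n k lam. s < cl j} = rl ` {1..len j}"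
  proof -
    have iff: "rl r < cl j \<longleftrightarrow> r \<in> {1..len j}" if "r \<in> {1..k}" for r
      using rl_cl[OF that assms] le_len_iff[OF that] that by (auto split: if_splits)
    have "{1..len j} \<subseteq> {1..k}" using len_le[of j] by auto
    thus ?thesis unfolding source_set_eq using iff by blast
  qed
  moreover have "inj_on rl {1..len j}" by (rule inj_on_subset[OF rl_inj]) (use len_le[of j] in auto)
  ultimately show ?thesis by (simp add: sources_below_def card_image)
qed

lemma SV_pivot:
  assumes "j \<in> {1..m}" "r \<le> len j" shows "SV r j (cl j) = edge_sign r j"
proof -
  have "even (len j - r) \<longleftrightarrow> even (len j + r)" using assms by auto
  thus ?thesis using path_support(2)[OF assms] sources_below_cl[OF assms(1)]
    by (simp add: SV_def edge_sign_def minus_one_power_iff)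
qed

lemma signed_system:
  assumes "\<And>b. b \<in> B \<Longrightarrow> D b = Plus \<Longrightarrow> box_weight b \<noteq> 0"
  shows "edge_system (vector_step D box_weight) (\<lambda>r. SH r (lam r)) (\<lambda>j. unit_at (cl j)) SH SV"
  unfolding edge_system_def
proof (intro conjI ballI allI impI)
  show "SV (len j) j = unit_at (cl j)" if "j \<in> {1..m}" for j
    using that sources_below_cl[OF that]
    by (auto simp: fun_eq_iff SV_def PV_border unit_at_def simp flip: mult_2)
  fix r j assume b: "(r, j) \<in> B"
  define E :: "nat \<Rightarrow> 'a" where "E t = (-1) ^ (sources_below t + r)" for t
  have S: "SH r i t = - E t * PH r i t" "SV r i t = E t * PV r i t" for i t
    by (simp_all add: SH_def SV_def E_def)
  have up: "SV (r - 1) j t = - E t * PV (r - 1) j t" for t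
    using b by (cases r) (simp_all add: SV_def E_def box_iff)
  show "vector_step D box_weight (r, j) (SH r j) (SV r j) = (SH r (j - 1), SV (r - 1) j)"
    using assms[OF b] unfolding vector_step_def fun_eq_iff prod.inject up S PV_box[OF b] PH_box[OF b]
    by (cases "D (r, j)") (simp_all add: fun_eq_iff field_simps)
qed simp

text \<open>The sources between \<open>rl r\<close> and \<open>cl j\<close> are the ends of the rows
  \<open>r + 1\<close> to \<open>len j\<close>, so the sign of the entry is
  \<open>(-1) ^ (len j - r)\<close>, opposite to the sign in \<open>SH\<close>. Hence
  \<open>SH\<close> on the right border is the projection of a pivot unit vector along the rows of
  the weight matrix.\<close>

lemma weight_entry_row:
  assumes r: "r \<in> {1..k}" and t: "t \<in> {1..n}"
  shows "weight_entry n k lam D a c (rl r) t = unit_at (rl r) t - SH r (lam r) t"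
proof -
  define q where "q = card {i \<in> source_set n k lam. rl r < i \<and> i < t \<or> t < i \<and> i < rl r}"
  have w: "weight_entry n k lam D a c (rl r) t =
      (-1) ^ q * ((if rl r = t then 1 else 0) + PH r (lam r) t)"
    using path_sum_source[OF r] by (simp add: weight_entry_def path_sum_def q_def)
  have zero: "PH r (lam r) t = 0" if "t \<notin> cl ` {1..lam r}"
    using path_support(1)[OF r] that by simp
  show ?thesis
  proof (cases "t \<in> cl ` {1..lam r}")
    case False
    have "q = 0" if "rl r = t" using that by (auto simp: q_def)
    thus ?thesis using zero[OF False] by (auto simp: w unit_at_def SH_def)
  next
    case True
    then obtain j where j: "j \<in> {1..m}" "j \<le> lam r" "t = cl j"
      using lam_le[OF r] by auto
    have lt: "rl r < t" using rl_cl[OF r j(1)] j by simp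
    have rlen: "r \<le> len j" using le_len_iff[OF r] j by simp
    have "s \<in> {1..k} \<Longrightarrow> rl s < cl j \<longleftrightarrow> s \<le> len j" for s
      using rl_cl[of s j] le_len_iff[of s j] j by (auto split: if_splits)
    moreover have "s \<in> {1..k} \<Longrightarrow> rl r < rl s \<longleftrightarrow> r < s" for s
      using rl_less[of r s] rl_less[of s r] r by (cases r s rule: linorder_cases) auto
    ultimately have "{i \<in> source_set n k lam. rl r < i \<and> i < t \<or> t < i \<and> i < rl r} = rl ` {Suc r..len j}"
      using lt len_le[of j] r by (fastforce simp: source_set_eq j(3))
    moreover have "inj_on rl {Suc r..len j}" by (rule inj_on_subset[OF rl_inj]) (use len_le[of j] r in auto)
    ultimately have q: "q = len j - r" by (simp add: card_image q_def)
    have "even (len j - r) \<longleftrightarrow> even (len j + r)" using rlen by auto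
    thus ?thesis using lt sources_below_cl[OF j(1)]
      unfolding w q by (simp add: SH_def unit_at_def j(3) minus_one_power_iff)
  qed
qed

lemma weight_matrix_entry:
  assumes r: "r \<in> {1..k}"
  shows "entry (weight_matrix n k lam D a c) r t = unit_at (rl r) t - SH r (lam r) t"
proof (cases "t \<in> {1..n}")
  case True
  have "sorted_list_of_set (source_set n k lam) ! (r - 1) = rl r"
    using r by (cases r) (simp_all add: sorted_source_set nth_map_upt del: upt_Suc)
  moreover have "r - 1 < k" "t - 1 < n" "Suc (t - 1) = t" using r True by auto
  ultimately show ?thesis
    using weight_entry_row[OF r True] True by (simp add: entry_def weight_matrix_def)
next
  case False
  have "cl ` {1..lam r} \<subseteq> {1..n}" using cl_range lam_le[OF r] by force
  hence "PH r (lam r) t = 0" using path_support(1)[OF r, of "lam r"] False by blast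
  thus ?thesis using rl_range[OF r] False by (auto simp: entry_def unit_at_def SH_def)
qed

lemma echelon_weight_matrix: "echelon (weight_matrix n k lam D a c)"
  unfolding echelon_def
proof (intro conjI ballI impI)
  show "weight_matrix n k lam D a c \<in> carrier_mat k n" by (simp add: weight_matrix_def)
next
  fix r s assume r: "r \<in> {1..k}" and s: "s \<in> {1..k}"
  have "rl s \<notin> cl ` {1..lam r}" using rl_neq_cl[OF s] lam_le[OF r] by fastforce
  hence "PH r (lam r) (rl s) = 0" using path_support(1)[OF r] by simp
  thus "entry (weight_matrix n k lam D a c) r (rl s) = (if r = s then 1 else 0)"
    using rl_eq_iff[OF r s] by (auto simp: weight_matrix_entry[OF r] SH_def unit_at_def)
next
  fix r j assume r: "r \<in> {1..k}" and j: "j \<in> {1..m}" "lam r < j"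
  have "cl j \<notin> cl ` {1..lam r}" using cl_eq_iff j lam_le[OF r] by fastforce
  hence "PH r (lam r) (cl j) = 0" using path_support(1)[OF r] by simp
  thus "entry (weight_matrix n k lam D a c) r (cl j) = 0"
    using rl_neq_cl[OF r j(1)] by (auto simp: weight_matrix_entry[OF r] SH_def unit_at_def)
qed

end

section \<open>Reconstruction of the parameters\<close>

text \<open>Equal cardinalities exclude the prefix case of \<open>lexord\<close>, so the first
  difference of the sorted lists decides.\<close>

lemma lex_lessD:
  assumes "finite J" "finite K" "card J = card K" "lex_less J K"
  obtains x where "x \<in> J" "x \<notin> K" "\<And>y. y < x \<Longrightarrow> y \<in> J \<longleftrightarrow> y \<in> K"
proof -
  let ?xs = "sorted_list_of_set J" and ?ys = "sorted_list_of_set K"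
  have "length ?xs = length ?ys" using assms by simp
  moreover have "length ?ys = length ?xs + Suc (length v)" if "?ys = ?xs @ a # v" for a v
    unfolding that by simp
  ultimately have "\<nexists>a v. ?ys = ?xs @ a # v" by fastforce
  then obtain u a b v w where *: "a < b" "?xs = u @ a # v" "?ys = u @ b # w"
    using assms(4) unfolding lex_less_def lexord_def by auto
  have "sorted_wrt (<) (u @ a # v)" "sorted_wrt (<) (u @ b # w)"
    using *(2,3) strict_sorted_list_of_set by metis+
  moreover have "J = set (u @ a # v)" "K = set (u @ b # w)"
    using *(2,3) assms(1,2) by (metis set_sorted_list_of_set)+
  ultimately show thesis using *(1) by (intro that[of a]) (auto simp: sorted_wrt_append)
qed

lemma lex_lessI:
  assumes fin: "finite J" "finite K" and card: "card J = card K"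
    and x: "x \<in> J" "x \<notin> K" "\<And>y. y < x \<Longrightarrow> y \<in> J \<longleftrightarrow> y \<in> K"
  shows "lex_less J K"
proof (rule ccontr)
  assume "\<not> lex_less J K"
  moreover have "sorted_list_of_set J \<noteq> sorted_list_of_set K"
    using x fin by (metis set_sorted_list_of_set)
  moreover have "\<forall>a b :: nat. (a, b) \<in> less_than \<or> a = b \<or> (b, a) \<in> less_than" by auto
  ultimately have "lex_less K J" unfolding lex_less_def using lexord_linear by blast
  then obtain x' where "x' \<in> K" "x' \<notin> J" "\<And>y. y < x' \<Longrightarrow> y \<in> K \<longleftrightarrow> y \<in> J"
    using lex_lessD[OF fin(2,1) card[symmetric]] by metis
  thus False using x by (cases x x' rule: linorder_cases) auto
qed

context partition_shape
begin

section \<open>Reduced echelon form and lexicographic minimality\<close>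

lemma source_set_bij: "bij_betw (\<lambda>i. rl (Suc i)) {0..<k} (source_set n k lam)"
proof -
  have "bij_betw rl {1..k} (source_set n k lam)"
    using rl_inj by (simp add: source_set_eq bij_betw_def)
  from bij_betw_trans[OF bij_betw_Suc_rows this] show ?thesis by (simp add: comp_def)
qed

lemma echelon_index:
  assumes "echelon M" "i < k" "t \<in> {1..n}" shows "M $$ (i, t - 1) = entry M (Suc i) t"
  using assms by (simp add: entry_def)

lemma echelon_le:
  assumes M: "echelon M" and r: "r \<in> {1..k}" and nz: "entry M r t \<noteq> 0"
  shows "rl r \<le> t"
proof -
  have "t \<in> {1..n}" using nz by (auto simp: entry_def split: if_splits)
  then consider s where "s \<in> {1..k}" "t = rl s" | c where "c \<in> {1..m}" "t = cl c"
    using labels_union by blast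
  thus ?thesis
  proof cases
    case 1
    thus ?thesis using nz echelon_pivot[OF M r 1(1)] by (auto split: if_splits)
  next
    case 2
    hence "c \<le> lam r" using nz echelon_zero[OF M r 2(1)] by (cases "lam r < c") auto
    thus ?thesis using 2 rl_cl[OF r 2(1)] by simp
  qed
qed

lemma echelon_pluecker_source:
  assumes M: "echelon M" shows "pluecker M (source_set n k lam) \<noteq> 0"
proof (rule pluecker_nonzero_if_lead[where rk = id])
  show "M \<in> carrier_mat k n" using echelon_carrier[OF M] .
  show "bij_betw (\<lambda>i. rl (Suc i)) {0..<k} (source_set n k lam)" using source_set_bij .
  show "M $$ (i, rl (Suc i) - 1) \<noteq> 0" if "i < k" for i
    using echelon_index[OF M that] rl_range[of "Suc i"] echelon_pivot[OF M, of "Suc i" "Suc i"] that by simp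
  show "id t \<le> id (rl (Suc i))"
    if i: "i < k" and t: "t \<in> source_set n k lam" and nz: "M $$ (i, t - 1) \<noteq> 0" for i t
  proof -
    obtain s where s: "s \<in> {1..k}" "t = rl s" using t by (auto simp: source_set_eq)
    have "entry M (Suc i) t \<noteq> 0" using nz echelon_index[OF M i] rl_range[OF s(1)] s(2) by simp
    thus ?thesis using echelon_pivot[OF M, of "Suc i" s] s i by (auto split: if_splits)
  qed
qed (use source_set_subset card_source_set in auto)

text \<open>Counting beyond the first difference \<open>x\<close>: a nonzero term maps each row with
  pivot beyond \<open>x\<close> to an element of \<open>J\<close> beyond \<open>x\<close>. But
  \<open>J\<close> agrees with the pivots below \<open>x\<close> and contains \<open>x\<close>, so
  it has one element too few there.\<close>

lemma echelon_pluecker_lex: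
  assumes M: "echelon M" and J: "J \<subseteq> {1..n}" "card J = k" and lex: "lex_less J (source_set n k lam)"
  shows "pluecker M J = 0"
proof (rule ccontr)
  assume "pluecker M J \<noteq> 0"
  then obtain \<sigma> where \<sigma>: "bij_betw \<sigma> {0..<k} J" "\<And>i. i < k \<Longrightarrow> M $$ (i, \<sigma> i - 1) \<noteq> 0"
    using pluecker_nonzeroD[OF echelon_carrier[OF M] J] by metis
  let ?S = "source_set n k lam"
  have fin: "finite J" "finite ?S"
    using J(1) source_set_subset finite_subset[of _ "{1..n}"] by auto
  obtain x where x: "x \<in> J" "x \<notin> ?S" "\<And>y. y < x \<Longrightarrow> y \<in> J \<longleftrightarrow> y \<in> ?S"
    using lex_lessD[OF fin _ lex] J(2) card_source_set by metis
  have le: "rl (Suc i) \<le> \<sigma> i" if "i < k" for i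
  proof -
    have "\<sigma> i \<in> {1..n}" using bij_betwE[OF \<sigma>(1)] J(1) that by (meson atLeastLessThan_iff subsetD zero_le)
    thus ?thesis using echelon_le[OF M, of "Suc i"] \<sigma>(2)[OF that] echelon_index[OF M that] that by simp
  qed
  let ?R = "{i \<in> {0..<k}. x < rl (Suc i)}"
  have "card ?R \<le> card {y \<in> J. x < y}"
  proof (rule card_inj_on_le[of \<sigma>])
    show "inj_on \<sigma> ?R" by (rule inj_on_subset[OF bij_betw_imp_inj_on[OF \<sigma>(1)]]) auto
    show "\<sigma> ` ?R \<subseteq> {y \<in> J. x < y}"
      using \<sigma>(1) le by (fastforce simp: bij_betw_def intro: less_le_trans)
  qed (use fin in auto)
  moreover have "card ?R = card {s \<in> ?S. x < s}"
  proof -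
    have inj: "inj_on (\<lambda>i. rl (Suc i)) {0..<k}" and img: "(\<lambda>i. rl (Suc i)) ` {0..<k} = ?S"
      using source_set_bij by (simp_all add: bij_betw_def)
    have "(\<lambda>i. rl (Suc i)) ` ?R = {s \<in> ?S. x < s}" unfolding img[symmetric] by blast
    moreover have "inj_on (\<lambda>i. rl (Suc i)) ?R" by (rule inj_on_subset[OF inj]) auto
    ultimately have "bij_betw (\<lambda>i. rl (Suc i)) ?R {s \<in> ?S. x < s}" by (simp add: bij_betw_def)
    thus ?thesis by (rule bij_betw_same_card)
  qed
  moreover have "k = card {s \<in> ?S. s < x} + card {s \<in> ?S. x < s}"
  proof -
    have "s < x \<or> x < s" if "s \<in> ?S" for s using that x(2) by (metis nat_neq_iff)
    hence "?S = {s \<in> ?S. s < x} \<union> {s \<in> ?S. x < s}" by blast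
    hence "card ?S = card ({s \<in> ?S. s < x} \<union> {s \<in> ?S. x < s})" by simp
    also have "\<dots> = card {s \<in> ?S. s < x} + card {s \<in> ?S. x < s}"
      using fin by (intro card_Un_disjoint) auto
    finally show ?thesis using card_source_set by simp
  qed
  moreover have "k = card {y \<in> J. y < x} + (1 + card {y \<in> J. x < y})"
  proof -
    have "J = {y \<in> J. y < x} \<union> insert x {y \<in> J. x < y}" using x(1) by auto
    hence "card J = card ({y \<in> J. y < x} \<union> insert x {y \<in> J. x < y})" by simp
    also have "\<dots> = card {y \<in> J. y < x} + card (insert x {y \<in> J. x < y})"
      using fin by (intro card_Un_disjoint) auto
    finally show ?thesis using J(2) fin by simp
  qed
  moreover have "{y \<in> J. y < x} = {s \<in> ?S. s < x}" using x(3) by blast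
  hence "card {y \<in> J. y < x} = card {s \<in> ?S. s < x}" by (rule arg_cong)
  ultimately show False by linarith
qed

lemma pick_source_set:
  assumes "j < k" shows "pick {i. Suc i \<in> source_set n k lam} j = rl (Suc j) - 1"
proof -
  let ?S = "{i. Suc i \<in> source_set n k lam}"
  have rl_pos: "1 \<le> rl s" if "s \<in> {1..k}" for s using rl_range[OF that] by simp
  have in_S: "rl (Suc j) - 1 \<in> ?S"
    using assms rl_pos[of "Suc j"] by (auto simp: source_set_eq)
  have "{a \<in> ?S. a < rl (Suc j) - 1} = (\<lambda>s. rl s - 1) ` {1..j}"
  proof (intro Set.set_eqI iffI)
    fix a assume "a \<in> {a \<in> ?S. a < rl (Suc j) - 1}"
    then obtain s where s: "s \<in> {1..k}" "Suc a = rl s" "rl s < rl (Suc j)"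
      by (auto simp: source_set_eq)
    have "s < Suc j" using s rl_less[of "Suc j" s] assms
      by (cases s "Suc j" rule: linorder_cases) auto
    moreover have "a = rl s - 1" using s(2) by simp
    ultimately show "a \<in> (\<lambda>s. rl s - 1) ` {1..j}" using s(1) by auto
  next
    fix a assume "a \<in> (\<lambda>s. rl s - 1) ` {1..j}"
    then obtain s where s: "s \<in> {1..j}" "a = rl s - 1" by auto
    have sk: "s \<in> {1..k}" using s assms by auto
    have "rl s < rl (Suc j)" using s assms by (intro rl_less) auto
    thus "a \<in> {a \<in> ?S. a < rl (Suc j) - 1}"
      using s rl_pos[OF sk] sk by (auto simp: source_set_eq)
  qed
  moreover have "inj_on (\<lambda>s. rl s - 1) {1..j}"
  proof (rule inj_onI)
    fix s s' assume s: "s \<in> {1..j}" "s' \<in> {1..j}" "rl s - 1 = rl s' - 1"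
    hence sk: "s \<in> {1..k}" "s' \<in> {1..k}" using assms by auto
    hence "rl s = rl s'" using s(3) rl_pos[of s] rl_pos[of s'] by linarith
    thus "s = s'" using rl_eq_iff[OF sk] by simp
  qed
  ultimately have "card {a \<in> ?S. a < rl (Suc j) - 1} = j" by (simp add: card_image)
  thus ?thesis using pick_card_in_set[OF in_S] by simp
qed

text \<open>After the pivot columns are normalised to the identity, a nonzero entry of row
  \<open>r\<close> in a column \<open>cl c\<close> left of its pivot would give a nonzero minor at
  the set with \<open>rl r\<close> exchanged for \<open>cl c\<close>, which is lexicographically
  smaller.\<close>

lemma echelon_representative:
  fixes M :: "'a::field mat"
  assumes M: "represents k n M A" and nz: "pluecker M (source_set n k lam) \<noteq> 0"
    and lex: "\<And>J. J \<subseteq> {1..n} \<Longrightarrow> card J = k \<Longrightarrow> lex_less J (source_set n k lam) \<Longrightarrow> pluecker M J = 0"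
  obtains F where "echelon F" "represents k n F A"
proof -
  let ?S = "source_set n k lam"
  have Mc: "M \<in> carrier_mat k n" using M by (simp add: represents_def)
  define X where "X = mat k k (\<lambda>(i, j). M $$ (i, pick {i. Suc i \<in> ?S} j))"
  have X: "X \<in> carrier_mat k k" by (simp add: X_def)
  have "det X \<noteq> 0"
    using nz pluecker_eq_det[OF Mc source_set_subset card_source_set] by (simp add: X_def)
  from det_non_zero_imp_unit[OF X this, of "()"] obtain Y where Y: "Y \<in> carrier_mat k k" "Y * X = 1\<^sub>m k"
    unfolding Units_def by (auto simp: ring_mat_simps)
  have "det Y * det X = 1" using det_mult[OF Y(1) X] Y(2) by simp
  hence detY: "det Y \<noteq> 0" by auto
  let ?F = "Y * M"
  have Fc: "?F \<in> carrier_mat k n" using Y Mc by simp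
  have ent: "?F $$ (i, t - 1) = entry ?F (Suc i) t" if "t \<in> {1..n}" for i t
    using that by (simp add: entry_def)
  have piv: "entry ?F r (rl s) = (if r = s then 1 else 0)" if r: "r \<in> {1..k}" and s: "s \<in> {1..k}" for r s
  proof -
    have rs: "r - 1 < k" "s - 1 < k" "Suc (s - 1) = s" "Suc (r - 1) = r" using r s by auto
    have t: "rl s - 1 < n" "rl s \<in> {1..n}" using rl_range[OF s] by auto
    have "entry ?F r (rl s) = (\<Sum>i = 0..<k. Y $$ (r - 1, i) * M $$ (i, rl s - 1))"
      using t rs Y Mc by (simp add: entry_def scalar_prod_def)
    also have "\<dots> = (Y * X) $$ (r - 1, s - 1)"
      using rs Y(1) pick_source_set[OF rs(2)] by (simp add: scalar_prod_def X_def)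
    also have "\<dots> = (if r = s then 1 else 0)" using rs Y(2) by auto
    finally show ?thesis .
  qed
  have zero: "entry ?F r (cl c) = 0" if r: "r \<in> {1..k}" and c: "c \<in> {1..m}" and lt: "lam r < c" for r c
  proof (rule ccontr)
    assume ne: "entry ?F r (cl c) \<noteq> 0"
    let ?t = "cl c"
    have tr: "?t < rl r" using rl_cl[OF r c] lt by simp
    have tS: "?t \<notin> ?S" using rl_neq_cl[OF _ c] unfolding source_set_eq by force
    have rS: "rl r \<in> ?S" using r by (simp add: source_set_eq)
    define l where "l i = (if Suc i = r then ?t else rl (Suc i))" for i
    define J where "J = insert ?t (?S - {rl r})"
    have finS: "finite ?S" using source_set_subset finite_subset by blast
    have cJ: "card J = k"
    proof -
      have "k > 0" using r by auto
      thus ?thesis using tS rS finS card_source_set by (simp add: J_def card_Diff_singleton)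
    qed
    have Jn: "J \<subseteq> {1..n}" using source_set_subset cl_range[OF c] by (auto simp: J_def)
    have "lex_less J ?S"
      by (rule lex_lessI[of _ _ ?t]) (use finS cJ card_source_set tS tr in \<open>auto simp: J_def\<close>)
    hence "pluecker M J = 0" using lex[OF Jn cJ] by simp
    hence "pluecker ?F J = 0" using pluecker_mult[OF Y(1) Mc Jn cJ] by simp
    moreover have "pluecker ?F J \<noteq> 0"
    \<comment> \<open>Column \<open>?t\<close> gets the lowest rank, which is free because labels
      start from 1. The other rows then lead with their own pivots whatever they have in
      \<open>?t\<close>, and row \<open>r\<close>, whose pivot is not in \<open>J\<close>, is left
      with \<open>?t\<close>.\<close>
    proof (rule pluecker_nonzero_if_lead[OF Fc Jn cJ, where l = l and rk = "\<lambda>u. if u = ?t then 0 else u"])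
      have inj: "inj_on l {0..<k}"
      proof (rule inj_onI)
        fix i i' assume i: "i \<in> {0..<k}" "i' \<in> {0..<k}" "l i = l i'"
        hence "Suc i \<in> {1..k}" "Suc i' \<in> {1..k}" by auto
        thus "i = i'" using i(3) rl_neq_cl[OF _ c, of "Suc i"] rl_neq_cl[OF _ c, of "Suc i'"]
            rl_eq_iff[of "Suc i" "Suc i'"] by (auto simp: l_def split: if_splits)
      qed
      have "l i \<in> J" if "i < k" for i
        using that rl_eq_iff[of "Suc i" r] r by (auto simp: l_def J_def source_set_eq)
      hence "l ` {0..<k} \<subseteq> J" by auto
      hence "l ` {0..<k} = J"
        using card_image[OF inj] cJ finS by (intro card_subset_eq) (auto simp: J_def)
      thus "bij_betw l {0..<k} J" using inj by (simp add: bij_betw_def)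
      show "?F $$ (i, l i - 1) \<noteq> 0" if "i < k" for i
      proof (cases "Suc i = r")
        case True
        thus ?thesis using ne ent[OF cl_range[OF c], of i] by (simp add: l_def)
      next
        case False
        thus ?thesis using that ent[of "rl (Suc i)" i] rl_range[of "Suc i"] piv[of "Suc i" "Suc i"]
          by (simp add: l_def)
      qed
      show "inj_on (\<lambda>u. if u = ?t then 0 else u) J" using Jn by (auto simp: inj_on_def split: if_splits)
      show "(if u = ?t then 0 else u) \<le> (if l i = ?t then 0 else l i)"
        if i: "i < k" and u: "u \<in> J" and nzu: "?F $$ (i, u - 1) \<noteq> 0" for i u
      proof (cases "u = ?t")
        case False
        hence "u \<in> ?S" "u \<noteq> rl r" using u by (auto simp: J_def)
        then obtain s where s: "s \<in> {1..k}" "u = rl s" "s \<noteq> r" unfolding source_set_eq by blast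
        have "entry ?F (Suc i) (rl s) \<noteq> 0" using nzu s ent[OF rl_range[OF s(1)], of i] by simp
        hence "s = Suc i" using piv[of "Suc i" s] s i by (auto split: if_splits)
        thus ?thesis using s tS by (auto simp: l_def source_set_eq)
      qed simp
    qed
    ultimately show False by simp
  qed
  have "echelon ?F" unfolding echelon_def using Fc piv zero by blast
  thus thesis using that represents_mult[OF M Y(1) detY] by blast
qed

section \<open>Uniqueness of the values on the edges\<close>

lemma edge_system_unique:
  assumes S: "edge_system st h\<^sub>0 v\<^sub>0 H V" "edge_system st h\<^sub>0 v\<^sub>0 H' V'"
  shows "r \<in> {1..k} \<Longrightarrow> c \<le> lam r \<Longrightarrow> H r c = H' r c"
    and "c \<in> {1..m} \<Longrightarrow> r \<le> len c \<Longrightarrow> V r c = V' r c"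
proof -
  let ?P = "\<lambda>r c. H r c = H' r c" and ?Q = "\<lambda>r c. V r c = V' r c"
  have 1: "?P r (lam r)" if "r \<in> {1..k}" for r
    using edge_system_row[OF S(1) that] edge_system_row[OF S(2) that] by simp
  have 2: "?Q (len c) c" if "c \<in> {1..m}" for c
    using edge_system_col[OF S(1) that] edge_system_col[OF S(2) that] by simp
  have 3: "?P r (c - 1) \<and> ?Q (r - 1) c" if b: "(r, c) \<in> B" "?P r c" "?Q r c" for r c
    using edge_system_box[OF S(1) b(1)] edge_system_box[OF S(2) b(1)] b(2,3) by simp
  note ind = edge_induct_nw'[where P = ?P and Q = ?Q, OF 1 2 3]
  show "r \<in> {1..k} \<Longrightarrow> c \<le> lam r \<Longrightarrow> ?P r c" by (rule ind(1))
  show "c \<in> {1..m} \<Longrightarrow> r \<le> len c \<Longrightarrow> ?Q r c" by (rule ind(2))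
qed

text \<open>The rule of a box is invertible in the direction of the network: its left and lower value
  determine the right and upper one.\<close>

lemma vector_system_unique:
  assumes S: "edge_system (vector_step D p) h\<^sub>0 v\<^sub>0 H V" "edge_system (vector_step D p) h\<^sub>0' v\<^sub>0 H' V'"
    and p: "\<And>b. b \<in> B \<Longrightarrow> D b = Plus \<Longrightarrow> p b \<noteq> 0"
    and left: "\<And>r. r \<in> {1..k} \<Longrightarrow> H r 0 = H' r 0"
  shows "r \<in> {1..k} \<Longrightarrow> c \<le> lam r \<Longrightarrow> H r c = H' r c"
proof -
  let ?P = "\<lambda>r c. H r c = H' r c" and ?Q = "\<lambda>r c. V r c = V' r c"
  have 2: "?Q (len c) c" if "c \<in> {1..m}" for c
    using edge_system_col[OF S(1) that] edge_system_col[OF S(2) that] by simp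
  have 3: "?P r c \<and> ?Q (r - 1) c" if b: "(r, c) \<in> B" "?P r (c - 1)" "?Q r c" for r c
  proof -
    have eq: "fst (vector_step D p (r, c) (H r c) (V r c)) = fst (vector_step D p (r, c) (H' r c) (V r c))"
      using b(2,3) edge_system_left[OF S(1) b(1)] edge_system_left[OF S(2) b(1)] by simp
    have "H r c t = H' r c t" for t
      using p[OF b(1)] fun_cong[OF eq, of t] by (cases "D (r, c)") (simp_all add: vector_step_def)
    hence "H r c = H' r c" by blast
    thus ?thesis
      using b(3) edge_system_up[OF S(1) b(1)] edge_system_up[OF S(2) b(1)] by simp
  qed
  note ind = edge_induct_sw[where P = ?P and Q = ?Q, OF left 2 3]
  show "r \<in> {1..k} \<Longrightarrow> c \<le> lam r \<Longrightarrow> ?P r c" by (rule ind(1))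
qed

text \<open>The box rules are linear, and the projection fixes the unit vectors of non-pivot
  columns.\<close>

lemma reduce_system:
  assumes N: "vector_system D p NH NV"
  shows "edge_system (vector_step D p) (\<lambda>r. reduce M (unit_at (rl r))) (\<lambda>c. unit_at (cl c))
    (\<lambda>r c. reduce M (NH r c)) (\<lambda>r c. reduce M (NV r c))"
  unfolding edge_system_def
proof (intro conjI ballI allI impI)
  show "reduce M (NH r (lam r)) = reduce M (unit_at (rl r))" if "r \<in> {1..k}" for r
    using edge_system_row[OF N that] by simp
  show "reduce M (NV (len c) c) = unit_at (cl c)" if "c \<in> {1..m}" for c
    using edge_system_col[OF N that] reduce_unit_col[OF that] by auto
  fix r c assume b: "(r, c) \<in> B"
  show "vector_step D p (r, c) (reduce M (NH r c)) (reduce M (NV r c)) =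
      (reduce M (NH r (c - 1)), reduce M (NV (r - 1) c))"
    unfolding edge_system_left[OF N b] edge_system_up[OF N b]
    by (auto simp: vector_step_def fun_eq_iff reduce_linear split: filling.splits)
qed

end

section \<open>Consistency characterises the weight matrix\<close>

context weighted_network
begin

abbreviation W where "W \<equiv> weight_matrix n k lam D a c"

lemma reduce_weight_matrix: "r \<in> {1..k} \<Longrightarrow> reduce W (unit_at (rl r)) = SH r (lam r)"
  by (simp add: fun_eq_iff reduce_unit_row weight_matrix_entry)

text \<open>Projected vectors and signed path sums solve the same system with the same southeast
  border, so they agree. Left of box \<open>(r, j)\<close> the sink \<open>cl j\<close> is out of
  reach, which is the vanishing that consistency demands.\<close>

lemma weight_matrix_consistent:
  assumes nz: "\<And>b. b \<in> B \<Longrightarrow> D b = Plus \<Longrightarrow> box_weight b \<noteq> 0"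
    and V: "vector_system D box_weight NH NV" and b: "(r, j) \<in> B"
  shows "consistent D box_weight W NH (r, j)"
proof -
  have r: "r \<in> {1..k}" "j \<le> lam r" and j: "j \<in> {1..m}" "r \<le> len j" using b box_iff box_iff' by auto
  have "edge_system (vector_step D box_weight) (\<lambda>r. reduce W (unit_at (rl r))) (\<lambda>j. unit_at (cl j)) SH SV"
    using signed_system[OF nz] reduce_weight_matrix by (simp add: edge_system_def)
  from edge_system_unique(1)[OF reduce_system[OF V] this r]
  have H: "reduce W (NH r j) = SH r j" .
  have "cl j \<notin> cl ` {1..j - 1}" using cl_eq_iff j by fastforce
  hence "SH r (j - 1) (cl j) = 0"
    using path_support(1)[OF r(1), of "j - 1"] r by (simp add: SH_def)
  hence z: "fst (vector_step D box_weight (r, j) (SH r j) (SV r j)) (cl j) = 0"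
    using edge_system_left[OF signed_system[OF nz] b] by simp
  have sv: "SV r j (cl j) = edge_sign r j" using SV_pivot[OF j] .
  have solve: "w = - edge_sign r j * x" if "x + w * edge_sign r j = 0" for w x :: 'a
  proof -
    have "0 = (x + w * edge_sign r j) * edge_sign r j" using that by simp
    also have "\<dots> = x * edge_sign r j + w" by (simp add: algebra_simps)
    finally show ?thesis by (simp add: eq_neg_iff_add_eq_0 add.commute mult.commute)
  qed
  show ?thesis
  proof (cases "D (r, j)")
    case Plus
    have w: "box_weight (r, j) \<noteq> 0" using nz[OF b Plus] .
    hence "SH r j (cl j) + box_weight (r, j) * edge_sign r j = 0"
      using z sv Plus by (simp add: vector_step_def field_simps)
    thus ?thesis using solve w Plus by (simp add: consistent_def H)
  next
    case Black
    thus ?thesis using z sv solve by (simp add: vector_step_def consistent_def H)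
  next
    case White
    thus ?thesis using z by (simp add: vector_step_def consistent_def H)
  qed
qed

text \<open>Consistency makes the projected vectors vanish on the left border, as the path sums do.
  Solving back towards the right border makes both agree there, and row \<open>r\<close> of the
  matrix can be read off from the value at the end of row \<open>r\<close>.\<close>

lemma eq_weight_matrix:
  assumes M: "echelon M" and V: "vector_system D box_weight NH NV"
    and cons: "\<And>b. b \<in> B \<Longrightarrow> consistent D box_weight M NH b"
  shows "M = W"
proof -
  have nz: "box_weight b \<noteq> 0" if "b \<in> B" "D b = Plus" for b
    using cons[OF that(1)] that(2) by (cases b) (auto simp: consistent_def)
  have "reduce M (NH r 0) = SH r 0" if "r \<in> {1..k}" for r
    using reduce_support(1)[OF M V that _ cons, of 0] by (simp add: fun_eq_iff SH_def PH_border)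
  from vector_system_unique[OF reduce_system[OF V] signed_system[OF nz] nz this]
  have eq: "reduce M (NH r (lam r)) = SH r (lam r)" if "r \<in> {1..k}" for r using that by blast
  have ent: "entry M r t = entry W r t" if "r \<in> {1..k}" for r t
  proof -
    have "reduce M (unit_at (rl r)) t = reduce W (unit_at (rl r)) t"
      using eq[OF that] unfolding edge_system_row[OF V that] reduce_weight_matrix[OF that] by simp
    thus ?thesis unfolding reduce_unit_row[OF that] by simp
  qed
  show ?thesis
  proof (rule eq_matI)
    show "dim_row M = dim_row W" "dim_col M = dim_col W"
      using echelon_carrier[OF M] echelon_carrier[OF echelon_weight_matrix] by auto
    fix i j assume "i < dim_row W" "j < dim_col W"
    hence "i < k" "j < n" by (auto simp: weight_matrix_def)
    thus "M $$ (i, j) = W $$ (i, j)" using ent[of "Suc i" "Suc j"] by (simp add: entry_def)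
  qed
qed

end

section \<open>Greedy parameters and the criterion for echelon matrices\<close>

context partition_shape
begin

text \<open>The parameter prescribed by consistency depends only on the vector on the right edge, so
  the rule of the box can compute it on the spot; one recursion yields the vectors and the
  parameters together.\<close>

lemma greedy_system:
  fixes M :: "'a::field mat"
  obtains p NH NV where "vector_system D p NH NV"
    "\<And>r c. p (r, c) = - edge_sign r c * reduce M (NH r c) (cl c)"
proof -
  define g where "g b h = (case b of (r, c) \<Rightarrow> - edge_sign r c * reduce M h (cl c))" for b :: box and h
  obtain NH NV where S: "edge_system (\<lambda>b h v. vector_step D (\<lambda>b. g b h) b h v)
      (\<lambda>r. unit_at (rl r)) (\<lambda>c. unit_at (cl c)) NH NV"
    using edge_system_exists .
  define p where "p b = (case b of (r, c) \<Rightarrow> g b (NH r c))" for b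
  have "vector_step D (\<lambda>b. g b (NH r c)) (r, c) h v = vector_step D p (r, c) h v" for r c h v
    by (simp add: vector_step_def p_def cong: filling.case_cong)
  hence "vector_system D p NH NV" using S by (simp add: edge_system_def)
  thus thesis by (rule that) (simp add: p_def g_def)
qed

text \<open>The fact \<open>key\<close> needs consistency southeast of the box. For a weight matrix
  it is given; for the greedy parameters it is the induction hypothesis, and black stones are
  consistent by construction.\<close>

lemma weight_matrix_iff_pluecker:
  fixes M :: "'a::field mat"
  assumes go: "go_diagram n k lam D" and M: "echelon M"
  shows "(\<exists>a c. (\<forall>b\<in>B. D b = Plus \<longrightarrow> a b \<noteq> 0) \<and> M = weight_matrix n k lam D a c) \<longleftrightarrow>
    (\<forall>b\<in>B. D b = White \<longrightarrow> pluecker M (box_set n k lam D b) = 0) \<and>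
    (\<forall>b\<in>B. D b = Plus \<longrightarrow> pluecker M (box_set n k lam D b) \<noteq> 0)" (is "?L \<longleftrightarrow> ?R")
proof -
  obtain LH LV where L: "label_system D LH LV" using edge_system_exists .
  have up: "LH r c < LV r c" if "(r, c) \<in> B" "D (r, c) \<noteq> Black" for r c
    using go_diagram_labels[OF L go that(1)] that(2) by simp
  have down: "LV r c < LH r c" if "(r, c) \<in> B" "D (r, c) = Black" for r c
    using go_diagram_labels[OF L go that(1)] that(2) by simp
  have key: "pluecker M (box_set n k lam D (r, c)) = 0 \<longleftrightarrow> reduce M (NH r c) (cl c) = 0"
    if "vector_system D p NH NV" "(r, c) \<in> B" "D (r, c) \<noteq> Black"
      "\<And>r' c'. (r', c') \<in> B \<Longrightarrow> r \<le> r' \<Longrightarrow> c \<le> c' \<Longrightarrow> (r', c') \<noteq> (r, c) \<Longrightarrow>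
         consistent D p M NH (r', c')" for p NH NV r c
    unfolding box_set_labels(1)[OF L that(2)]
    by (rule pluecker_outer_label[OF M L that(1) _ _ that(2) up[OF that(2,3)] that(4)
          box_set_labels(2,3)[OF L that(2)]]) (use up down in auto)
  show ?thesis
  proof
    assume ?L
    then obtain a c where ac: "\<forall>b\<in>B. D b = Plus \<longrightarrow> a b \<noteq> 0" "M = weight_matrix n k lam D a c" by blast
    interpret weighted_network n k lam D a c by unfold_locales
    have nz: "box_weight b \<noteq> 0" if "b \<in> B" "D b = Plus" for b
      using ac(1) that by (simp add: box_weight_def)
    obtain NH NV where V: "vector_system D box_weight NH NV" using edge_system_exists .
    have cons: "consistent D box_weight M NH (r, j)" if "(r, j) \<in> B" for r j
      using weight_matrix_consistent[OF nz V that] ac(2) by simp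
    have "pluecker M (box_set n k lam D (r, j)) = 0 \<longleftrightarrow> D (r, j) = White"
      if "(r, j) \<in> B" "D (r, j) \<noteq> Black" for r j
      using key[OF V that cons] cons[OF that(1)] that(2)
      by (auto simp: consistent_def split: filling.splits)
    thus ?R by force
  next
    assume R: ?R
    obtain p NH NV where V: "vector_system D p NH NV"
      and p: "\<And>r c. p (r, c) = - edge_sign r c * reduce M (NH r c) (cl c)"
      using greedy_system[of D M] by blast
    have cons: "(r, c) \<in> B \<longrightarrow> consistent D p M NH (r, c)" for r c
    proof (induction "(k - r) + (m - c)" arbitrary: r c rule: less_induct)
      case less
      show ?case
      proof
        assume b: "(r, c) \<in> B"
        have se: "consistent D p M NH (r', c')"
          if "(r', c') \<in> B" "r \<le> r'" "c \<le> c'" "(r', c') \<noteq> (r, c)" for r' c'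
        proof -
          have "r' \<le> k" "c' \<le> m" using that(1) box_col[of r' c'] by (auto simp: box_iff)
          hence "(k - r') + (m - c') < (k - r) + (m - c)" using that by auto
          thus ?thesis using less that(1) by blast
        qed
        show "consistent D p M NH (r, c)"
        proof (cases "D (r, c) = Black")
          case True
          thus ?thesis by (simp add: consistent_def p)
        next
          case False
          from key[OF V b False se] show ?thesis using R b False
            by (cases "D (r, c)") (auto simp: consistent_def p)
        qed
      qed
    qed
    \<comment> \<open>Pluses take their weight from \<open>a\<close> and black stones from
      \<open>c\<close>, so \<open>p\<close> can serve as both.\<close>
    interpret weighted_network n k lam D p p by unfold_locales
    have bw: "box_weight = p" by (simp add: fun_eq_iff box_weight_def)
    have "consistent D p M NH b" if "b \<in> B" for b using cons[of "fst b" "snd b"] that by simp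
    hence "M = weight_matrix n k lam D p p" by (rule eq_weight_matrix[OF M, unfolded bw, OF V])
    moreover have "p b \<noteq> 0" if "b \<in> B" "D b = Plus" for b
    proof (cases b)
      case (Pair r c)
      hence D: "D (r, c) = Plus" and "consistent D p M NH (r, c)" using cons[of r c] that by auto
      from this(2) show ?thesis unfolding consistent_def prod.case D filling.case Pair by blast
    qed
    ultimately show ?L by blast
  qed
qed

lemma box_set_in_grassmannian:
  assumes go: "go_diagram n k lam D" and b: "b \<in> B"
  shows "box_set n k lam D b \<subseteq> {1..n}" "card (box_set n k lam D b) = k"
proof -
  obtain LH LV where L: "label_system D LH LV" using edge_system_exists .
  obtain r c where rc: "b = (r, c)" by fastforce
  note S = box_set_labels[OF L b[unfolded rc]]
  show "card (box_set n k lam D b) = k" using card_image[OF S(2)] S(1) rc by simp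
  have "r' \<in> {1..k} \<Longrightarrow> outer_label LH LV (r, c) r' \<in> {1..n}" for r'
  proof -
    assume r': "r' \<in> {1..k}"
    have "(r, c) \<in> B" using b rc by simp
    hence "c \<in> {1..m}" "r \<le> len c" by (simp_all add: box_iff')
    hence "LV r c \<in> rl ` {Suc r..k} \<union> cl ` {c..m}" by (rule label_support(2)[OF L])
    moreover have "LH r' (outer_col (r, c) r') \<in> rl ` {r'..k} \<union> cl ` {Suc (outer_col (r, c) r')..m}"
      by (rule label_support(1)[OF L r']) (simp add: outer_col_def)
    moreover have "rl ` {x..k} \<union> cl ` {y..m} \<subseteq> {1..n}" if "1 \<le> x" "1 \<le> y" for x y
      using that labels_union by (metis (no_types) Icc_subset_Ici_iff Un_mono atLeastatMost_subset_iff image_mono order_refl)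
    moreover have "1 \<le> r'" "1 \<le> c" "1 \<le> Suc x" for x using r' \<open>c \<in> {1..m}\<close> by auto
    ultimately have "LV r c \<in> {1..n}" "LH r' (outer_col (r, c) r') \<in> {1..n}" by blast+
    thus ?thesis by (simp add: outer_label_def)
  qed
  thus "box_set n k lam D b \<subseteq> {1..n}" unfolding rc S(1) by blast
qed

end

theorem theorem7p8:
  fixes n k :: nat and lam :: "nat \<Rightarrow> nat" and D :: "box \<Rightarrow> filling"
    and A :: "'a::field vec set" and M :: "'a mat"
  assumes "k \<le> n"
    and "partition_in_rect k (n - k) lam"
    and "go_diagram n k lam D"
    and "A \<in> grassmannian k n"
    and "represents k n M A"
  shows "A \<in> deodhar_component n k lam D \<longleftrightarrow>
      (\<forall>b \<in> boxes k lam. D b = White \<longrightarrow> pluecker M (box_set n k lam D b) = 0) \<and>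
      (\<forall>b \<in> boxes k lam. D b = Plus \<longrightarrow> pluecker M (box_set n k lam D b) \<noteq> 0) \<and>
      pluecker M (source_set n k lam) \<noteq> 0 \<and>
      (\<forall>J. J \<subseteq> {1..n} \<and> card J = k \<and> lex_less J (source_set n k lam) \<longrightarrow> pluecker M J = 0)"
proof -
  interpret partition_shape n k lam using assms by unfold_locales
  have same: "pluecker M J = 0 \<longleftrightarrow> pluecker F J = 0"
    if "echelon F" "represents k n F A" "J \<subseteq> {1..n}" "card J = k" for F J
    using represents_pluecker[OF assms(5) that(2) source_set_subset card_source_set
        echelon_pluecker_source[OF that(1)] that(3,4)] .
  \<comment> \<open>Weight matrices are in echelon form themselves, so membership can be tested on
    echelon representatives of \<open>A\<close>.\<close>
  have component: "A \<in> deodhar_component n k lam D \<longleftrightarrow>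
      (\<exists>F. echelon F \<and> represents k n F A \<and>
         (\<exists>a c. (\<forall>b\<in>B. D b = Plus \<longrightarrow> a b \<noteq> 0) \<and> F = weight_matrix n k lam D a c))"
  proof -
    have "echelon (weight_matrix n k lam D a c)" for a c :: "box \<Rightarrow> 'a"
    proof -
      interpret weighted_network n k lam D a c by unfold_locales
      show ?thesis by (rule echelon_weight_matrix)
    qed
    thus ?thesis using assms(4) by (auto simp: deodhar_component_def)
  qed
  show ?thesis (is "_ \<longleftrightarrow> ?R")
  proof
    assume "A \<in> deodhar_component n k lam D"
    then obtain F where F: "echelon F" "represents k n F A"
      "\<exists>a c. (\<forall>b\<in>B. D b = Plus \<longrightarrow> a b \<noteq> 0) \<and> F = weight_matrix n k lam D a c"
      using component by blast
    from F(3) show ?R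
      unfolding weight_matrix_iff_pluecker[OF assms(3) F(1)]
      using same[OF F(1,2)] box_set_in_grassmannian[OF assms(3)]
        echelon_pluecker_source[OF F(1)] echelon_pluecker_lex[OF F(1)]
        source_set_subset card_source_set by simp
  next
    assume R: ?R
    then obtain F where F: "echelon F" "represents k n F A"
      using echelon_representative[OF assms(5)] by blast
    have "\<exists>a c. (\<forall>b\<in>B. D b = Plus \<longrightarrow> a b \<noteq> 0) \<and> F = weight_matrix n k lam D a c"
      unfolding weight_matrix_iff_pluecker[OF assms(3) F(1)]
      using R same[OF F] box_set_in_grassmannian[OF assms(3)] by simp
    thus "A \<in> deodhar_component n k lam D" using component F by blast
  qed
qed

end
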